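(* Suppose Assumption 1 holds and $\theta>0$. Let $(\sigma_n)$ be a positive sequence with $\sigma_n\to0$, and let $\mathcal{E}_n=\mathbb{E}[(Y_{n,1}-X_{n,1})^2\alpha_n(X_n,Y_n)]$ with $\alpha_n(X_n,Y_n)=\min\{1,\exp(\sum_{i=1}^n\rho_n(X_{n,i},Y_{n,i}))\}$. (a) If $\lim_n n^{1/6}\sigma_n=0$ or $\lim_n n^{1/6}\sigma_n=\infty$, then $n^{1/3}\mathcal{E}_n\to0$. (b) If $\lim_n n^{1/6}\sigma_n=\ell\in(0,\infty)$, then $n^{1/3}\mathcal{E}_n\to h(\ell)=2\ell^2\Phi(-\ell^3\theta/2)$, with $\Phi$ the standard normal distribution function. (c) $h$ has a unique maximiser $\ell^*\in(0,\infty)$; it is given by $(\ell^* )^3\theta/2=s^*$ where $s^*$ is the unique positive solution of $s\,\varphi(s)/\Phi(-s)=2/3$ ($\varphi$ the standard normal density); the corresponding limiting acceptance rate is $2\Phi(-s^* )\approx0.574$, and $h(\ell^* )=C_h\theta^{-2/3}$ with $C_h=2^{5/3}(s^* )^{2/3}\Phi(-s^* )\approx0.652$.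
   Context: Let $\phi:\mathbb{R}\to\mathbb{R}$ be such that $\pi(x)=e^{\phi(x)}$ is a probability density on $\mathbb{R}$. A balancing function is $g:[0,\infty)\to[0,\infty)$ with $g(0)=0$ and $g(t)=tg(1/t)$ for $t>0$; normalize $g(1)=1$ and set $b(x)=\log g(e^x)$, $\mathfrak g=g''(1)$. Let $\mu$ be a centred symmetric probability distribution on $\mathbb{R}$ and $\mu_k=\int z^k\mu(dz)$. For $\sigma>0$ let $Z_\sigma(x)=\int g(e^{\sigma z\phi'(x)})\mu(dz)$ and let $Q_\sigma(x,\cdot)$ be the law of $x+\sigma W$ where $W$ has distribution $Z_\sigma(x)^{-1}g(e^{\sigma w\phi'(x)})\mu(dw)$. For $X\sim\pi$, $Y\sim Q_{\sigma_n}(X,\cdot)$, $\rho_n(X,Y)=\log\frac{\pi(dy)Q_{\sigma_n}(y,dx)}{\pi(dx)Q_{\sigma_n}(x,dy)}$ on the symmetric set where this Radon–Nikodym derivative is positive and finite, and $0$ otherwise. In dimension $n$, $X_n=(X_{n,1},\dots,X_{n,n})\sim\prod_i\pi(x_i)dx_i$ and $Y_n\sim\prod_iQ_{\sigma_n}(X_{n,i},dy_i)$. $A_\phi=\mathbb{E}_\pi[(\phi''')^2]$, $B_\phi=\mathbb{E}_\pi[(\phi'\phi'')^2]$, $C_\phi=\mathbb{E}_\pi[\phi'\phi''\phi''']$, and $\theta^2=\mu_6\{\tfrac{1}{144}A_\phi+(\tfrac14+\mathfrak g)^2B_\phi-\tfrac16(\tfrac14+\mathfrak g)C_\phi\}+\mu_4\{\tfrac16(\tfrac12+\mathfrak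 g)C_\phi-2(\tfrac14+\mathfrak g)(\tfrac12+\mathfrak g)B_\phi\}+(\tfrac12+\mathfrak g)^2B_\phi$ with $\theta\ge0$. Assumption 1: there are constants $H\in(0,1)$, $\gamma>0$, $\beta\ge0$, $\epsilon>0$ such that (i) $\phi\in\mathcal{C}^{3+H}(\mathbb{R})$ and for each $f\in\{\phi''',\phi''\phi',(\phi')^3,\phi''|\phi'|^{1+\beta}\}$, $\int|f|^{2+\epsilon}(1+|\phi'|^\beta)\pi\,dx<\infty$ and $|f(x+\delta)-f(x)|\le K(x)\max(|\delta|^H,|\delta|^\gamma)$ for all $x,\delta$, with $\int K^2(1+|\phi'|^\beta)\pi\,dx<\infty$; (ii) $b\in\mathcal{C}^3(\mathbb{R})$ with $b',b'',b'''$ bounded; (iii) $\int z^2\mu(dz)=1$, $\int|z|^\xi\mu(dz)<\infty$ with $\xi=\max(6+3\epsilon,2+2H,2+2\gamma)$, and for some $C_\mu>0$ and all $a$, $\int e^{b(az)}|z|^\xi\mu(dz)\le C_\mu(1+|a|^\beta)\int e^{b(az)}\mu(dz)<\infty$.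
   Formalization: The approximation C_h ≈ 0.652 is left out because it is false: with s* ≈ 0.5618 the stated formula C_h = 2^{5/3}(s* )^{2/3}Φ(−s* ) gives about 0.6207; the exact formula for h(ℓ* ) is proved instead. *)

theory Defs
  imports "HOL-Probability.Probability"
begin

text \<open>Power with the mathematical convention t^0 = 1 (Isabelle has 0 powr 0 = 0).\<close>
definition npow :: "real \<Rightarrow> real \<Rightarrow> real" where
  "npow x a = (if a = 0 then 1 else x powr a)"

definition piM :: "(real \<Rightarrow> real) \<Rightarrow> real measure" where
  "piM phi = density lborel (\<lambda>x. ennreal (exp (phi x)))"

definition Phi :: "real \<Rightarrow> real" where
  "Phi x = measure (density lborel std_normal_density) {..x}"

text \<open>Balancing function (with g(1)=1 and g>0 on (0,oo) so that b = log g(e^x) is real-valued).\<close>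
definition balancing :: "(real \<Rightarrow> real) \<Rightarrow> bool" where
  "balancing g \<longleftrightarrow> g 0 = 0 \<and> (\<forall>t>0. g t > 0) \<and> (\<forall>t>0. g t = t * g (1 / t)) \<and> g 1 = 1"

definition bfun :: "(real \<Rightarrow> real) \<Rightarrow> real \<Rightarrow> real" where
  "bfun g x = ln (g (exp x))"

definition gfrak :: "(real \<Rightarrow> real) \<Rightarrow> real" where
  "gfrak g = deriv (deriv g) 1"

definition mom :: "real measure \<Rightarrow> nat \<Rightarrow> real" where
  "mom mu k = (\<integral>z. z ^ k \<partial>mu)"

definition Zs :: "(real \<Rightarrow> real) \<Rightarrow> real measure \<Rightarrow> (real \<Rightarrow> real) \<Rightarrow> real \<Rightarrow> real \<Rightarrow> real" where
  "Zs g mu phi s x = (\<integral>z. g (exp (s * z * deriv phi x)) \<partial>mu)"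

definition Qk :: "(real \<Rightarrow> real) \<Rightarrow> real measure \<Rightarrow> (real \<Rightarrow> real) \<Rightarrow> real \<Rightarrow> real \<Rightarrow> real measure" where
  "Qk g mu phi s x =
     distr (density mu (\<lambda>w. ennreal (g (exp (s * w * deriv phi x)) / Zs g mu phi s x)))
           borel (\<lambda>w. x + s * w)"

definition Jm :: "(real \<Rightarrow> real) \<Rightarrow> real measure \<Rightarrow> (real \<Rightarrow> real) \<Rightarrow> real \<Rightarrow> (real \<times> real) measure" where
  "Jm g mu phi s = piM phi \<bind> (\<lambda>x. distr (Qk g mu phi s x) (borel \<Otimes>\<^sub>M borel) (\<lambda>y. (x, y)))"

definition Jrev :: "(real \<Rightarrow> real) \<Rightarrow> real measure \<Rightarrow> (real \<Rightarrow> real) \<Rightarrow> real \<Rightarrow> (real \<times> real) measure" where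
  "Jrev g mu phi s = distr (Jm g mu phi s) (borel \<Otimes>\<^sub>M borel) (\<lambda>(x, y). (y, x))"

definition rho :: "(real \<Rightarrow> real) \<Rightarrow> real measure \<Rightarrow> (real \<Rightarrow> real) \<Rightarrow> real \<Rightarrow> real \<times> real \<Rightarrow> real" where
  "rho g mu phi s xy =
     (let r = RN_deriv (Jm g mu phi s) (Jrev g mu phi s) xy
      in if 0 < r \<and> r < \<top> then ln (enn2real r) else 0)"

definition jointn :: "(real \<Rightarrow> real) \<Rightarrow> real measure \<Rightarrow> (real \<Rightarrow> real) \<Rightarrow> real \<Rightarrow> nat
    \<Rightarrow> ((nat \<Rightarrow> real) \<times> (nat \<Rightarrow> real)) measure" where
  "jointn g mu phi s n =
     PiM {1..n} (\<lambda>_. piM phi) \<bind>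
       (\<lambda>x. distr (PiM {1..n} (\<lambda>i. Qk g mu phi s (x i)))
                  (PiM {1..n} (\<lambda>_. borel) \<Otimes>\<^sub>M PiM {1..n} (\<lambda>_. borel)) (\<lambda>y. (x, y)))"

definition alphan :: "(real \<Rightarrow> real) \<Rightarrow> real measure \<Rightarrow> (real \<Rightarrow> real) \<Rightarrow> real \<Rightarrow> nat
    \<Rightarrow> (nat \<Rightarrow> real) \<times> (nat \<Rightarrow> real) \<Rightarrow> real" where
  "alphan g mu phi s n xy =
     min 1 (exp (\<Sum>i\<in>{1..n}. rho g mu phi s (fst xy i, snd xy i)))"

definition En :: "(real \<Rightarrow> real) \<Rightarrow> real measure \<Rightarrow> (real \<Rightarrow> real) \<Rightarrow> real \<Rightarrow> nat \<Rightarrow> real" where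
  "En g mu phi s n = (\<integral>xy. (snd xy 1 - fst xy 1)^2 * alphan g mu phi s n xy \<partial>jointn g mu phi s n)"

definition Accn :: "(real \<Rightarrow> real) \<Rightarrow> real measure \<Rightarrow> (real \<Rightarrow> real) \<Rightarrow> real \<Rightarrow> nat \<Rightarrow> real" where
  "Accn g mu phi s n = (\<integral>xy. alphan g mu phi s n xy \<partial>jointn g mu phi s n)"

definition theta :: "(real \<Rightarrow> real) \<Rightarrow> (real \<Rightarrow> real) \<Rightarrow> real measure \<Rightarrow> real" where
  "theta phi g mu =
    (let d1 = deriv phi; d2 = deriv (deriv phi); d3 = deriv (deriv (deriv phi));
         A = (\<integral>x. (d3 x)^2 \<partial>piM phi);
         B = (\<integral>x. (d1 x * d2 x)^2 \<partial>piM phi);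
         C = (\<integral>x. d1 x * d2 x * d3 x \<partial>piM phi);
         gg = gfrak g
     in sqrt (mom mu 6 * (A / 144 + (1/4 + gg)^2 * B - (1/6) * (1/4 + gg) * C)
            + mom mu 4 * ((1/6) * (1/2 + gg) * C - 2 * (1/4 + gg) * (1/2 + gg) * B)
            + (1/2 + gg)^2 * B))"

definition hfun :: "real \<Rightarrow> real \<Rightarrow> real" where
  "hfun th l = 2 * l^2 * Phi (- (l^3 * th / 2))"

definition C3H :: "(real \<Rightarrow> real) \<Rightarrow> real \<Rightarrow> bool" where
  "C3H f H \<longleftrightarrow>
     (\<forall>x. (f has_real_derivative deriv f x) (at x)) \<and>
     (\<forall>x. (deriv f has_real_derivative deriv (deriv f) x) (at x)) \<and>
     (\<forall>x. (deriv (deriv f) has_real_derivative deriv (deriv (deriv f)) x) (at x)) \<and>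
     continuous_on UNIV (deriv (deriv (deriv f))) \<and>
     (\<forall>R. \<exists>L. \<forall>x y. \<bar>x\<bar> \<le> R \<longrightarrow> \<bar>y\<bar> \<le> R \<longrightarrow>
        \<bar>deriv (deriv (deriv f)) x - deriv (deriv (deriv f)) y\<bar> \<le> L * \<bar>x - y\<bar> powr H)"

definition C3bdd :: "(real \<Rightarrow> real) \<Rightarrow> bool" where
  "C3bdd f \<longleftrightarrow>
     (\<forall>x. (f has_real_derivative deriv f x) (at x)) \<and>
     (\<forall>x. (deriv f has_real_derivative deriv (deriv f) x) (at x)) \<and>
     (\<forall>x. (deriv (deriv f) has_real_derivative deriv (deriv (deriv f)) x) (at x)) \<and>
     continuous_on UNIV (deriv (deriv (deriv f))) \<and>
     (\<exists>M. \<forall>x. \<bar>deriv f x\<bar> \<le> M \<and> \<bar>deriv (deriv f) x\<bar> \<le> M \<and> \<bar>deriv (deriv (deriv f)) x\<bar> \<le> M)"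

definition Assumption1 :: "(real \<Rightarrow> real) \<Rightarrow> (real \<Rightarrow> real) \<Rightarrow> real measure \<Rightarrow> bool" where
  "Assumption1 phi g mu \<longleftrightarrow>
    (\<exists>H \<gamma> \<beta> \<epsilon>::real. 0 < H \<and> H < 1 \<and> 0 < \<gamma> \<and> 0 \<le> \<beta> \<and> 0 < \<epsilon> \<and>
      (let d1 = deriv phi; d2 = deriv (deriv phi); d3 = deriv (deriv (deriv phi));
           w = (\<lambda>x. 1 + npow \<bar>d1 x\<bar> \<beta>);
           \<xi> = max (6 + 3 * \<epsilon>) (max (2 + 2 * H) (2 + 2 * \<gamma>))
       in
       \<comment> \<open>(i)\<close>
       C3H phi H \<and>
       (\<forall>f \<in> {d3, \<lambda>x. d2 x * d1 x, \<lambda>x. (d1 x)^3, \<lambda>x. d2 x * \<bar>d1 x\<bar> powr (1 + \<beta>)}.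
          integrable (piM phi) (\<lambda>x. \<bar>f x\<bar> powr (2 + \<epsilon>) * w x) \<and>
          (\<exists>K. integrable (piM phi) (\<lambda>x. (K x)^2 * w x) \<and>
               (\<forall>x \<delta>. \<bar>f (x + \<delta>) - f x\<bar> \<le> K x * max (\<bar>\<delta>\<bar> powr H) (\<bar>\<delta>\<bar> powr \<gamma>)))) \<and>
       \<comment> \<open>(ii)\<close>
       C3bdd (bfun g) \<and>
       \<comment> \<open>(iii)\<close>
       (\<integral>z. z^2 \<partial>mu) = 1 \<and>
       integrable mu (\<lambda>z. \<bar>z\<bar> powr \<xi>) \<and>
       (\<exists>C\<mu>>0. \<forall>a. integrable mu (\<lambda>z. exp (bfun g (a * z))) \<and>
                   integrable mu (\<lambda>z. exp (bfun g (a * z)) * \<bar>z\<bar> powr \<xi>) \<and>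
                   (\<integral>z. exp (bfun g (a * z)) * \<bar>z\<bar> powr \<xi> \<partial>mu)
                     \<le> C\<mu> * (1 + npow \<bar>a\<bar> \<beta>) * (\<integral>z. exp (bfun g (a * z)) \<partial>mu))))"

end

theory Submission
  imports Defs "HOL-Real_Asymp.Real_Asymp"
begin

text \<open>
  Let \<open>\<rho>\<close> be the log-likelihood ratio of the reversed one-coordinate law \<open>J\<close> with respect to \<open>J\<close>.
  Swapping the two coordinates changes the sign of \<open>\<rho>\<close>, and \<open>dJ_rev = e^\<rho> dJ\<close>, so the law \<open>e^(\<rho>/2) dJ\<close>
  is symmetric. With \<open>S\<close> the sum of the \<open>\<rho>_i\<close>, the acceptance probability is
  \<open>min 1 e^S = e^(S/2) e^(-|S|/2)\<close>: the first factor tilts the product law into one under which \<open>S\<close> is a sum of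
  symmetric independent variables with real characteristic function \<open>E[cos(t\<rho>) / cosh(\<rho>/2)]^n\<close>, and the second
  is a bounded continuous function of \<open>S\<close>. Everything thus reduces to
  \<open>E[1 - cos(t\<rho>) / cosh(\<rho>/2)] = \<sigma>^6 (1/8 + t^2/2) \<theta>^2 (1 + o(1))\<close>, which needs only the pointwise limit of
  \<open>\<rho> / \<sigma>^3\<close> and a majorant for its square; no expansion of the mean of \<open>\<rho>\<close> is required. Levy's continuity
  theorem gives the limit of the tilted law, and the same quantity at \<open>t = 0\<close> gives exponential decay when
  \<open>n \<sigma>^6\<close> tends to infinity.
\<close>

section \<open>The normal distribution function and the maximiser of the limit\<close>

text \<open>The usual argument must show that the mean of rho is minus half its variance to order
  sigma^6; here swap symmetry carries that relation. Since cosh(r/2) contributes r^2/8 and cos(t r)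
  contributes t^2 r^2/2, with v the limit of n sigma^6 theta^2 the tilted mass tends to exp(-v/8)
  and its normalised characteristic function to exp(-v t^2/2). Under N(0,v) the mean of exp(-|x|/2)
  is exp(v/8) 2 Phi(-sqrt(v)/2), so the exponentials cancel. The squared jump is itself invariant
  under the swap, so it survives the tilt and alters only one of the n factors, by a quantity
  tending to 1. The obstacle is domination. Local regularity of phi bounds rho only for |sigma w| <=
  1; longer jumps use that the integrand is at most 2 <= 2 |sigma w|^6, hence sixth moments. These
  are moments under the weights e^(b(a w)) with a = sigma phi'(x), controlled only relative to their
  normaliser and with a factor 1 + |a|^beta. So every majorant in x carries the factor 1 +
  |phi'|^beta, and limits in w need uniform tail estimates.\<close>

lemma Phi_eq_cdf: "Phi = cdf std_normal_distribution"
  by (auto simp: Phi_def cdf_def fun_eq_iff)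

lemma Phi_diff: assumes "a \<le> b" shows "Phi b - Phi a = integral {a..b} std_normal_density"
proof -
  interpret real_distribution std_normal_distribution by (rule real_dist_normal_dist)
  have sint: "set_integrable lborel {a<..b} std_normal_density"
    unfolding set_integrable_def by (rule integrable_mult_indicator) auto
  have "Phi b - Phi a = measure std_normal_distribution {a<..b}"
  proof (cases "a = b")
    case False
    then show ?thesis using assms unfolding Phi_eq_cdf by (subst cdf_diff_eq) auto
  qed auto
  also have "\<dots> = integral\<^sup>L std_normal_distribution (indicator {a<..b})" by simp
  also have "\<dots> = (\<integral>x. std_normal_density x * indicator {a<..b} x \<partial>lborel)"
    by (subst integral_density) (auto)
  also have "\<dots> = (LINT x:{a<..b}|lborel. std_normal_density x)"
    by (simp add: set_lebesgue_integral_def mult.commute)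
  also have "\<dots> = integral {a<..b} std_normal_density"
    using sint by (rule set_borel_integral_eq_integral)
  also have "\<dots> = integral {a..b} std_normal_density"
    by (rule integral_subset_negligible[symmetric, THEN sym])
       (auto intro: negligible_subset[of "{a}"])
  finally show ?thesis .
qed

lemma std_normal_density_continuous: "continuous_on S std_normal_density"
  unfolding normal_density_def by (intro continuous_intros) auto

text \<open>Near x, \<open>Phi\<close> differs by a constant from an integral over a compact window,
  where the fundamental theorem of calculus applies.\<close>

lemma Phi_has_derivative: "(Phi has_real_derivative std_normal_density x) (at x)"
proof -
  have "((\<lambda>u. integral {x - 1..u} std_normal_density) has_real_derivative std_normal_density x) (at x within {x - 1..x + 1})"
    by (rule integral_has_real_derivative[OF std_normal_density_continuous]) auto
  then have "((\<lambda>u. integral {x - 1..u} std_normal_density) has_real_derivative std_normal_density x) (at x)"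
    by (simp add: at_within_Icc_at)
  then have "((\<lambda>u. Phi (x - 1) + integral {x - 1..u} std_normal_density) has_real_derivative std_normal_density x) (at x)"
    by (auto intro!: derivative_eq_intros)
  then show ?thesis
  proof (rule has_field_derivative_transform_within_open[where S = "{x-1<..<x+1}"])
    fix u assume "u \<in> {x-1<..<x+1}"
    then show "Phi (x - 1) + integral {x - 1..u} std_normal_density = Phi u"
      using Phi_diff[of "x - 1" u] by auto
  qed auto
qed

lemmas Phi_derivative_chain [derivative_intros] = Phi_has_derivative[THEN DERIV_chain2]

lemma std_normal_density_minus [simp]: "std_normal_density (- x) = std_normal_density x"
  by (simp add: normal_density_def)

text \<open>The sum Phi(-x) + Phi(x) has derivative zero, and its constant value is read off at
  infinity.\<close>

lemma Phi_minus: "Phi (- x) = 1 - Phi x"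
proof -
  interpret real_distribution std_normal_distribution by (rule real_dist_normal_dist)
  have d: "((\<lambda>x. Phi (- x) + Phi x) has_real_derivative 0) (at x)" for x
    by (auto intro!: derivative_eq_intros)
  have eq: "Phi (- x) + Phi x = Phi (- y) + Phi y" for x y
    using DERIV_isconst_all[of "\<lambda>x. Phi (- x) + Phi x"] d by blast
  have "((\<lambda>y. Phi (- y) + Phi y) \<longlongrightarrow> 0 + 1) at_top"
    unfolding Phi_eq_cdf
    by (intro tendsto_add cdf_lim_at_top_prob filterlim_compose[OF cdf_lim_at_bot filterlim_uminus_at_bot_at_top])
  moreover have "((\<lambda>y. Phi (- y) + Phi y) \<longlongrightarrow> Phi (- x) + Phi x) at_top"
    by (subst eq[of _ x]) simp
  ultimately show ?thesis using tendsto_unique[OF trivial_limit_at_top_linorder] by fastforce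
qed

lemma Phi_0: "Phi 0 = 1 / 2" using Phi_minus[of 0] by simp

lemma std_normal_density_derivative:
  "(std_normal_density has_real_derivative (- x * std_normal_density x)) (at x)"
  unfolding normal_density_def by (auto intro!: derivative_eq_intros simp: field_simps)

lemma Phi_strict_mono: "x < y \<Longrightarrow> Phi x < Phi y"
  by (rule DERIV_pos_imp_increasing[of x y]) (blast intro: Phi_has_derivative normal_density_pos zero_less_one)+

lemma Phi_pos: "Phi x > 0"
proof -
  have "Phi (x - 1) \<ge> 0" unfolding Phi_def by simp
  with Phi_strict_mono[of "x - 1" x] show ?thesis by simp
qed

lemmas std_normal_density_chain [derivative_intros] = std_normal_density_derivative[THEN DERIV_chain2]

section \<open>Mills ratio and hazard rate of the normal law\<close>

lemma std_normal_density_le: "std_normal_density s \<le> 1 / sqrt (2 * pi)"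
proof -
  have "(1 / sqrt (2 * pi)) * exp (- s\<^sup>2 / 2) \<le> (1 / sqrt (2 * pi)) * 1"
    by (intro mult_left_mono) simp_all
  then show ?thesis by (simp add: normal_density_def)
qed

text \<open>The function q has derivative -phi(s)/s^2 < 0, with phi the normal density, and tends to
  0 at infinity; hence it is positive.\<close>

lemma Mills_bound: assumes "s > 0" shows "s * Phi (- s) < std_normal_density s"
proof -
  interpret real_distribution std_normal_distribution by (rule real_dist_normal_dist)
  define q where "q s = std_normal_density s / s - Phi (- s)" for s
  have d: "(q has_real_derivative (- std_normal_density s / s\<^sup>2)) (at s)" if "s > 0" for s
    unfolding q_def using that
    by (auto intro!: derivative_eq_intros simp: field_simps power2_eq_square)
  have dec: "q y < q x" if "0 < x" "x < y" for x y
  proof (rule DERIV_neg_imp_decreasing[OF that(2)])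
    fix s assume "x \<le> s" "s \<le> y"
    then have "s > 0" using that by simp
    with d[OF this] show "\<exists>D. (q has_real_derivative D) (at s) \<and> D < 0"
      by (intro exI conjI) (assumption, simp add: divide_pos_pos normal_density_pos)
  qed
  have "((\<lambda>s. std_normal_density s / s) \<longlongrightarrow> 0) at_top"
  proof (rule real_tendsto_sandwich[where f = "\<lambda>_. 0" and h = "\<lambda>s. (1 / sqrt (2 * pi)) / s"])
    have le: "std_normal_density s / s \<le> (1 / sqrt (2 * pi)) / s" if "s > 0" for s
      using that std_normal_density_le by (intro divide_right_mono) auto
    show "\<forall>\<^sub>F s in at_top. std_normal_density s / s \<le> (1 / sqrt (2 * pi)) / s"
      by (rule eventually_mono[OF eventually_gt_at_top[of "0::real"] le])
    show "\<forall>\<^sub>F s in at_top. 0 \<le> std_normal_density s / s"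
      by (rule eventually_mono[OF eventually_gt_at_top[of "0::real"]])
         (intro divide_nonneg_nonneg normal_density_nonneg, linarith)
    show "((\<lambda>s. (1 / sqrt (2 * pi)) / s) \<longlongrightarrow> 0) at_top"
      by (rule tendsto_divide_0[OF tendsto_const])
         (rule filterlim_mono[OF filterlim_ident at_top_le_at_infinity order_refl])
  qed (rule tendsto_const)
  then have "(q \<longlongrightarrow> 0 - 0) at_top" unfolding q_def
    by (intro tendsto_diff)
       (auto simp: Phi_eq_cdf intro!: filterlim_compose[OF cdf_lim_at_bot filterlim_uminus_at_bot_at_top])
  then have lim: "(q \<longlongrightarrow> 0) at_top" by simp
  \<comment> \<open>The limit yields only a weak inequality, so it is taken at s + 1; the strict
    decrease from s to s + 1 then makes q(s) positive.\<close>
  have "q (s + 1) \<ge> 0"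
    by (rule tendsto_upperbound[OF lim])
       (use dec[of "s + 1"] assms in \<open>auto intro!: eventually_mono[OF eventually_gt_at_top[of "s+1"]] less_imp_le\<close>)
  with dec[of s "s + 1"] assms have "q s > 0" by simp
  then show ?thesis using assms by (simp add: q_def field_simps)
qed

text \<open>s times the hazard rate of the standard normal. With s = l^3 theta/2, the critical
  points l > 0 of the limit h are where this equals 2/3.\<close>

definition hazard_ratio :: "real \<Rightarrow> real" where
  "hazard_ratio s = s * std_normal_density s / Phi (- s)"

lemma hazard_ratio_has_derivative:
  "(hazard_ratio has_real_derivative
     std_normal_density s * (Phi (- s) + s * (std_normal_density s - s * Phi (- s))) / (Phi (- s))\<^sup>2) (at s)"
proof -
  let ?f = "std_normal_density s" and ?P = "Phi (- s)"
  have P: "?P > 0" by (rule Phi_pos)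
  have m: "((\<lambda>s. - s) has_real_derivative - 1) (at s)" by (auto intro!: derivative_eq_intros)
  have 1: "((\<lambda>s. s * std_normal_density s) has_real_derivative 1 * ?f + - s * ?f * s) (at s)"
    by (rule DERIV_mult[OF DERIV_ident std_normal_density_derivative])
  have "(hazard_ratio has_real_derivative
    ((1 * ?f + - s * ?f * s) * ?P - s * ?f * (std_normal_density (- s) * - 1)) / (?P * ?P)) (at s)"
    unfolding hazard_ratio_def
    by (rule DERIV_divide[OF 1 Phi_derivative_chain[OF m]]) (use P in simp)
  then show ?thesis
    by (rule DERIV_cong) (simp add: power2_eq_square algebra_simps)
qed

text \<open>The numerator of the derivative contains phi(s) - s Phi(-s), positive by the Mills
  bound.\<close>

lemma hazard_ratio_strict_mono:
  assumes "0 < x" "x < y" shows "hazard_ratio x < hazard_ratio y"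
proof (rule DERIV_pos_imp_increasing[OF assms(2)])
  fix s assume "x \<le> s" "s \<le> y"
  then have s: "s > 0" using assms by simp
  let ?f = "std_normal_density s" and ?P = "Phi (- s)"
  have P: "?P > 0" by (rule Phi_pos)
  have f: "?f > 0" by (rule normal_density_pos) simp
  have "?f * (?P + s * (?f - s * ?P)) / ?P\<^sup>2 > 0"
    using P f Mills_bound[OF s] s by (intro divide_pos_pos mult_pos_pos add_pos_pos) auto
  then show "\<exists>d. (hazard_ratio has_real_derivative d) (at s) \<and> 0 < d"
    using hazard_ratio_has_derivative by blast
qed

section \<open>Rational enclosure of the critical value\<close>

lemma exp_minus_bounds:
  fixes x :: real assumes "x \<ge> 0"
  shows "1 - x + x^2/2 - x^3/6 \<le> exp (- x)" "exp (- x) \<le> 1 - x + x^2/2 - x^3/6 + x^4/24"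
proof -
  obtain t where "exp (- x) = (\<Sum>m<4. (- x) ^ m / fact m) + exp t / fact 4 * (- x) ^ 4"
    using Maclaurin_exp_le[of "- x" 4] by blast
  moreover have "exp t / fact 4 * (- x) ^ 4 \<ge> 0" by simp
  moreover have "(\<Sum>m<4. (- x) ^ m / fact m) = 1 - x + x^2/2 - x^3/6"
    by (simp add: eval_nat_numeral)
  ultimately show "1 - x + x^2/2 - x^3/6 \<le> exp (- x)" by linarith
  obtain t where t: "exp (- x) = (\<Sum>m<5. (- x) ^ m / fact m) + exp t / fact 5 * (- x) ^ 5"
    using Maclaurin_exp_le[of "- x" 5] by blast
  moreover have "exp t / fact 5 * (- x) ^ 5 \<le> 0" using assms by (simp add: mult_nonneg_nonpos)
  moreover have "(\<Sum>m<5. (- x) ^ m / fact m) = 1 - x + x^2/2 - x^3/6 + x^4/24"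
    by (simp add: eval_nat_numeral)
  ultimately show "exp (- x) \<le> 1 - x + x^2/2 - x^3/6 + x^4/24" by linarith
qed

lemma inv_sqrt_2pi_bounds: "0.39894 \<le> 1 / sqrt (2 * pi)" "1 / sqrt (2 * pi) \<le> 0.39895"
proof -
  have "sqrt (2 * pi) \<le> 2.50664" by (rule real_le_lsqrt) (use pi_approx in \<open>auto simp: power2_eq_square\<close>)
  moreover have "2.50662 \<le> sqrt (2 * pi)" by (rule real_le_rsqrt) (use pi_approx in \<open>auto simp: power2_eq_square\<close>)
  ultimately show "0.39894 \<le> 1 / sqrt (2 * pi)" "1 / sqrt (2 * pi) \<le> 0.39895"
    by (auto simp: divide_simps)
qed

text \<open>Alternating Taylor sums at s^2/2. The shorter third bound is the one integrated for the
  lower bound on Phi(-s), where degree 5 is precise enough.\<close>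

lemma std_normal_density_bounds:
  fixes s :: real
  shows "(1 / sqrt (2 * pi)) * (1 - s^2/2 + s^4/8 - s^6/48) \<le> std_normal_density s"
    "std_normal_density s \<le> (1 / sqrt (2 * pi)) * (1 - s^2/2 + s^4/8 - s^6/48 + s^8/384)"
    "std_normal_density s \<le> (1 / sqrt (2 * pi)) * (1 - s^2/2 + s^4/8)"
proof -
  have d: "std_normal_density s = (1 / sqrt (2 * pi)) * exp (- (s^2/2))"
    by (simp add: normal_density_def)
  have p: "(s^2/2)^2 = s^4/4" "(s^2/2)^3 = s^6/8" "(s^2/2)^4 = s^8/16"
    by (simp_all add: power_divide flip: power_mult)
  note e = exp_minus_bounds[of "s^2/2", unfolded p]
  obtain t where t: "exp (- (s^2/2)) = (\<Sum>m<3. (- (s^2/2)) ^ m / fact m) + exp t / fact 3 * (- (s^2/2)) ^ 3"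
    using Maclaurin_exp_le[of "- (s^2/2)" 3] by blast
  moreover have "exp t / fact 3 * (- (s^2/2)) ^ 3 \<le> 0" by (simp add: mult_nonneg_nonpos)
  moreover have "(\<Sum>m<3. (- (s^2/2)) ^ m / fact m) = 1 - s^2/2 + s^4/8"
    by (simp add: eval_nat_numeral)
  ultimately have e3: "exp (- (s^2/2)) \<le> 1 - s^2/2 + s^4/8" by linarith
  show "(1 / sqrt (2 * pi)) * (1 - s^2/2 + s^4/8 - s^6/48) \<le> std_normal_density s"
    "std_normal_density s \<le> (1 / sqrt (2 * pi)) * (1 - s^2/2 + s^4/8 - s^6/48 + s^8/384)"
    "std_normal_density s \<le> (1 / sqrt (2 * pi)) * (1 - s^2/2 + s^4/8)"
    unfolding d using e e3 by (intro mult_left_mono; simp)+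
qed

text \<open>Integrates the density bounds from 0, where \<open>Phi\<close> equals 1/2, by comparing
  derivatives.\<close>

lemma Phi_neg_bounds:
  assumes "s \<ge> 0"
  shows "Phi (- s) \<le> 1/2 - (1 / sqrt (2 * pi)) * (s - s^3/6 + s^5/40 - s^7/336)"
    "1/2 - (1 / sqrt (2 * pi)) * (s - s^3/6 + s^5/40) \<le> Phi (- s)"
proof -
  define c where "c = 1 / sqrt (2 * pi)"
  note f = std_normal_density_bounds[folded c_def]
  have "Phi (- 0) + c * (0 - 0^3/6 + 0^5/40 - 0^7/336) \<ge> Phi (- s) + c * (s - s^3/6 + s^5/40 - s^7/336)"
  proof (rule DERIV_nonpos_imp_nonincreasing[OF assms])
    fix x :: real assume "0 \<le> x" "x \<le> s"
    have "((\<lambda>s. Phi (- s) + c * (s - s^3/6 + s^5/40 - s^7/336)) has_real_derivative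
      (c * (1 - x^2/2 + x^4/8 - x^6/48) - std_normal_density x)) (at x)"
      by (auto intro!: derivative_eq_intros simp: field_simps)
    with f(1)[of x]
    show "\<exists>y. ((\<lambda>s. Phi (- s) + c * (s - s^3/6 + s^5/40 - s^7/336)) has_real_derivative y) (at x) \<and> y \<le> 0" by (intro exI conjI) auto
  qed
  then have "Phi (- s) + c * (s - s^3/6 + s^5/40 - s^7/336) \<le> 1/2" by (simp add: Phi_0)
  then show "Phi (- s) \<le> 1/2 - (1 / sqrt (2 * pi)) * (s - s^3/6 + s^5/40 - s^7/336)" unfolding c_def by linarith
  have "Phi (- 0) + c * (0 - 0^3/6 + 0^5/40) \<le> Phi (- s) + c * (s - s^3/6 + s^5/40)"
  proof (rule DERIV_nonneg_imp_nondecreasing[OF assms])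
    fix x :: real assume "0 \<le> x" "x \<le> s"
    have "((\<lambda>s. Phi (- s) + c * (s - s^3/6 + s^5/40)) has_real_derivative
      (c * (1 - x^2/2 + x^4/8) - std_normal_density x)) (at x)"
      by (auto intro!: derivative_eq_intros simp: field_simps)
    with f(3)[of x]
    show "\<exists>y. ((\<lambda>s. Phi (- s) + c * (s - s^3/6 + s^5/40)) has_real_derivative y) (at x) \<and> 0 \<le> y" by (intro exI conjI) auto
  qed
  then have "1/2 \<le> Phi (- s) + c * (s - s^3/6 + s^5/40)" by (simp add: Phi_0)
  then show "1/2 - (1 / sqrt (2 * pi)) * (s - s^3/6 + s^5/40) \<le> Phi (- s)" unfolding c_def by linarith
qed

text \<open>The two points bracket the critical s, closely enough that 2 Phi(-s) stays within half a
  unit of the third decimal of 0.574.\<close>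

lemma hazard_ratio_bounds: "hazard_ratio (5615/10000) < 2/3" "2/3 < hazard_ratio (5625/10000)"
  and Phi_neg_numeric: "2 * Phi (- (5615/10000)) \<le> (5745/10000)" "(5735/10000) \<le> 2 * Phi (- (5625/10000))"
proof -
  define c where "c = 1 / sqrt (2 * pi)"
  have c: "(39894/100000) \<le> c" "c \<le> (39895/100000)" using inv_sqrt_2pi_bounds unfolding c_def by auto
  note f = std_normal_density_bounds[folded c_def] and P = Phi_neg_bounds[folded c_def]
  have m: "c * x \<le> c * y" if "x \<le> y" for x y using c that by (intro mult_left_mono) auto
  \<comment> \<open>Each decimal in 1 to 6 is a Taylor polynomial at the endpoint, rounded in the
    direction that weakens the inequality.\<close>
  have 1: "std_normal_density (5615/10000) \<le> c * (85422/100000)"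
    by (rule order_trans[OF f(2) m]) (simp add: eval_nat_numeral)
  have 2: "c * (85365/100000) \<le> std_normal_density (5625/10000)"
    by (rule order_trans[OF m f(1)]) (simp add: eval_nat_numeral)
  have 3: "1/2 - c * (533391/1000000) \<le> Phi (- (5615/10000))"
    by (rule order_trans[OF diff_left_mono[OF m] P(2)]) (simp_all add: eval_nat_numeral)
  have 4: "Phi (- (5625/10000)) \<le> 1/2 - c * (53418/100000)"
    by (rule order_trans[OF P(1) diff_left_mono[OF m]]) (simp_all add: eval_nat_numeral)
  have 5: "Phi (- (5615/10000)) \<le> 1/2 - c * (53332/100000)"
    by (rule order_trans[OF P(1) diff_left_mono[OF m]]) (simp_all add: eval_nat_numeral)
  have 6: "1/2 - c * (53426/100000) \<le> Phi (- (5625/10000))"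
    by (rule order_trans[OF diff_left_mono[OF m] P(2)]) (simp_all add: eval_nat_numeral)
  show "2 * Phi (- (5615/10000)) \<le> (5745/10000)" "(5735/10000) \<le> 2 * Phi (- (5625/10000))"
    using 5 6 c by simp_all
  have "(5615/10000) * std_normal_density (5615/10000) < 2/3 * Phi (- (5615/10000))" using 1 3 c by linarith
  then show "hazard_ratio (5615/10000) < 2/3" using Phi_pos[of "- (5615/10000)"]
    unfolding hazard_ratio_def by (subst pos_divide_less_eq) auto
  have "(5625/10000) * std_normal_density (5625/10000) > 2/3 * Phi (- (5625/10000))" using 2 4 c by linarith
  then show "2/3 < hazard_ratio (5625/10000)" using Phi_pos[of "- (5625/10000)"]
    unfolding hazard_ratio_def by (subst pos_less_divide_eq) auto
qed

lemma hazard_ratio_solution: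
  obtains s where "0 < s" "hazard_ratio s = 2/3"
    "\<And>s'. 0 < s' \<Longrightarrow> hazard_ratio s' = 2/3 \<Longrightarrow> s' = s"
    "0.5735 \<le> 2 * Phi (- s)" "2 * Phi (- s) \<le> 0.5745"
proof -
  have "continuous_on {0.5615..0.5625} hazard_ratio"
    by (rule DERIV_continuous_on[OF hazard_ratio_has_derivative[THEN DERIV_subset]]) auto
  then obtain s where s: "0.5615 \<le> s" "s \<le> 0.5625" "hazard_ratio s = 2/3"
    using IVT'[of hazard_ratio "0.5615" "2/3" "0.5625"] hazard_ratio_bounds by force
  have "Phi (- s) \<le> Phi (- 0.5615)" "Phi (- 0.5625) \<le> Phi (- s)"
    using s by (auto intro!: strict_mono_leD[OF strict_monoI[OF Phi_strict_mono]])
  then have bounds: "0.5735 \<le> 2 * Phi (- s)" "2 * Phi (- s) \<le> 0.5745"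
    using Phi_neg_numeric by simp_all
  have unique: "s' = s" if "0 < s'" "hazard_ratio s' = 2/3" for s'
    using hazard_ratio_strict_mono[of s s'] hazard_ratio_strict_mono[of s' s] s that by force
  have "0 < s" using s by simp
  then show ?thesis by (rule that[OF _ s(3) unique bounds])
qed

section \<open>The maximiser of the limiting efficiency\<close>

lemma hfun_derivative:
  "(hfun th has_real_derivative
     (4 * l * Phi (- (l^3 * th / 2)) - 3 * l^4 * th * std_normal_density (l^3 * th / 2))) (at l)"
proof -
  have i: "((\<lambda>l. - (l^3 * th / 2)) has_real_derivative - (3 * l^2 * th / 2)) (at l)"
    by (auto intro!: derivative_eq_intros)
  have "(hfun th has_real_derivative
     (4 * l) * Phi (- (l^3 * th / 2)) + (std_normal_density (- (l^3 * th / 2)) * - (3 * l^2 * th / 2)) * (2 * l^2)) (at l)"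
    unfolding hfun_def
    by (rule DERIV_mult[OF _ Phi_derivative_chain[OF i]]) (auto intro!: derivative_eq_intros)
  then show ?thesis
    by (rule DERIV_cong) (simp add: eval_nat_numeral)
qed

text \<open>Since 3 l^4 th = 6 l s for s = l^3 th/2, the derivative is 6 l (2/3 Phi(-s) - s phi(s)).
  The 2/3 is the ratio of the exponents of l in l^2 and l^3.\<close>

lemma hfun_derivative_sign:
  assumes "th > 0" "l > 0"
  shows "\<exists>D. (hfun th has_real_derivative D) (at l) \<and>
     (hazard_ratio (l^3 * th / 2) < 2/3 \<longrightarrow> D > 0) \<and> (hazard_ratio (l^3 * th / 2) > 2/3 \<longrightarrow> D < 0)"
proof -
  define s where "s = l^3 * th / 2"
  have P: "Phi (- s) > 0" by (rule Phi_pos)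
  have e: "4 * l * Phi (- s) - 3 * l^4 * th * std_normal_density s
      = 6 * l * (2/3 * Phi (- s) - s * std_normal_density s)"
    by (simp add: s_def algebra_simps eval_nat_numeral)
  show ?thesis
    using hfun_derivative[of th l, folded s_def, unfolded e] P assms
    unfolding s_def[symmetric] hazard_ratio_def
    by (intro exI[of _ "6 * l * (2/3 * Phi (- s) - s * std_normal_density s)"])
       (simp add: pos_divide_less_eq pos_less_divide_eq mult_less_0_iff zero_less_mult_iff)
qed

text \<open>As l^3 th/2 increases with l and \<open>hazard_ratio\<close> increases, the derivative
  changes sign exactly once, from plus to minus.\<close>

lemma hfun_maximiser:
  assumes th: "th > 0" and s: "0 < s" "hazard_ratio s = 2/3"
  defines "l \<equiv> root 3 (2 * s / th)"
  shows "l > 0" "l^3 * th / 2 = s" "\<And>l'. l' > 0 \<Longrightarrow> l' \<noteq> l \<Longrightarrow> hfun th l' < hfun th l"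
proof -
  show l0: "l > 0" using th s by (simp add: l_def)
  have "l^3 = 2 * s / th" using th s by (simp add: l_def odd_real_root_pow)
  then show ls: "l^3 * th / 2 = s" using th by (simp add: field_simps)
  have lt: "hazard_ratio (x^3 * th / 2) < 2/3" if "0 < x" "x < l" for x
  proof -
    have "x^3 < l^3" using that by (intro power_strict_mono) auto
    then have "x^3 * th / 2 < s" unfolding ls[symmetric] using th by simp
    then show ?thesis using hazard_ratio_strict_mono[of "x^3*th/2" s] that th s(2) by simp
  qed
  have gt: "hazard_ratio (x^3 * th / 2) > 2/3" if "l < x" for x
  proof -
    have "l^3 < x^3" using that l0 by (intro power_strict_mono) auto
    then have "s < x^3 * th / 2" unfolding ls[symmetric] using th by simp
    then show ?thesis using hazard_ratio_strict_mono[OF s(1)] s(2) by simp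
  qed
  have cont: "continuous_on S (hfun th)" for S
    by (rule DERIV_continuous_on[OF DERIV_subset[OF hfun_derivative]]) auto
  fix l' assume l': "l' > 0" "l' \<noteq> l"
  show "hfun th l' < hfun th l"
  proof (cases "l' < l")
    case True
    show ?thesis
    proof (rule DERIV_pos_imp_increasing_open[OF True _ cont])
      fix x assume "l' < x" "x < l"
      then show "\<exists>y. (hfun th has_real_derivative y) (at x) \<and> y > 0"
        using hfun_derivative_sign[OF th, of x] lt[of x] l' by auto
    qed
  next
    case False
    then have "l < l'" using l' by simp
    then show ?thesis
    proof (rule DERIV_neg_imp_decreasing_open[OF _ _ cont])
      fix x assume "l < x" "x < l'"
      then show "\<exists>y. (hfun th has_real_derivative y) (at x) \<and> y < 0"
        using hfun_derivative_sign[OF th, of x] gt[of x] l0 by auto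
    qed
  qed
qed

text \<open>Here l^2 = (2 s/th)^(2/3), and the prefactor 2 turns 2^(2/3) into 2^(5/3).\<close>

lemma hfun_max_value:
  assumes "th > 0" "l > 0" "l^3 * th / 2 = s"
  shows "hfun th l = 2 powr (5/3) * s powr (2/3) * Phi (- s) * th powr (- 2/3)"
proof -
  have "l powr 3 = l ^ 3" using assms by (simp add: powr_numeral)
  then have "s powr (2/3) = (l powr 3 * th / 2) powr (2/3)" by (simp only: assms(3))
  also have "\<dots> = (l powr 3) powr (2/3) * th powr (2/3) / 2 powr (2/3)"
    using assms by (simp only: powr_divide powr_mult)
  also have "(l powr 3) powr (2/3) = l powr 2" by (simp add: powr_powr)
  finally have "2 powr (5/3) * s powr (2/3) * th powr (- 2/3)
    = l powr 2 * (2 powr (5/3) / 2 powr (2/3)) * (th powr (2/3) * th powr (-2/3))" by simp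
  also have "2 powr (5/3) / 2 powr (2/3) = (2::real)" by (simp flip: powr_diff)
  also have "th powr (2/3) * th powr (-2/3) = 1" using assms by (simp flip: powr_add)
  finally have "2 powr (5/3) * s powr (2/3) * th powr (- 2/3) = 2 * l^2" using assms by (simp add: powr_numeral)
  then have "2 powr (5/3) * s powr (2/3) * Phi (- s) * th powr (- 2/3) = 2 * l^2 * Phi (- s)"
    by (simp only: mult.assoc mult.left_commute mult.commute)
  then show ?thesis by (simp only: hfun_def assms(3))
qed

section \<open>The log-normaliser of the proposal\<close>

lemma npow_nonneg: "0 \<le> npow \<bar>a\<bar> \<beta>"
  by (simp add: npow_def)

lemma npow_mono: "0 \<le> \<beta> \<Longrightarrow> \<bar>a\<bar> \<le> \<bar>c\<bar> \<Longrightarrow> npow \<bar>a\<bar> \<beta> \<le> npow \<bar>c\<bar> \<beta>"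
  by (simp add: npow_def powr_mono2)

lemma npow_mult_le: "0 \<le> \<beta> \<Longrightarrow> 0 \<le> s \<Longrightarrow> s \<le> 1 \<Longrightarrow> npow \<bar>s * a\<bar> \<beta> \<le> npow \<bar>a\<bar> \<beta>"
  by (rule npow_mono) (auto simp: abs_mult intro: mult_left_le_one_le)

lemma abs_exp_diff_le: fixes u v :: real shows "\<bar>exp u - exp v\<bar> \<le> \<bar>u - v\<bar> * (exp u + exp v)"
proof -
  have *: "\<bar>exp u - exp v\<bar> \<le> \<bar>u - v\<bar> * (exp u + exp v)" if "v \<le> u" for u v :: real
  proof -
    have "exp u - exp v = exp u * (1 - exp (v - u))" by (simp add: algebra_simps flip: exp_add)
    also have "\<dots> \<le> exp u * (u - v)"
      using exp_ge_add_one_self[of "v - u"] by (intro mult_left_mono) (linarith, simp)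
    also have "\<dots> \<le> (exp u + exp v) * (u - v)" using that by (intro mult_right_mono) auto
    finally show ?thesis using that by (simp add: mult.commute)
  qed
  show ?thesis using *[of v u] *[of u v] by (cases "v \<le> u") (auto simp: abs_minus_commute add.commute)
qed

lemma abs_power_le_power_6: fixes z :: real assumes "k \<le> 6" shows "\<bar>z\<bar> ^ k \<le> 1 + \<bar>z\<bar> ^ 6"
proof (cases "\<bar>z\<bar> \<le> 1")
  case True
  then have "\<bar>z\<bar> ^ k \<le> 1" by (intro power_le_one) auto
  then show ?thesis by (rule order_trans) simp
next
  case False
  then have "\<bar>z\<bar> ^ k \<le> \<bar>z\<bar> ^ 6" using assms by (intro power_increasing) auto
  then show ?thesis by linarith
qed

text \<open>Collects what concerns b and \<open>mu\<close> alone. The margin of \<xi> above 6 is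
  what makes sixth-moment tails uniformly small.\<close>

locale balanced_proposal =
  fixes b :: "real \<Rightarrow> real" and mu :: "real measure" and M C \<beta> \<xi> :: real
  assumes mu_prob: "prob_space mu" and mu_sets [measurable_cong]: "sets mu = sets borel"
    and mu_symm: "distr mu borel uminus = mu"
    and b_refl: "b u = u + b (- u)" and b_0: "b 0 = 0"
    and b_deriv: "(b has_real_derivative deriv b x) (at x)"
    and b_deriv2: "(deriv b has_real_derivative deriv (deriv b) x) (at x)"
    and b_deriv2_cont: "continuous_on UNIV (deriv (deriv b))"
    and b_deriv_bd: "\<bar>deriv b x\<bar> \<le> M" and b_deriv2_bd: "\<bar>deriv (deriv b) x\<bar> \<le> M"
    and xi: "\<xi> > 6" and C_pos: "C > 0" and beta: "\<beta> \<ge> 0"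
    and int_exp: "integrable mu (\<lambda>z. exp (b (a * z)))"
    and int_exp_xi: "integrable mu (\<lambda>z. exp (b (a * z)) * \<bar>z\<bar> powr \<xi>)"
    and exp_xi_le: "(\<integral>z. exp (b (a * z)) * \<bar>z\<bar> powr \<xi> \<partial>mu)
       \<le> C * (1 + npow \<bar>a\<bar> \<beta>) * (\<integral>z. exp (b (a * z)) \<partial>mu)"
    and mu_mean: "(\<integral>z. z \<partial>mu) = 0" and mu_var: "(\<integral>z. z\<^sup>2 \<partial>mu) = 1"
begin

sublocale mu: prob_space mu by (rule mu_prob)

text \<open>The proposal normaliser depends on the scale and the state only through a = s phi'(x),
  so it is studied as a function of one variable.\<close>

definition Zt :: "real \<Rightarrow> real" where "Zt a = (\<integral>z. exp (b (a * z)) \<partial>mu)"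
definition Zt_xi :: "real \<Rightarrow> real" where "Zt_xi a = (\<integral>z. exp (b (a * z)) * \<bar>z\<bar> powr \<xi> \<partial>mu)"

lemma M_nonneg: "M \<ge> 0"
  using b_deriv_bd[of 0] by simp

lemma b_cont: "continuous_on S b"
  by (rule DERIV_continuous_on[OF b_deriv[THEN DERIV_subset]]) auto

lemma b'_cont: "continuous_on S (deriv b)"
  by (rule DERIV_continuous_on[OF b_deriv2[THEN DERIV_subset]]) auto

lemma b_measurable [measurable]: "b \<in> borel_measurable borel" "deriv b \<in> borel_measurable borel"
    "deriv (deriv b) \<in> borel_measurable borel"
  using b_cont b'_cont b_deriv2_cont by (auto intro: borel_measurable_continuous_onI)

lemma b_lipschitz: "\<bar>b u - b v\<bar> \<le> M * \<bar>u - v\<bar>"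
  using field_differentiable_bound[of UNIV b "deriv b" M u v] b_deriv b_deriv_bd
  by (auto intro: DERIV_subset)

lemma b'_lipschitz: "\<bar>deriv b u - deriv b v\<bar> \<le> M * \<bar>u - v\<bar>"
  using field_differentiable_bound[of UNIV "deriv b" "deriv (deriv b)" M u v] b_deriv2 b_deriv2_bd
  by (auto intro: DERIV_subset)

lemma b_abs_le: "\<bar>b u\<bar> \<le> M * \<bar>u\<bar>"
  using b_lipschitz[of u 0] b_0 by simp

lemma b'_refl: "deriv b u = 1 - deriv b (- u)"
proof -
  have "((\<lambda>u. u + b (- u)) has_real_derivative 1 + deriv b (- u) * - 1) (at u)"
    by (intro derivative_intros DERIV_chain2[OF b_deriv])
  moreover have "(\<lambda>u. u + b (- u)) = b" by (rule ext) (rule b_refl[symmetric])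
  ultimately have "(b has_real_derivative 1 + deriv b (- u) * - 1) (at u)" by simp
  from DERIV_unique[OF this b_deriv] show ?thesis by simp
qed

lemma b'_0: "deriv b 0 = 1/2"
  using b'_refl[of 0] by simp

lemma Zt_pos: "Zt a > 0"
proof -
  have "Zt a \<noteq> 0"
  proof
    assume "Zt a = 0"
    then have "AE z in mu. exp (b (a * z)) = 0"
      unfolding Zt_def by (subst (asm) integral_nonneg_eq_0_iff_AE[OF int_exp]) auto
    then show False using mu.AE_False by simp
  qed
  moreover have "Zt a \<ge> 0" unfolding Zt_def by (intro integral_nonneg_AE) auto
  ultimately show ?thesis by simp
qed

lemma Zt_0: "Zt 0 = 1"
  by (simp add: Zt_def b_0 mu.prob_space)

lemma Zt_xi_le: "Zt_xi a \<le> C * (1 + npow \<bar>a\<bar> \<beta>) * Zt a"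
  unfolding Zt_xi_def Zt_def by (rule exp_xi_le)

lemma abs_power_le_xi: "k \<le> 6 \<Longrightarrow> \<bar>z\<bar> ^ k \<le> 1 + \<bar>z\<bar> powr \<xi>"
proof (cases "\<bar>z\<bar> \<le> 1")
  case True
  then have "\<bar>z\<bar> ^ k \<le> 1" by (simp add: power_le_one)
  then show ?thesis by (simp add: add_increasing2)
next
  case False assume "k \<le> 6"
  then have "\<bar>z\<bar> ^ k = \<bar>z\<bar> powr real k" using False by (simp add: powr_realpow)
  also have "\<dots> \<le> \<bar>z\<bar> powr \<xi>" using False \<open>k \<le> 6\<close> xi by (intro powr_mono) auto
  finally show ?thesis by simp
qed

lemma weight_power_le_xi: "k \<le> 6 \<Longrightarrow> exp t * \<bar>z\<bar> ^ k \<le> exp t + exp t * \<bar>z\<bar> powr \<xi>"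
  using mult_left_mono[OF abs_power_le_xi, of k "exp t" z] by (simp add: distrib_left)

lemma int_exp_abs_power: assumes "k \<le> 6" shows "integrable mu (\<lambda>z. exp (b (a * z)) * \<bar>z\<bar> ^ k)"
proof (rule Bochner_Integration.integrable_bound)
  show "integrable mu (\<lambda>z. exp (b (a * z)) + exp (b (a * z)) * \<bar>z\<bar> powr \<xi>)"
    by (intro Bochner_Integration.integrable_add int_exp int_exp_xi)
  show "AE z in mu. norm (exp (b (a * z)) * \<bar>z\<bar> ^ k) \<le> norm (exp (b (a * z)) + exp (b (a * z)) * \<bar>z\<bar> powr \<xi>)"
    using weight_power_le_xi[OF assms] by (intro AE_I2) (auto simp: abs_mult)
qed measurable

lemma exp_abs_power_le:
  assumes "k \<le> 6"
  shows "(\<integral>z. exp (b (a * z)) * \<bar>z\<bar> ^ k \<partial>mu) \<le> (1 + C) * (1 + npow \<bar>a\<bar> \<beta>) * Zt a"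
proof -
  have "(\<integral>z. exp (b (a * z)) * \<bar>z\<bar> ^ k \<partial>mu) \<le> (\<integral>z. exp (b (a * z)) + exp (b (a * z)) * \<bar>z\<bar> powr \<xi> \<partial>mu)"
    using weight_power_le_xi[OF assms]
    by (intro integral_mono int_exp_abs_power[OF assms] Bochner_Integration.integrable_add int_exp int_exp_xi)
       auto
  also have "\<dots> = Zt a + Zt_xi a"
    unfolding Zt_def Zt_xi_def by (intro Bochner_Integration.integral_add int_exp int_exp_xi)
  also have "\<dots> \<le> (1 + npow \<bar>a\<bar> \<beta>) * Zt a + C * (1 + npow \<bar>a\<bar> \<beta>) * Zt a"
    using Zt_pos[of a] npow_nonneg[of a \<beta>] by (intro add_mono Zt_xi_le) simp
  finally show ?thesis by (simp add: algebra_simps)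
qed

text \<open>The hypothesis bounds the \<xi>-moment only by a multiple of \<open>Zt\<close> itself,
  so the bound is obtained by absorption: on |z| <= R the weight is bounded, and R is chosen so
  large that the tail contributes at most half of \<open>Zt a\<close>.\<close>

lemma Zt_locally_bounded: obtains B where "\<And>a. \<bar>a\<bar> \<le> A \<Longrightarrow> Zt a \<le> B"
proof (cases "A \<ge> 0")
  case True
  define D where "D = C * (1 + npow \<bar>A\<bar> \<beta>)"
  have "D > 0" unfolding D_def using C_pos npow_nonneg[of A \<beta>] by (intro mult_pos_pos) auto
  have "((\<lambda>R. R powr (- \<xi>) * D) \<longlongrightarrow> 0 * D) at_top"
    using xi by (intro tendsto_mult tendsto_const tendsto_neg_powr filterlim_ident) auto
  then have "\<forall>\<^sub>F R in at_top. R powr (- \<xi>) * D < 1/2" by (rule order_tendstoD) simp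
  then obtain R where R: "R powr (- \<xi>) * D < 1/2" "R > 0"
    using eventually_happens'[OF trivial_limit_at_top_linorder eventually_conj[OF _ eventually_gt_at_top[of 0]]] by blast
  show ?thesis
  proof (rule that)
    fix a assume a: "\<bar>a\<bar> \<le> A"
    have pt: "exp (b (a * z)) \<le> exp (M * A * R) + R powr (- \<xi>) * (exp (b (a * z)) * \<bar>z\<bar> powr \<xi>)" for z
    proof (cases "\<bar>z\<bar> \<le> R")
      case True
      have "b (a * z) \<le> M * (\<bar>a\<bar> * \<bar>z\<bar>)" using b_abs_le[of "a * z"] by (simp add: abs_mult)
      also have "\<dots> \<le> M * (A * R)" using a True R M_nonneg by (intro mult_left_mono mult_mono) auto
      finally have "exp (b (a * z)) \<le> exp (M * A * R)" by (simp add: mult.assoc)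
      then show ?thesis by (simp add: add_increasing2)
    next
      case False
      have "1 = R powr (- \<xi>) * R powr \<xi>" using R by (simp flip: powr_add)
      also have "\<dots> \<le> R powr (- \<xi>) * \<bar>z\<bar> powr \<xi>"
        using False R xi by (intro mult_left_mono powr_mono2) auto
      finally have "exp (b (a * z)) * 1 \<le> exp (b (a * z)) * (R powr (- \<xi>) * \<bar>z\<bar> powr \<xi>)"
        by (intro mult_left_mono) auto
      moreover have "0 < exp (M * A * R)" by simp
      ultimately show ?thesis by (simp only: mult_1_right mult.left_commute)
    qed
    have "Zt a \<le> (\<integral>z. exp (M * A * R) + R powr (- \<xi>) * (exp (b (a * z)) * \<bar>z\<bar> powr \<xi>) \<partial>mu)"
      unfolding Zt_def using pt
      by (intro integral_mono int_exp Bochner_Integration.integrable_add integrable_mult_right int_exp_xi) auto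
    also have "\<dots> = exp (M * A * R) + R powr (- \<xi>) * Zt_xi a"
      unfolding Zt_xi_def by (subst Bochner_Integration.integral_add) (auto simp: int_exp_xi mu.prob_space)
    also have "Zt_xi a \<le> D * Zt a"
      unfolding D_def using a C_pos Zt_pos[of a] beta
      by (intro order_trans[OF Zt_xi_le] mult_right_mono mult_left_mono add_left_mono npow_mono) auto
    also have "R powr (- \<xi>) * (D * Zt a) \<le> 1/2 * Zt a"
      using R Zt_pos[of a] unfolding mult.assoc[symmetric] by (intro mult_right_mono) auto
    finally show "Zt a \<le> 2 * exp (M * A * R)" by (simp add: mult_left_mono)
  qed
next
  case False
  then show ?thesis using that[of 0] by force
qed

lemma Zt_xi_locally_bounded: obtains B where "\<And>a. \<bar>a\<bar> \<le> A \<Longrightarrow> Zt_xi a \<le> B" "B \<ge> 0"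
proof -
  obtain B where B: "\<And>a. \<bar>a\<bar> \<le> A \<Longrightarrow> Zt a \<le> B" using Zt_locally_bounded by blast
  have "Zt_xi a \<le> C * (1 + npow \<bar>A\<bar> \<beta>) * \<bar>B\<bar>" if "\<bar>a\<bar> \<le> A" for a
    using that B[OF that] C_pos Zt_pos[of a] beta npow_nonneg[of A \<beta>]
    by (intro order_trans[OF Zt_xi_le] mult_mono mult_left_mono add_left_mono npow_mono) (auto intro: add_nonneg_nonneg)
  moreover have "C * (1 + npow \<bar>A\<bar> \<beta>) * \<bar>B\<bar> \<ge> 0" using C_pos npow_nonneg[of A \<beta>] by simp
  ultimately show ?thesis using that by blast
qed

text \<open>No integrable majorant of the weights is available; their higher moment \<open>\<xi> > 6\<close> makes the
  tails uniformly small instead.\<close>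
lemma weighted_limit:
  fixes F :: "nat \<Rightarrow> real \<Rightarrow> real"
  assumes [measurable]: "\<And>n. F n \<in> borel_measurable mu" "f \<in> borel_measurable mu"
    and a: "\<And>n. \<bar>a n\<bar> \<le> A" and c: "\<And>n. \<bar>c n\<bar> \<le> A"
    and lim: "\<And>z. (\<lambda>n. F n z) \<longlonglongrightarrow> f z"
    and bd: "\<And>n z. \<bar>F n z\<bar> \<le> K * (1 + \<bar>z\<bar> ^ 6) * (exp (b (a n * z)) + exp (b (c n * z)))"
    and f: "integrable mu f"
  shows "(\<lambda>n. \<integral>z. F n z \<partial>mu) \<longlonglongrightarrow> (\<integral>z. f z \<partial>mu)"
proof -
  have A: "A \<ge> 0" using a[of 0] by simp
  have K: "K \<ge> 0"
  proof -
    have "0 \<le> K * (1 + \<bar>0\<bar> ^ 6) * (exp (b (a 0 * 0)) + exp (b (c 0 * 0)))"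
      by (rule order_trans[OF abs_ge_zero bd])
    then show ?thesis by (simp add: b_0)
  qed
  obtain B where B: "\<And>a. \<bar>a\<bar> \<le> A \<Longrightarrow> Zt_xi a \<le> B" "B \<ge> 0" using Zt_xi_locally_bounded by blast
  \<comment> \<open>Sharp cutoff at level R: on [-R, R] the weights are bounded uniformly in n, so
    ordinary dominated convergence applies there.\<close>
  define T :: "real \<Rightarrow> nat \<Rightarrow> real" where "T z R = indicator {- real R..real R} z" for z R
  have T_meas [measurable]: "(\<lambda>z. T z R) \<in> borel_measurable borel" for R unfolding T_def by measurable
  have T01: "0 \<le> T z R" "T z R \<le> 1" for z R by (auto simp: T_def)
  have T_in: "\<bar>z\<bar> \<le> R" if "T z R \<noteq> 0" for z R using that by (auto simp: T_def indicator_def split: if_splits)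
  have T_lim: "(\<lambda>R. T z R) \<longlonglongrightarrow> 1" for z
  proof (rule tendsto_eventually)
    obtain N :: nat where "\<bar>z\<bar> \<le> N" using real_arch_simple by blast
    then have "z \<in> {- real R..real R}" if "N \<le> R" for R
      using of_nat_mono[OF that, where ?'a = real] by auto
    then show "\<forall>\<^sub>F R in sequentially. T z R = 1"
      by (intro eventually_sequentiallyI[of N]) (simp add: T_def)
  qed
  have int_F: "integrable mu (F n)" for n
  proof (rule Bochner_Integration.integrable_bound)
    show "integrable mu (\<lambda>z. K * ((exp (b (a n * z)) * \<bar>z\<bar> ^ 0 + exp (b (a n * z)) * \<bar>z\<bar> ^ 6)
        + (exp (b (c n * z)) * \<bar>z\<bar> ^ 0 + exp (b (c n * z)) * \<bar>z\<bar> ^ 6)))"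
      by (intro integrable_mult_right Bochner_Integration.integrable_add int_exp_abs_power) auto
    show "AE z in mu. norm (F n z) \<le> norm (K * ((exp (b (a n * z)) * \<bar>z\<bar> ^ 0 + exp (b (a n * z)) * \<bar>z\<bar> ^ 6)
        + (exp (b (c n * z)) * \<bar>z\<bar> ^ 0 + exp (b (c n * z)) * \<bar>z\<bar> ^ 6)))"
      by (intro AE_I2, unfold real_norm_def, rule order_trans[OF bd], rule order_trans[OF _ abs_ge_self])
         (simp add: algebra_simps)
  qed measurable
  have trunc: "(\<lambda>n. \<integral>z. T z R * F n z \<partial>mu) \<longlonglongrightarrow> (\<integral>z. T z R * f z \<partial>mu)" for R
  proof (rule integral_dominated_convergence[where w = "\<lambda>_. K * (1 + real R ^ 6) * (2 * exp (M * (A * real R)))"])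
    show "AE z in mu. norm (T z R * F n z) \<le> K * (1 + real R ^ 6) * (2 * exp (M * (A * real R)))" for n
    proof (intro AE_I2)
      fix z
      show "norm (T z R * F n z) \<le> K * (1 + real R ^ 6) * (2 * exp (M * (A * real R)))"
      proof (cases "T z R = 0")
        case False
        have e: "exp (b (x * z)) \<le> exp (M * (A * R))" if "\<bar>x\<bar> \<le> A" for x
        proof -
          have "b (x * z) \<le> M * (\<bar>x\<bar> * \<bar>z\<bar>)" using b_abs_le[of "x * z"] by (simp add: abs_mult)
          also have "\<dots> \<le> M * (A * R)" using that T_in[OF False] M_nonneg A by (intro mult_left_mono mult_mono) auto
          finally show ?thesis by simp
        qed
        have "norm (T z R * F n z) \<le> 1 * \<bar>F n z\<bar>"
          unfolding real_norm_def abs_mult using T01[of z R] by (intro mult_right_mono) auto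
        also have "\<dots> \<le> K * (1 + \<bar>z\<bar> ^ 6) * (exp (b (a n * z)) + exp (b (c n * z)))" using bd by simp
        also have "\<dots> \<le> K * (1 + real R ^ 6) * (exp (M * (A * R)) + exp (M * (A * R)))"
          using K T_in[OF False] by (intro mult_mono add_mono e a c mult_left_mono power_mono) auto
        finally show ?thesis by simp
      qed (use K in auto)
    qed
    show "AE z in mu. (\<lambda>n. T z R * F n z) \<longlonglongrightarrow> T z R * f z" by (intro AE_I2 tendsto_intros lim)
  qed auto
  have trunc_f: "(\<lambda>R. \<integral>z. T z R * f z \<partial>mu) \<longlonglongrightarrow> (\<integral>z. f z \<partial>mu)"
  proof (rule integral_dominated_convergence[where w = "\<lambda>z. \<bar>f z\<bar>"])
    show "AE z in mu. norm (T z R * f z) \<le> \<bar>f z\<bar>" for R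
      using T01 by (intro AE_I2) (auto simp: abs_mult intro: mult_left_le_one_le)
    show "AE z in mu. (\<lambda>R. T z R * f z) \<longlonglongrightarrow> f z"
      using tendsto_mult[OF T_lim tendsto_const] by (intro AE_I2) simp
  qed (use f in auto)
  \<comment> \<open>For |z| > R >= 1 one has 1 + |z|^6 <= 2 R^(6-\<xi>) |z|^\<xi>, so the cutoff
    error is O(R^(6-\<xi>)) uniformly in n.\<close>
  have tail: "\<bar>(\<integral>z. T z R * F n z \<partial>mu) - (\<integral>z. F n z \<partial>mu)\<bar> \<le> 4 * K * B * real R powr (6 - \<xi>)" if R: "R \<ge> 1" for n R
  proof -
    have pt: "\<bar>(T z R - 1) * F n z\<bar>
      \<le> 2 * K * real R powr (6 - \<xi>) * (exp (b (a n * z)) * \<bar>z\<bar> powr \<xi> + exp (b (c n * z)) * \<bar>z\<bar> powr \<xi>)" for z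
    proof (cases "\<bar>z\<bar> \<le> R")
      case True
      then have "T z R = 1" by (auto simp: T_def indicator_def abs_le_iff)
      then show ?thesis using K by simp
    next
      case False
      then have z: "\<bar>z\<bar> > R" "\<bar>z\<bar> > 1" using R by auto
      have "1 + \<bar>z\<bar> ^ 6 \<le> 2 * \<bar>z\<bar> ^ 6" using one_le_power[of "\<bar>z\<bar>" 6] z by simp
      moreover have "\<bar>z\<bar> ^ 6 = \<bar>z\<bar> powr (6 - \<xi>) * \<bar>z\<bar> powr \<xi>" using z by (simp add: powr_realpow flip: powr_add)
      moreover have "\<bar>z\<bar> powr (6 - \<xi>) * \<bar>z\<bar> powr \<xi> \<le> R powr (6 - \<xi>) * \<bar>z\<bar> powr \<xi>"
        using z xi R by (intro mult_right_mono powr_mono2') auto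
      ultimately have z6: "1 + \<bar>z\<bar> ^ 6 \<le> 2 * (R powr (6 - \<xi>) * \<bar>z\<bar> powr \<xi>)" by linarith
      have "\<bar>(T z R - 1) * F n z\<bar> = \<bar>T z R - 1\<bar> * \<bar>F n z\<bar>" by (rule abs_mult)
      also have "\<dots> \<le> 1 * (K * (1 + \<bar>z\<bar> ^ 6) * (exp (b (a n * z)) + exp (b (c n * z))))"
        using T01[of z R] bd by (intro mult_mono) auto
      also have "\<dots> \<le> 1 * (K * (2 * (R powr (6 - \<xi>) * \<bar>z\<bar> powr \<xi>)) * (exp (b (a n * z)) + exp (b (c n * z))))"
        using K by (intro mult_left_mono mult_right_mono z6) auto
      finally show ?thesis by (simp add: algebra_simps)
    qed
    have i1: "integrable mu (\<lambda>z. T z R * F n z)"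
      by (rule Bochner_Integration.integrable_bound[OF int_F[of n]])
         (use T01 in \<open>auto simp: abs_mult intro!: AE_I2 mult_left_le_one_le\<close>)
    have "\<bar>(\<integral>z. T z R * F n z \<partial>mu) - (\<integral>z. F n z \<partial>mu)\<bar> = \<bar>\<integral>z. (T z R - 1) * F n z \<partial>mu\<bar>"
      by (subst Bochner_Integration.integral_diff[symmetric, OF i1 int_F]) (simp add: algebra_simps)
    also have "\<dots> \<le> (\<integral>z. \<bar>(T z R - 1) * F n z\<bar> \<partial>mu)" by (rule integral_abs_bound)
    also have "\<dots> \<le> (\<integral>z. 2 * K * real R powr (6 - \<xi>) * (exp (b (a n * z)) * \<bar>z\<bar> powr \<xi> + exp (b (c n * z)) * \<bar>z\<bar> powr \<xi>) \<partial>mu)"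
    proof (rule integral_mono)
      show "integrable mu (\<lambda>z. \<bar>(T z R - 1) * F n z\<bar>)"
        using Bochner_Integration.integrable_diff[OF i1 int_F[of n]] by (intro integrable_abs) (simp add: algebra_simps)
    qed (use pt in \<open>auto intro!: integrable_mult_right int_exp_xi\<close>)
    also have "\<dots> = 2 * K * real R powr (6 - \<xi>) * (Zt_xi (a n) + Zt_xi (c n))"
      unfolding Zt_xi_def by (simp add: int_exp_xi)
    also have "\<dots> \<le> 2 * K * real R powr (6 - \<xi>) * (B + B)"
      using K by (intro mult_left_mono add_mono B a c) auto
    finally show ?thesis by (simp add: algebra_simps)
  qed
  \<comment> \<open>Uniformity in n permits exchanging the limits in R and n.\<close>
  have "uniform_limit UNIV (\<lambda>R n. \<integral>z. T z R * F n z \<partial>mu) (\<lambda>n. \<integral>z. F n z \<partial>mu) sequentially"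
  proof (rule uniform_limitI)
    fix e :: real assume "e > 0"
    have "(\<lambda>R. 4 * K * B * real R powr (6 - \<xi>)) \<longlonglongrightarrow> 4 * K * B * 0"
      using xi by (intro tendsto_mult tendsto_const tendsto_neg_powr filterlim_real_sequentially) auto
    then have "\<forall>\<^sub>F R in sequentially. 4 * K * B * real R powr (6 - \<xi>) < e"
      by (rule order_tendstoD) (use \<open>e > 0\<close> in simp)
    with eventually_ge_at_top[of 1]
    show "\<forall>\<^sub>F R in sequentially. \<forall>n\<in>UNIV. dist (\<integral>z. T z R * F n z \<partial>mu) (\<integral>z. F n z \<partial>mu) < e"
    proof eventually_elim
      case (elim R)
      then show ?case unfolding dist_real_def by (intro ballI le_less_trans[OF tail])
    qed
  qed
  then show ?thesis
    using swap_uniform_limit'[OF always_eventually[OF allI[OF trunc]] trunc_f] by simp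
qed

lemma weighted_integral_bound:
  assumes [measurable]: "k \<in> borel_measurable borel" and k: "\<And>u. \<bar>k u\<bar> \<le> L * exp (b u)" and j: "j \<le> 6"
  shows "integrable mu (\<lambda>z. z ^ j * k (a * z))"
    and "\<bar>\<integral>z. z ^ j * k (a * z) \<partial>mu\<bar> \<le> L * (\<integral>z. exp (b (a * z)) * \<bar>z\<bar> ^ j \<partial>mu)"
proof -
  have le: "norm (z ^ j * k (a * z)) \<le> L * (exp (b (a * z)) * \<bar>z\<bar> ^ j)" for z
    using mult_left_mono[OF k[of "a * z"], of "\<bar>z\<bar> ^ j"] by (simp add: abs_mult power_abs ac_simps)
  note int = integrable_mult_right[OF int_exp_abs_power[OF j, of a], of L]
  show i: "integrable mu (\<lambda>z. z ^ j * k (a * z))"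
    by (rule Bochner_Integration.integrable_bound[OF int])
       (simp, intro AE_I2 order_trans[OF le], simp only: real_norm_def abs_ge_self)
  have "norm (\<integral>z. z ^ j * k (a * z) \<partial>mu) \<le> (\<integral>z. L * (exp (b (a * z)) * \<bar>z\<bar> ^ j) \<partial>mu)"
    by (rule Bochner_Integration.integral_norm_bound_integral[OF i int le])
  then show "\<bar>\<integral>z. z ^ j * k (a * z) \<partial>mu\<bar> \<le> L * (\<integral>z. exp (b (a * z)) * \<bar>z\<bar> ^ j \<partial>mu)"
    by simp
qed

text \<open>Differentiation under the integral, with the difference quotients handled by
  \<open>weighted_limit\<close> for want of a common majorant. Each derivative costs one power of z
  and six are available, hence j <= 5.\<close>

lemma weighted_integral_derivative:
  fixes k k' :: "real \<Rightarrow> real"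
  assumes k: "\<And>u. (k has_real_derivative k' u) (at u)" and [measurable]: "k' \<in> borel_measurable borel"
    and L: "\<And>u v. \<bar>k u - k v\<bar> \<le> L * \<bar>u - v\<bar> * (exp (b u) + exp (b v))"
    and k_le: "\<And>u. \<bar>k u\<bar> \<le> L' * exp (b u)" and k'_le: "\<And>u. \<bar>k' u\<bar> \<le> L * exp (b u)"
    and j: "j \<le> 5"
  shows "((\<lambda>a. \<integral>z. z ^ j * k (a * z) \<partial>mu) has_real_derivative (\<integral>z. z ^ Suc j * k' (a * z) \<partial>mu)) (at a)"
proof -
  have [measurable]: "k \<in> borel_measurable borel"
    by (intro borel_measurable_continuous_onI DERIV_continuous_on[OF k[THEN DERIV_subset]]) auto
  have int_k: "integrable mu (\<lambda>z. z ^ j * k (x * z))" for x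
    using j by (intro weighted_integral_bound(1)[where L = L'] k_le) auto
  have L0: "L \<ge> 0" using k'_le[of 0] by (simp add: b_0)
  have int_k': "integrable mu (\<lambda>z. z ^ Suc j * k' (x * z))" for x
    using j by (intro weighted_integral_bound(1)[where L = L] k'_le) auto
  let ?G = "\<lambda>a. \<integral>z. z ^ j * k (a * z) \<partial>mu"
  show ?thesis
    unfolding DERIV_def
  proof (subst LIMSEQ_SEQ_conv[symmetric], intro allI impI)
    fix h :: "nat \<Rightarrow> real" assume h: "(\<forall>n. h n \<noteq> 0) \<and> h \<longlonglongrightarrow> 0"
    then have "Bseq h" by (intro convergent_imp_Bseq) (auto simp: convergent_def)
    then obtain H where H: "\<And>n. \<bar>h n\<bar> \<le> H" by (auto simp: Bseq_def)
    have H0: "H \<ge> 0" using H[of 0] by simp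
    have eq: "(?G (a + h n) - ?G a) / h n = (\<integral>z. z ^ j * ((k ((a + h n) * z) - k (a * z)) / h n) \<partial>mu)" for n
      by (subst Bochner_Integration.integral_diff[symmetric, OF int_k int_k])
         (simp add: diff_divide_distrib right_diff_distrib flip: Bochner_Integration.integral_divide_zero)
    show "(\<lambda>n. (?G (a + h n) - ?G a) / h n) \<longlonglongrightarrow> (\<integral>z. z ^ Suc j * k' (a * z) \<partial>mu)"
      unfolding eq
    \<comment> \<open>The two weight sequences are those at the moving point a + h n and at the
      fixed point a, as in the Lipschitz bound for k.\<close>
    proof (rule weighted_limit[where A = "\<bar>a\<bar> + H" and a = "\<lambda>n. a + h n" and c = "\<lambda>n. a" and K = "L"])
      show "\<bar>a + h n\<bar> \<le> \<bar>a\<bar> + H" for n using H[of n] by linarith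
      show "\<bar>a\<bar> \<le> \<bar>a\<bar> + H" using H0 by simp
      show "(\<lambda>n. z ^ j * ((k ((a + h n) * z) - k (a * z)) / h n)) \<longlonglongrightarrow> z ^ Suc j * k' (a * z)" for z
      proof -
        have "((\<lambda>x. k (x * z)) has_real_derivative k' (a * z) * z) (at a)"
          by (rule DERIV_chain2[OF k]) (auto intro!: derivative_eq_intros)
        then have "(\<lambda>x. (k ((a + x) * z) - k (a * z)) / x) \<midarrow>0\<rightarrow> k' (a * z) * z"
          unfolding DERIV_def .
        then have "(\<lambda>n. (k ((a + h n) * z) - k (a * z)) / h n) \<longlonglongrightarrow> k' (a * z) * z"
          using h LIMSEQ_SEQ_conv[of 0 "\<lambda>x. (k ((a + x) * z) - k (a * z)) / x" "k' (a * z) * z"] by blast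
        from tendsto_mult[OF tendsto_const[of "z ^ j"] this] show ?thesis by (simp add: ac_simps)
      qed
      show "\<bar>z ^ j * ((k ((a + h n) * z) - k (a * z)) / h n)\<bar>
        \<le> L * (1 + \<bar>z\<bar> ^ 6) * (exp (b ((a + h n) * z)) + exp (b (a * z)))" for n z
      proof -
        let ?E = "exp (b ((a + h n) * z)) + exp (b (a * z))"
        have hn: "\<bar>h n\<bar> > 0" using h by simp
        have d: "\<bar>(a + h n) * z - a * z\<bar> = \<bar>h n\<bar> * \<bar>z\<bar>" by (simp add: algebra_simps abs_mult)
        have "\<bar>k ((a + h n) * z) - k (a * z)\<bar> / \<bar>h n\<bar> \<le> (L * (\<bar>h n\<bar> * \<bar>z\<bar>) * ?E) / \<bar>h n\<bar>"
          using L[of "(a + h n) * z" "a * z"] unfolding d by (intro divide_right_mono) auto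
        also have "\<dots> = L * \<bar>z\<bar> * ?E" using hn by simp
        finally have "\<bar>z\<bar> ^ j * (\<bar>k ((a + h n) * z) - k (a * z)\<bar> / \<bar>h n\<bar>) \<le> \<bar>z\<bar> ^ j * (L * \<bar>z\<bar> * ?E)"
          by (intro mult_left_mono) auto
        also have "\<dots> = \<bar>z\<bar> ^ Suc j * (L * ?E)" by simp
        also have "\<dots> \<le> (1 + \<bar>z\<bar> ^ 6) * (L * ?E)"
        proof (intro mult_right_mono)
          show "\<bar>z\<bar> ^ Suc j \<le> 1 + \<bar>z\<bar> ^ 6" using j by (intro abs_power_le_power_6) simp
          show "0 \<le> L * ?E" using L0 by (simp add: add_nonneg_nonneg)
        qed
        finally show ?thesis by (simp add: abs_mult power_abs ac_simps)
      qed
    qed (use int_k' in auto)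
  qed
qed

section \<open>Derivatives of the log-normaliser\<close>

lemma exp_b'_le: "\<bar>deriv b u * exp (b u)\<bar> \<le> M * exp (b u)"
  unfolding abs_mult abs_exp_cancel by (intro mult_right_mono b_deriv_bd) simp

lemma exp_b''_le: "\<bar>(deriv (deriv b) u + (deriv b u)\<^sup>2) * exp (b u)\<bar> \<le> (M + M * M) * exp (b u)"
proof -
  have "(deriv b u)\<^sup>2 \<le> M * M"
    using abs_le_square_iff[of "deriv b u" M] b_deriv_bd[of u] M_nonneg by (simp add: power2_eq_square)
  then have "\<bar>deriv (deriv b) u + (deriv b u)\<^sup>2\<bar> \<le> M + M * M"
    using b_deriv2_bd[of u] zero_le_power2[of "deriv b u"] by linarith
  then show ?thesis unfolding abs_mult abs_exp_cancel by (intro mult_right_mono) auto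
qed

definition Zt' :: "real \<Rightarrow> real" where "Zt' a = (\<integral>z. z * (deriv b (a * z) * exp (b (a * z))) \<partial>mu)"

definition Zt'' :: "real \<Rightarrow> real" where
  "Zt'' a = (\<integral>z. z\<^sup>2 * ((deriv (deriv b) (a * z) + (deriv b (a * z))\<^sup>2) * exp (b (a * z))) \<partial>mu)"

lemma Zt_derivative: "(Zt has_real_derivative Zt' a) (at a)"
proof -
  have "((\<lambda>a. \<integral>z. z ^ 0 * exp (b (a * z)) \<partial>mu) has_real_derivative
      (\<integral>z. z ^ Suc 0 * (deriv b (a * z) * exp (b (a * z))) \<partial>mu)) (at a)"
  proof (rule weighted_integral_derivative[where L = M and L' = 1])
    show "((\<lambda>u. exp (b u)) has_real_derivative deriv b u * exp (b u)) (at u)" for u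
      using DERIV_chain2[OF DERIV_exp b_deriv] by (simp add: mult.commute)
    show "\<bar>exp (b u) - exp (b v)\<bar> \<le> M * \<bar>u - v\<bar> * (exp (b u) + exp (b v))" for u v
      by (rule order_trans[OF abs_exp_diff_le]) (intro mult_right_mono b_lipschitz, simp add: add_nonneg_nonneg)
  qed (use exp_b'_le in auto)
  then show ?thesis by (simp add: Zt_def[abs_def] Zt'_def)
qed

lemma Zt'_derivative: "(Zt' has_real_derivative Zt'' a) (at a)"
proof -
  have "((\<lambda>a. \<integral>z. z ^ 1 * (deriv b (a * z) * exp (b (a * z))) \<partial>mu) has_real_derivative
      (\<integral>z. z ^ Suc 1 * ((deriv (deriv b) (a * z) + (deriv b (a * z))\<^sup>2) * exp (b (a * z))) \<partial>mu)) (at a)"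
  proof (rule weighted_integral_derivative[where L = "M + M * M" and L' = M])
    show "((\<lambda>u. deriv b u * exp (b u)) has_real_derivative (deriv (deriv b) u + (deriv b u)\<^sup>2) * exp (b u)) (at u)" for u
      using DERIV_mult[OF b_deriv2 DERIV_chain2[OF DERIV_exp b_deriv]]
      by (simp add: algebra_simps power2_eq_square)
    show "\<bar>deriv b u * exp (b u) - deriv b v * exp (b v)\<bar> \<le> (M + M * M) * \<bar>u - v\<bar> * (exp (b u) + exp (b v))" for u v
    proof -
      have "deriv b u * exp (b u) - deriv b v * exp (b v)
        = (deriv b u - deriv b v) * exp (b u) + deriv b v * (exp (b u) - exp (b v))"
        by (simp add: algebra_simps)
      also have "\<bar>\<dots>\<bar> \<le> \<bar>deriv b u - deriv b v\<bar> * exp (b u) + \<bar>deriv b v\<bar> * \<bar>exp (b u) - exp (b v)\<bar>"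
        by (rule order_trans[OF abs_triangle_ineq]) (simp add: abs_mult)
      also have "\<dots> \<le> (M * \<bar>u - v\<bar>) * (exp (b u) + exp (b v)) + M * ((M * \<bar>u - v\<bar>) * (exp (b u) + exp (b v)))"
        using M_nonneg
        by (intro add_mono mult_mono b'_lipschitz b_deriv_bd order_trans[OF abs_exp_diff_le] b_lipschitz mult_nonneg_nonneg)
           (auto simp: add_nonneg_nonneg)
      finally show ?thesis by (simp add: algebra_simps)
    qed
  qed (use exp_b'_le exp_b''_le in auto)
  then show ?thesis by (simp add: Zt'_def[abs_def] Zt''_def numeral_2_eq_2)
qed

lemma Zt'_le: "\<bar>Zt' a\<bar> \<le> M * (\<integral>z. exp (b (a * z)) * \<bar>z\<bar> \<partial>mu)"
  using weighted_integral_bound(2)[OF _ exp_b'_le, of 1 a] by (simp add: Zt'_def)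

lemma Zt''_le: "\<bar>Zt'' a\<bar> \<le> (M + M * M) * (\<integral>z. exp (b (a * z)) * z\<^sup>2 \<partial>mu)"
  using weighted_integral_bound(2)[OF _ exp_b''_le, of 2 a] by (simp add: Zt''_def)

definition psi :: "real \<Rightarrow> real" where "psi a = Zt' a / Zt a"

definition psi' :: "real \<Rightarrow> real" where "psi' a = Zt'' a / Zt a - (Zt' a / Zt a)\<^sup>2"

lemma ln_Zt_derivative: "((\<lambda>a. ln (Zt a)) has_real_derivative psi a) (at a)"
  using DERIV_chain2[OF DERIV_ln[OF Zt_pos] Zt_derivative] by (simp add: psi_def divide_inverse mult.commute)

lemma psi_derivative: "(psi has_real_derivative psi' a) (at a)"
proof -
  have "(psi has_real_derivative (Zt'' a * Zt a - Zt' a * Zt' a) / (Zt a * Zt a)) (at a)"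
    unfolding psi_def[abs_def] using Zt_pos[of a] by (intro DERIV_divide Zt'_derivative Zt_derivative) auto
  moreover have "(Zt'' a * Zt a - Zt' a * Zt' a) / (Zt a * Zt a) = psi' a"
    using Zt_pos[of a] by (simp add: psi'_def diff_divide_distrib power2_eq_square)
  ultimately show ?thesis by simp
qed

lemma psi_0: "psi 0 = 0"
proof -
  have "Zt' 0 = (\<integral>z. z * (1/2) \<partial>mu)" by (simp add: Zt'_def b'_0 b_0)
  also have "\<dots> = 0" using mu_mean by (simp only: Bochner_Integration.integral_mult_left_zero)
  finally show ?thesis by (simp add: psi_def)
qed

text \<open>Unit variance leaves b''(0) + b'(0)^2, and the reflection identity forces b'(0) = 1/2.
  This number is the 1/2 + g''(1) of theta.\<close>

lemma psi'_0: "psi' 0 = deriv (deriv b) 0 + 1/4"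
proof -
  have "Zt'' 0 = (\<integral>z. z\<^sup>2 * (deriv (deriv b) 0 + 1/4) \<partial>mu)" by (simp add: Zt''_def b'_0 b_0 power2_eq_square)
  also have "\<dots> = deriv (deriv b) 0 + 1/4" using mu_var by (simp only: Bochner_Integration.integral_mult_left_zero mult_1_left)
  finally show ?thesis using psi_0 by (simp add: psi'_def psi_def Zt_0)
qed

text \<open>Both terms of \<open>psi'\<close> are bounded by the second tilted moment relative to
  \<open>Zt\<close>, the squared first one by Cauchy-Schwarz; the moment hypothesis then supplies
  the growth in a.\<close>

lemma psi'_le: "\<bar>psi' a\<bar> \<le> (M + 2 * (M * M)) * (1 + C) * (1 + npow \<bar>a\<bar> \<beta>)"
proof -
  define m1 where "m1 = (\<integral>z. exp (b (a * z)) * \<bar>z\<bar> \<partial>mu)"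
  define m2 where "m2 = (\<integral>z. exp (b (a * z)) * z\<^sup>2 \<partial>mu)"
  define m where "m = m1 / Zt a"
  note Z = Zt_pos[of a]
  have i1: "integrable mu (\<lambda>z. exp (b (a * z)) * \<bar>z\<bar>)" using int_exp_abs_power[of 1 a] by simp
  have i2: "integrable mu (\<lambda>z. exp (b (a * z)) * z\<^sup>2)" using int_exp_abs_power[of 2 a] by simp
  have m10: "m1 \<ge> 0" unfolding m1_def by (intro integral_nonneg_AE) auto
  \<comment> \<open>The tilted variance of |z| about its tilted mean m is nonnegative.\<close>
  have "0 \<le> (\<integral>z. exp (b (a * z)) * (\<bar>z\<bar> - m)\<^sup>2 \<partial>mu)" by (intro integral_nonneg_AE) auto
  also have "\<dots> = (\<integral>z. exp (b (a * z)) * z\<^sup>2 - 2 * m * (exp (b (a * z)) * \<bar>z\<bar>) + m\<^sup>2 * exp (b (a * z)) \<partial>mu)"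
    by (intro Bochner_Integration.integral_cong refl) (simp add: power2_diff algebra_simps)
  also have "\<dots> = m2 - 2 * m * m1 + m\<^sup>2 * Zt a"
    unfolding m1_def m2_def Zt_def using i1 i2 int_exp[of a] by simp
  also have "\<dots> = m2 - m\<^sup>2 * Zt a" using Z by (simp add: m_def field_simps power2_eq_square)
  finally have cs: "m\<^sup>2 \<le> m2 / Zt a" using Z by (simp add: field_simps)
  have m2: "m2 / Zt a \<le> (1 + C) * (1 + npow \<bar>a\<bar> \<beta>)"
    using exp_abs_power_le[of 2 a] Z by (simp add: m2_def pos_divide_le_eq)
  have "\<bar>Zt' a / Zt a\<bar> \<le> M * m"
    using Zt'_le[of a] Z by (simp add: m_def m1_def abs_div_pos[symmetric] divide_right_mono)
  then have "(Zt' a / Zt a)\<^sup>2 \<le> (M * m)\<^sup>2" by (metis abs_ge_zero power2_abs power_mono)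
  also have "\<dots> = M * M * m\<^sup>2" by (simp add: power2_eq_square)
  also have "\<dots> \<le> M * M * (m2 / Zt a)" using cs M_nonneg by (intro mult_left_mono) auto
  finally have 1: "(Zt' a / Zt a)\<^sup>2 \<le> M * M * (m2 / Zt a)" .
  have 2: "\<bar>Zt'' a / Zt a\<bar> \<le> (M + M * M) * (m2 / Zt a)"
    using divide_right_mono[OF Zt''_le[of a], of "Zt a"] Z by (simp add: m2_def abs_div_pos[symmetric])
  have "\<bar>psi' a\<bar> \<le> \<bar>Zt'' a / Zt a\<bar> + (Zt' a / Zt a)\<^sup>2"
    unfolding psi'_def using zero_le_power2[of "Zt' a / Zt a"] by linarith
  also have "\<dots> \<le> (M + M * M) * (m2 / Zt a) + M * M * (m2 / Zt a)" by (intro add_mono 1 2)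
  also have "\<dots> = (M + 2 * (M * M)) * (m2 / Zt a)" by (simp only: distrib_right mult_2 add.assoc)
  also have "\<dots> \<le> (M + 2 * (M * M)) * ((1 + C) * (1 + npow \<bar>a\<bar> \<beta>))"
    using M_nonneg m2 by (intro mult_left_mono) auto
  finally show ?thesis by (simp add: mult.assoc)
qed

text \<open>The continuous extension of psi(a)/a, with value psi'(0) at 0. It splits a factor s phi'
  off psi(s phi').\<close>

definition psi_quot :: "real \<Rightarrow> real" where
  "psi_quot a = (if a = 0 then deriv (deriv b) 0 + 1/4 else psi a / a)"

lemma psi_eq: "psi a = a * psi_quot a"
  by (simp add: psi_quot_def psi_0)

lemma quot_isCont:
  assumes "(f has_real_derivative d) (at 0)" "f 0 = 0" "\<And>a. a \<noteq> 0 \<Longrightarrow> q a = f a / a" "q 0 = d"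
  shows "isCont q (0::real)"
proof -
  have "(\<lambda>h. f h / h) \<midarrow>0\<rightarrow> d" using assms(1,2) by (simp add: DERIV_def)
  moreover have "(q \<longlongrightarrow> d) (at 0) = ((\<lambda>h. f h / h) \<longlongrightarrow> d) (at 0)"
    by (rule filterlim_cong) (auto simp: eventually_at_filter assms(3))
  ultimately show ?thesis by (simp add: isCont_def assms(4))
qed

lemma psi_quot_isCont: "isCont psi_quot 0"
  by (rule quot_isCont[OF psi_derivative]) (auto simp: psi_0 psi'_0 psi_quot_def)

lemma psi_quot_le: "\<bar>psi_quot a\<bar> \<le> (M + 2 * (M * M)) * (1 + C) * (1 + npow \<bar>a\<bar> \<beta>)"
proof (cases "a = 0")
  case True
  then show ?thesis using psi'_le[of 0] by (simp add: psi'_0 psi_quot_def)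
next
  case False
  let ?L = "(M + 2 * (M * M)) * (1 + C)"
  have L: "?L \<ge> 0" using M_nonneg C_pos by simp
  have "norm (psi a - psi 0) \<le> ?L * (1 + npow \<bar>a\<bar> \<beta>) * norm (a - 0)"
  \<comment> \<open>On this symmetric interval the growth factor is largest at the endpoints, so one
    constant bounds psi'.\<close>
  proof (rule field_differentiable_bound[of "{- \<bar>a\<bar>..\<bar>a\<bar>}" psi psi'])
    show "norm (psi' z) \<le> ?L * (1 + npow \<bar>a\<bar> \<beta>)" if "z \<in> {- \<bar>a\<bar>..\<bar>a\<bar>}" for z
      unfolding real_norm_def using that L beta
      by (intro order_trans[OF psi'_le] mult_left_mono add_left_mono npow_mono) auto
  qed (auto intro: DERIV_subset[OF psi_derivative])
  then show ?thesis using False by (simp add: psi_quot_def psi_0 abs_divide pos_divide_le_eq)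
qed

text \<open>\<open>b(u) - u/2\<close> is even, so its derivative vanishes at 0 and factors through \<open>u\<close>.\<close>
definition even_quot :: "real \<Rightarrow> real" where
  "even_quot u = (if u = 0 then deriv (deriv b) 0 else (deriv b u - 1/2) / u)"

lemma even_quot_eq: "deriv b u - 1/2 = u * even_quot u"
  by (simp add: even_quot_def b'_0)

lemma even_quot_isCont: "isCont even_quot 0"
proof (rule quot_isCont)
  show "((\<lambda>u. deriv b u - 1/2) has_real_derivative deriv (deriv b) 0) (at 0)"
    using b_deriv2[of 0] by (auto intro!: derivative_eq_intros)
qed (auto simp: b'_0 even_quot_def)

lemma even_quot_le: "\<bar>even_quot u\<bar> \<le> M"
  using b_deriv2_bd[of 0] b'_lipschitz[of u 0]
  by (auto simp: even_quot_def b'_0 abs_divide pos_divide_le_eq)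

lemma int_mu_power: assumes "k \<le> 6" shows "integrable mu (\<lambda>z. \<bar>z\<bar> ^ k)" "integrable mu (\<lambda>z. z ^ k)"
proof -
  show 1: "integrable mu (\<lambda>z. \<bar>z\<bar> ^ k)" using int_exp_abs_power[OF assms, of 0] by (simp add: b_0)
  show "integrable mu (\<lambda>z. z ^ k)"
    by (rule Bochner_Integration.integrable_bound[OF 1]) (auto simp: power_abs)
qed

end

section \<open>Expansion of the log-ratio\<close>

text \<open>The step t may have either sign, as proposals move both ways; only the distance of the
  intermediate point from x matters later.\<close>

lemma mvt_between:
  fixes f f' :: "real \<Rightarrow> real"
  assumes "\<And>u. (f has_real_derivative f' u) (at u)"
  shows "\<exists>v. \<bar>v - x\<bar> \<le> \<bar>t\<bar> \<and> f (x + t) - f x = t * f' v"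
proof (cases t "0::real" rule: linorder_cases)
  case less
  with MVT2[of "x + t" x f f'] assms obtain z where z: "x + t < z" "z < x" "f x - f (x + t) = (x - (x + t)) * f' z"
    by auto
  then show ?thesis using less by (intro exI[of _ z]) (auto simp: algebra_simps)
next
  case greater
  with MVT2[of x "x + t" f f'] assms obtain z where "z > x" "z < x + t" "f (x + t) - f x = (x + t - x) * f' z"
    by auto
  then show ?thesis using greater by (intro exI[of _ z]) auto
qed (auto intro!: exI[of _ x])

lemma taylor_between:
  fixes d :: "nat \<Rightarrow> real \<Rightarrow> real"
  assumes n: "n > 0" and d: "\<And>m u. m < n \<Longrightarrow> (d m has_real_derivative d (Suc m) u) (at u)"
  shows "\<exists>v. \<bar>v - x\<bar> \<le> \<bar>t\<bar> \<and> d 0 (x + t) = (\<Sum>m<n. d m x / fact m * t ^ m) + d n v / fact n * t ^ n"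
proof (cases "t = 0")
  case True
  have "(\<Sum>m<n. d m x / fact m * 0 ^ m) = (\<Sum>m<n. if m = 0 then d 0 x else 0)"
    by (intro sum.cong) (auto simp: power_0_left)
  then show ?thesis using True n by (auto simp: power_0_left intro!: exI[of _ x])
next
  case False
  have "\<exists>v. (if x + t < x then x + t < v \<and> v < x else x < v \<and> v < x + t) \<and>
    d 0 (x + t) = (\<Sum>m<n. d m x / fact m * (x + t - x) ^ m) + d n v / fact n * (x + t - x) ^ n"
    by (rule Taylor[where a = "x - \<bar>t\<bar>" and b = "x + \<bar>t\<bar>"]) (use n d False in auto)
  then obtain v where v: "if x + t < x then x + t < v \<and> v < x else x < v \<and> v < x + t"
    "d 0 (x + t) = (\<Sum>m<n. d m x / fact m * (x + t - x) ^ m) + d n v / fact n * (x + t - x) ^ n"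
    by blast
  from v(1) have "\<bar>v - x\<bar> \<le> \<bar>t\<bar>" by (auto split: if_splits)
  with v(2) show ?thesis by (intro exI[of _ v]) simp
qed

text \<open>\<open>dom\<close> is an envelope over unit windows around x, so that it also covers the
  intermediate points of Taylor expansions. It must be integrable against 1 + |phi'|^beta because
  that factor comes from the proposal's moments.\<close>

locale mh_target = balanced_proposal b mu M C \<beta> \<xi>
  for b :: "real \<Rightarrow> real" and mu M C \<beta> \<xi> +
  fixes phi :: "real \<Rightarrow> real" and dom :: "real \<Rightarrow> real"
  assumes dens: "(\<integral>\<^sup>+x. ennreal (exp (phi x)) \<partial>lborel) = 1"
    and phi_deriv: "(phi has_real_derivative deriv phi x) (at x)"
    and phi_deriv2: "(deriv phi has_real_derivative deriv (deriv phi) x) (at x)"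
    and phi_deriv3: "(deriv (deriv phi) has_real_derivative deriv (deriv (deriv phi)) x) (at x)"
    and phi_deriv3_cont: "continuous_on UNIV (deriv (deriv (deriv phi)))"
    and dom_int: "integrable (piM phi) (\<lambda>x. dom x * (1 + npow \<bar>deriv phi x\<bar> \<beta>))"
    and dom_ge_1: "1 \<le> dom x"
    and dom_d3: "\<bar>v - x\<bar> \<le> 1 \<Longrightarrow> (deriv (deriv (deriv phi)) v)\<^sup>2 \<le> dom x"
    and dom_d12: "\<bar>v - x\<bar> \<le> 1 \<Longrightarrow> (deriv phi v * deriv (deriv phi) v)\<^sup>2 \<le> dom x"
    and dom_d12_beta: "\<bar>v - x\<bar> \<le> 1 \<Longrightarrow> (deriv (deriv phi) v * \<bar>deriv phi v\<bar> powr (1 + \<beta>))\<^sup>2 \<le> dom x"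
begin

abbreviation "d1 \<equiv> deriv phi"
abbreviation "d2 \<equiv> deriv (deriv phi)"
abbreviation "d3 \<equiv> deriv (deriv (deriv phi))"
abbreviation "curv \<equiv> deriv (deriv b) 0"

text \<open>The logarithm of pi(y) q(y,x) / (pi(x) q(x,y)) for y = x + s w. The reverse jump is -w,
  so its weight has argument (x - y) phi'(y); the factors of the symmetric \<open>mu\<close>
  cancel.\<close>

definition log_ratio :: "real \<Rightarrow> real \<Rightarrow> real \<Rightarrow> real" where
  "log_ratio s x y = phi y - phi x + b ((x - y) * d1 y) - b ((y - x) * d1 x)
     - ln (Zt (s * d1 y)) + ln (Zt (s * d1 x))"

text \<open>The coefficient of s^3 in \<open>log_ratio s x (x + s w)\<close>; -1/12 = 1/6 - 1/4 is
  the error constant of the trapezoidal rule.\<close>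

definition lead :: "real \<Rightarrow> real \<Rightarrow> real" where
  "lead x w = w ^ 3 * (- d3 x / 12 + curv * (d1 x * d2 x)) - w * ((curv + 1/4) * (d1 x * d2 x))"

lemma Zt_isCont: "isCont Zt a"
  by (rule DERIV_isCont[OF Zt_derivative])

lemma phi_cont: "continuous_on S phi" "continuous_on S d1" "continuous_on S d2"
  by (rule DERIV_continuous_on[OF phi_deriv[THEN DERIV_subset]] DERIV_continuous_on[OF phi_deriv2[THEN DERIV_subset]]
      DERIV_continuous_on[OF phi_deriv3[THEN DERIV_subset]]; simp)+

lemma phi_measurable [measurable]: "phi \<in> borel_measurable borel" "d1 \<in> borel_measurable borel"
    "d2 \<in> borel_measurable borel" "d3 \<in> borel_measurable borel"
  using phi_cont phi_deriv3_cont by (auto intro: borel_measurable_continuous_onI)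

lemma Zt_measurable [measurable]: "Zt \<in> borel_measurable borel"
  by (intro borel_measurable_continuous_onI continuous_at_imp_continuous_on) (auto simp: Zt_isCont)

lemma taylor_phi: "\<exists>v. \<bar>v - x\<bar> \<le> \<bar>t\<bar> \<and> phi (x + t) = phi x + t * d1 x + t\<^sup>2 / 2 * d2 x + t ^ 3 / 6 * d3 v"
  using taylor_between[of 3 "\<lambda>m. (deriv ^^ m) phi" x t] phi_deriv phi_deriv2 phi_deriv3
  by (fastforce simp: less_Suc_eq numeral_3_eq_3 power2_eq_square field_simps)

lemma taylor_d1: "\<exists>v. \<bar>v - x\<bar> \<le> \<bar>t\<bar> \<and> d1 (x + t) = d1 x + t * d2 x + t\<^sup>2 / 2 * d3 v"
  using taylor_between[of 2 "\<lambda>m. (deriv ^^ Suc m) phi" x t] phi_deriv2 phi_deriv3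
  by (fastforce simp: less_Suc_eq numeral_2_eq_2 field_simps)

text \<open>The ratio splits into the trapezoidal error of phi over [x, x + t], the increment of the
  even function b(u) - u/2 at u = t phi', and the increment of the log-normaliser. Each is of third
  order in t and s jointly, and each may use its own intermediate point.\<close>

lemma log_ratio_expansion:
  "\<exists>v1 v2 v3 v4. \<bar>v1 - x\<bar> \<le> \<bar>t\<bar> \<and> \<bar>v2 - x\<bar> \<le> \<bar>t\<bar> \<and> \<bar>v3 - x\<bar> \<le> \<bar>t\<bar> \<and> \<bar>v4 - x\<bar> \<le> \<bar>t\<bar> \<and>
    log_ratio s x (x + t) = t ^ 3 * (d3 v1 / 6 - d3 v2 / 4)
      + t ^ 3 * even_quot (t * d1 v3) * (d1 v3 * d2 v3) - t * s\<^sup>2 * psi_quot (s * d1 v4) * (d1 v4 * d2 v4)"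
proof -
  obtain v1 where v1: "\<bar>v1 - x\<bar> \<le> \<bar>t\<bar>" "phi (x + t) = phi x + t * d1 x + t\<^sup>2 / 2 * d2 x + t ^ 3 / 6 * d3 v1"
    using taylor_phi by blast
  obtain v2 where v2: "\<bar>v2 - x\<bar> \<le> \<bar>t\<bar>" "d1 (x + t) = d1 x + t * d2 x + t\<^sup>2 / 2 * d3 v2"
    using taylor_d1 by blast
  have "((\<lambda>u. b (t * d1 u) - t * d1 u / 2) has_real_derivative (t * d1 u) * even_quot (t * d1 u) * (t * d2 u)) (at u)" for u
  proof -
    have i: "((\<lambda>u. t * d1 u) has_real_derivative t * d2 u) (at u)"
      by (rule DERIV_cmult[OF phi_deriv2])
    have "((\<lambda>u. b (t * d1 u) - t * d1 u / 2) has_real_derivative deriv b (t * d1 u) * (t * d2 u) - t * d2 u / 2) (at u)"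
      by (rule DERIV_diff[OF DERIV_chain2[OF b_deriv i] DERIV_cdivide[OF i]])
    then show ?thesis unfolding even_quot_eq[symmetric] by (simp add: algebra_simps)
  qed
  from mvt_between[OF this, of x t] obtain v3 where v3: "\<bar>v3 - x\<bar> \<le> \<bar>t\<bar>"
    "(b (t * d1 (x + t)) - t * d1 (x + t) / 2) - (b (t * d1 x) - t * d1 x / 2) = t * ((t * d1 v3) * even_quot (t * d1 v3) * (t * d2 v3))"
    by auto
  have "((\<lambda>u. ln (Zt (s * d1 u))) has_real_derivative psi (s * d1 u) * (s * d2 u)) (at u)" for u
    by (rule DERIV_chain2[OF ln_Zt_derivative DERIV_cmult[OF phi_deriv2]])
  from mvt_between[OF this, of x t] obtain v4 where v4: "\<bar>v4 - x\<bar> \<le> \<bar>t\<bar>"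
    "ln (Zt (s * d1 (x + t))) - ln (Zt (s * d1 x)) = t * (psi (s * d1 v4) * (s * d2 v4))"
    by auto
  \<comment> \<open>Reflection turns the reverse weight into the forward one and leaves the linear
    term that completes the trapezoidal rule.\<close>
  have refl: "b (- (t * d1 (x + t))) = b (t * d1 (x + t)) - t * d1 (x + t)"
    using b_refl[of "t * d1 (x + t)"] by simp
  have "log_ratio s x (x + t) = (phi (x + t) - phi x - t * d1 x / 2 - t * d1 (x + t) / 2)
      + ((b (t * d1 (x + t)) - t * d1 (x + t) / 2) - (b (t * d1 x) - t * d1 x / 2))
      - (ln (Zt (s * d1 (x + t))) - ln (Zt (s * d1 x)))"
    unfolding log_ratio_def using refl by (simp add: algebra_simps)
  also have "phi (x + t) - phi x - t * d1 x / 2 - t * d1 (x + t) / 2 = t ^ 3 * (d3 v1 / 6 - d3 v2 / 4)"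
    unfolding v1(2) v2(2) by (simp add: field_simps power2_eq_square power3_eq_cube)
  also note v3(2)
  also note v4(2)
  also have "t * (t * d1 v3 * even_quot (t * d1 v3) * (t * d2 v3)) = t ^ 3 * even_quot (t * d1 v3) * (d1 v3 * d2 v3)"
    by (simp add: power3_eq_cube)
  also have "t * (psi (s * d1 v4) * (s * d2 v4)) = t * s\<^sup>2 * psi_quot (s * d1 v4) * (d1 v4 * d2 v4)"
    by (simp add: psi_eq power2_eq_square)
  finally show ?thesis using v1(1) v2(1) v3(1) v4(1) by blast
qed

text \<open>The bracket adds the constants of the three parts of the expansion; the leading 2 comes
  from (|w|^3 + |w|)^2 <= 2 (w^6 + w^2).\<close>

definition bd_const :: real where
  "bd_const = 2 * (1 + M + 2 * ((M + 2 * (M * M)) * (1 + C)))\<^sup>2"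

text \<open>The restriction |s w| <= 1 keeps all intermediate points in the unit window governed by
  \<open>dom\<close>.\<close>

lemma log_ratio_bound:
  assumes s: "0 < s" "s \<le> 1" and sw: "\<bar>s * w\<bar> \<le> 1"
  shows "(log_ratio s x (x + s * w) / s ^ 3)\<^sup>2 \<le> bd_const * (w ^ 6 + w\<^sup>2) * dom x"
proof -
  define L where "L = (M + 2 * (M * M)) * (1 + C)"
  have L: "L \<ge> 0" unfolding L_def using M_nonneg C_pos by simp
  obtain v1 v2 v3 v4 where v: "\<bar>v1 - x\<bar> \<le> 1" "\<bar>v2 - x\<bar> \<le> 1" "\<bar>v3 - x\<bar> \<le> 1" "\<bar>v4 - x\<bar> \<le> 1"
    and eq: "log_ratio s x (x + s * w) = (s * w) ^ 3 * (d3 v1 / 6 - d3 v2 / 4)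
      + (s * w) ^ 3 * even_quot (s * w * d1 v3) * (d1 v3 * d2 v3) - (s * w) * s\<^sup>2 * psi_quot (s * d1 v4) * (d1 v4 * d2 v4)"
    using log_ratio_expansion[of x "s * w" s] sw by (meson order_trans)
  define q where "q = sqrt (dom x)"
  have q: "q \<ge> 0" "q\<^sup>2 = dom x" using dom_ge_1[of x] by (auto simp: q_def)
  have le_q: "\<bar>r\<bar> \<le> q" if "r\<^sup>2 \<le> dom x" for r using that by (simp add: q_def real_le_rsqrt)
  have e: "log_ratio s x (x + s * w) / s ^ 3 = w ^ 3 * (d3 v1 / 6 - d3 v2 / 4)
      + w ^ 3 * (even_quot (s * w * d1 v3) * (d1 v3 * d2 v3)) - w * (psi_quot (s * d1 v4) * (d1 v4 * d2 v4))"
    unfolding eq using s by (simp add: field_simps power2_eq_square power3_eq_cube)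
  have 1: "\<bar>d3 v1 / 6 - d3 v2 / 4\<bar> \<le> q"
    using le_q[OF dom_d3[OF v(1)]] le_q[OF dom_d3[OF v(2)]] q(1) by linarith
  have 2: "\<bar>even_quot (s * w * d1 v3) * (d1 v3 * d2 v3)\<bar> \<le> M * q"
    unfolding abs_mult[of "even_quot _"] using M_nonneg
    by (intro mult_mono even_quot_le le_q dom_d12 v) auto
  \<comment> \<open>The growth factor of \<open>psi_quot\<close> multiplies |phi' phi''|; this is
    the source of the term phi'' |phi'|^(1+beta) in Assumption 1.\<close>
  have 3: "\<bar>psi_quot (s * d1 v4) * (d1 v4 * d2 v4)\<bar> \<le> 2 * L * q"
  proof -
    have "\<bar>psi_quot (s * d1 v4) * (d1 v4 * d2 v4)\<bar> \<le> L * (1 + npow \<bar>d1 v4\<bar> \<beta>) * \<bar>d1 v4 * d2 v4\<bar>"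
      unfolding abs_mult[of "psi_quot _"] L_def using s beta L unfolding L_def
      by (intro mult_right_mono order_trans[OF psi_quot_le] mult_left_mono add_left_mono npow_mult_le) auto
    also have "\<dots> = L * (\<bar>d1 v4 * d2 v4\<bar> + \<bar>d2 v4 * \<bar>d1 v4\<bar> powr (1 + \<beta>)\<bar>)"
      using beta by (simp add: npow_def abs_mult powr_add algebra_simps)
    also have "\<dots> \<le> L * (q + q)"
      using L by (intro mult_left_mono add_mono le_q dom_d12 dom_d12_beta v) auto
    finally show ?thesis by simp
  qed
  have "\<bar>log_ratio s x (x + s * w) / s ^ 3\<bar> \<le> \<bar>w\<bar> ^ 3 * q + \<bar>w\<bar> ^ 3 * (M * q) + \<bar>w\<bar> * (2 * L * q)"
  proof -
    have "\<bar>log_ratio s x (x + s * w) / s ^ 3\<bar> \<le> \<bar>w ^ 3 * (d3 v1 / 6 - d3 v2 / 4)\<bar>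
      + \<bar>w ^ 3 * (even_quot (s * w * d1 v3) * (d1 v3 * d2 v3))\<bar> + \<bar>w * (psi_quot (s * d1 v4) * (d1 v4 * d2 v4))\<bar>"
      unfolding e by linarith
    also have "\<dots> \<le> \<bar>w\<bar> ^ 3 * q + \<bar>w\<bar> ^ 3 * (M * q) + \<bar>w\<bar> * (2 * L * q)"
      unfolding abs_mult[of w] abs_mult[of "w ^ 3"] power_abs[symmetric]
      by (intro add_mono mult_left_mono 1 2 3) auto
    finally show ?thesis .
  qed
  also have "\<dots> \<le> (1 + M + 2 * L) * (\<bar>w\<bar> ^ 3 + \<bar>w\<bar>) * q"
    using q L M_nonneg by (simp add: algebra_simps add_nonneg_nonneg)
  finally have "\<bar>log_ratio s x (x + s * w) / s ^ 3\<bar>\<^sup>2 \<le> ((1 + M + 2 * L) * (\<bar>w\<bar> ^ 3 + \<bar>w\<bar>) * q)\<^sup>2"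
    by (intro power_mono) auto
  also have "\<dots> = (1 + M + 2 * L)\<^sup>2 * (\<bar>w\<bar> ^ 3 + \<bar>w\<bar>)\<^sup>2 * dom x" by (simp only: power_mult_distrib q)
  also have "\<dots> \<le> (1 + M + 2 * L)\<^sup>2 * (2 * (w ^ 6 + w\<^sup>2)) * dom x"
  proof (intro mult_right_mono mult_left_mono)
    have "(\<bar>w\<bar> ^ 3 + \<bar>w\<bar>)\<^sup>2 \<le> 2 * ((\<bar>w\<bar> ^ 3)\<^sup>2 + \<bar>w\<bar>\<^sup>2)" using sum_squares_bound[of "\<bar>w\<bar> ^ 3" "\<bar>w\<bar>"] by (simp add: power2_sum)
    then show "(\<bar>w\<bar> ^ 3 + \<bar>w\<bar>)\<^sup>2 \<le> 2 * (w ^ 6 + w\<^sup>2)" by (simp flip: power_mult)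
  qed (use dom_ge_1[of x] in auto)
  also have "\<dots> = bd_const * (w ^ 6 + w\<^sup>2) * dom x" by (simp add: bd_const_def L_def)
  finally show ?thesis by (simp only: power2_abs)
qed

text \<open>The intermediate points are squeezed to x while the arguments of the two quotients tend
  to 0, where these are continuous.\<close>

lemma log_ratio_limit:
  assumes s: "\<And>n. s n > 0" "s \<longlonglongrightarrow> 0"
  shows "(\<lambda>n. log_ratio (s n) x (x + s n * w) / s n ^ 3) \<longlonglongrightarrow> lead x w"
proof -
  have "\<forall>n. \<exists>v1 v2 v3 v4. \<bar>v1 - x\<bar> \<le> \<bar>s n * w\<bar> \<and> \<bar>v2 - x\<bar> \<le> \<bar>s n * w\<bar> \<and> \<bar>v3 - x\<bar> \<le> \<bar>s n * w\<bar> \<and> \<bar>v4 - x\<bar> \<le> \<bar>s n * w\<bar> \<and>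
    log_ratio (s n) x (x + s n * w) = (s n * w) ^ 3 * (d3 v1 / 6 - d3 v2 / 4)
      + (s n * w) ^ 3 * even_quot (s n * w * d1 v3) * (d1 v3 * d2 v3)
      - s n * w * (s n)\<^sup>2 * psi_quot (s n * d1 v4) * (d1 v4 * d2 v4)"
    by (intro allI log_ratio_expansion)
  then obtain v1 v2 v3 v4 where v: "\<And>n. \<bar>v1 n - x\<bar> \<le> \<bar>s n * w\<bar>" "\<And>n. \<bar>v2 n - x\<bar> \<le> \<bar>s n * w\<bar>"
      "\<And>n. \<bar>v3 n - x\<bar> \<le> \<bar>s n * w\<bar>" "\<And>n. \<bar>v4 n - x\<bar> \<le> \<bar>s n * w\<bar>"
    and eq: "\<And>n. log_ratio (s n) x (x + s n * w) = (s n * w) ^ 3 * (d3 (v1 n) / 6 - d3 (v2 n) / 4)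
      + (s n * w) ^ 3 * even_quot (s n * w * d1 (v3 n)) * (d1 (v3 n) * d2 (v3 n))
      - s n * w * (s n)\<^sup>2 * psi_quot (s n * d1 (v4 n)) * (d1 (v4 n) * d2 (v4 n))"
    unfolding choice_iff by blast
  have sw: "(\<lambda>n. \<bar>s n * w\<bar>) \<longlonglongrightarrow> 0" using tendsto_mult[OF s(2) tendsto_const[of w]] by (simp add: tendsto_rabs_zero)
  have lim: "v \<longlonglongrightarrow> x" if "\<And>n. \<bar>v n - x\<bar> \<le> \<bar>s n * w\<bar>" for v :: "nat \<Rightarrow> real"
    by (rule LIM_zero_cancel, rule Lim_null_comparison[OF _ sw]) (use that in auto)
  note v' = lim[OF v(1)] lim[OF v(2)] lim[OF v(3)] lim[OF v(4)]
  have c: "isCont d1 x" "isCont d2 x" "isCont d3 x"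
    using phi_deriv3_cont
    by (auto simp: continuous_on_eq_continuous_at intro: DERIV_isCont phi_deriv2 phi_deriv3)
  have e: "log_ratio (s n) x (x + s n * w) / s n ^ 3 = w ^ 3 * (d3 (v1 n) / 6 - d3 (v2 n) / 4)
      + w ^ 3 * (even_quot (s n * w * d1 (v3 n)) * (d1 (v3 n) * d2 (v3 n)))
      - w * (psi_quot (s n * d1 (v4 n)) * (d1 (v4 n) * d2 (v4 n)))" for n
    unfolding eq using s(1)[of n] by (simp add: field_simps power2_eq_square power3_eq_cube)
  have "(\<lambda>n. s n * w * d1 (v3 n)) \<longlonglongrightarrow> 0 * w * d1 x"
    by (intro tendsto_intros s isCont_tendsto_compose[OF c(1)] v')
  then have 1: "(\<lambda>n. even_quot (s n * w * d1 (v3 n))) \<longlonglongrightarrow> even_quot 0"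
    by (intro isCont_tendsto_compose[OF even_quot_isCont]) simp
  have "(\<lambda>n. s n * d1 (v4 n)) \<longlonglongrightarrow> 0 * d1 x"
    by (intro tendsto_intros s isCont_tendsto_compose[OF c(1)] v')
  then have 2: "(\<lambda>n. psi_quot (s n * d1 (v4 n))) \<longlonglongrightarrow> psi_quot 0"
    by (intro isCont_tendsto_compose[OF psi_quot_isCont]) simp
  have "(\<lambda>n. log_ratio (s n) x (x + s n * w) / s n ^ 3) \<longlonglongrightarrow> w ^ 3 * (d3 x / 6 - d3 x / 4)
      + w ^ 3 * (even_quot 0 * (d1 x * d2 x)) - w * (psi_quot 0 * (d1 x * d2 x))"
    unfolding e
    by (intro tendsto_intros 1 2 isCont_tendsto_compose[OF c(1)] isCont_tendsto_compose[OF c(2)]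
        isCont_tendsto_compose[OF c(3)] v') auto
  moreover have "w ^ 3 * (d3 x / 6 - d3 x / 4) + w ^ 3 * (even_quot 0 * (d1 x * d2 x)) - w * (psi_quot 0 * (d1 x * d2 x)) = lead x w"
    by (simp add: lead_def even_quot_def psi_quot_def algebra_simps)
  ultimately show ?thesis by simp
qed

end

section \<open>The one-coordinate chain and its reversal\<close>

locale mh_chain = mh_target "bfun g" mu M C \<beta> \<xi> phi dom
  for g :: "real \<Rightarrow> real" and mu M C \<beta> \<xi> phi dom +
  assumes g_pos: "t > 0 \<Longrightarrow> g t > 0"
begin

abbreviation "b \<equiv> bfun g"

lemma g_exp: "g (exp u) = exp (b u)"
  using g_pos[of "exp u"] by (simp add: bfun_def)

lemma Zs_eq: "Zs g mu phi s x = Zt (s * d1 x)"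
  by (simp add: Zs_def Zt_def g_exp ac_simps)

text \<open>The density with respect to \<open>mu\<close> of the standardised jump W given the state
  x.\<close>

definition wt :: "real \<Rightarrow> real \<Rightarrow> real \<Rightarrow> real" where
  "wt s x w = exp (b (s * w * d1 x)) / Zt (s * d1 x)"

lemma wt_pos: "wt s x w > 0"
  unfolding wt_def using Zt_pos by (intro divide_pos_pos) auto

lemma wt_measurable [measurable]:
  assumes [measurable]: "f \<in> borel_measurable N" "h \<in> borel_measurable N"
  shows "(\<lambda>p. wt s (f p) (h p)) \<in> borel_measurable N"
  unfolding wt_def by measurable

abbreviation "Q s x \<equiv> Qk g mu phi s x"

lemma Qk_eq: "Q s x = distr (density mu (\<lambda>w. ennreal (wt s x w))) borel (\<lambda>w. x + s * w)"
  by (simp add: Qk_def wt_def Zs_eq g_exp)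

lemma wt_integrable: "integrable mu (wt s x)"
  using integrable_divide_zero[OF int_exp[of "s * d1 x"], of "Zt (s * d1 x)"]
  by (simp add: wt_def[abs_def] ac_simps)

lemma wt_integral: "(\<integral>w. wt s x w \<partial>mu) = 1"
  using Zt_pos[of "s * d1 x"] by (simp add: wt_def) (simp add: Zt_def ac_simps)

lemma wt_nn_integral: "(\<integral>\<^sup>+w. ennreal (wt s x w) \<partial>mu) = 1"
  by (subst nn_integral_eq_integral[OF wt_integrable]) (auto simp: wt_integral wt_pos less_imp_le)

lemma Qk_prob: "prob_space (Q s x)"
  unfolding Qk_eq
proof (rule prob_space.prob_space_distr)
  show "prob_space (density mu (\<lambda>w. ennreal (wt s x w)))"
    by (rule prob_spaceI) (subst emeasure_density, auto simp: wt_nn_integral cong: nn_integral_cong)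
qed auto

lemma sets_Qk [simp, measurable_cong]: "sets (Q s x) = sets borel"
  by (simp add: Qk_def)

lemma space_Qk [simp]: "space (Q s x) = UNIV"
  by (simp add: Qk_def)

lemma nn_integral_Qk:
  assumes [measurable]: "f \<in> borel_measurable borel"
  shows "(\<integral>\<^sup>+y. f y \<partial>Q s x) = (\<integral>\<^sup>+w. ennreal (wt s x w) * f (x + s * w) \<partial>mu)"
  unfolding Qk_eq by (subst nn_integral_distr, simp, simp, subst nn_integral_density, auto)

lemma Qk_measurable: "Qk g mu phi s \<in> borel \<rightarrow>\<^sub>M prob_algebra borel"
  unfolding measurable_restrict_space2_iff prob_algebra_def
proof (intro conjI measurable_subprob_algebra)
  fix A :: "real set" assume [measurable]: "A \<in> sets borel"
  have "emeasure (Q s x) A = (\<integral>\<^sup>+w. ennreal (wt s x w) * indicator A (x + s * w) \<partial>mu)" for x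
    by (subst nn_integral_Qk[symmetric]) auto
  then show "(\<lambda>x. emeasure (Q s x) A) \<in> borel_measurable borel"
    by simp
qed (auto simp: Qk_prob prob_space_imp_subprob_space)

lemma piM_sets [simp, measurable_cong]: "sets (piM phi) = sets borel"
  by (simp add: piM_def)

lemma piM_space [simp]: "space (piM phi) = UNIV"
  by (simp add: piM_def)

lemma piM_prob: "prob_space (piM phi)"
  unfolding piM_def by (rule prob_spaceI) (subst emeasure_density, auto simp: dens)

sublocale pi: prob_space "piM phi" by (rule piM_prob)

section \<open>The joint law of state and proposal, and its reversal\<close>

abbreviation "J s \<equiv> Jm g mu phi s"
abbreviation "JN s n \<equiv> PiM {1..n :: nat} (\<lambda>_. Jm g mu phi s)"

lemma Jm_kernel_measurable:
  "(\<lambda>x. distr (Q s x) (borel \<Otimes>\<^sub>M borel) (\<lambda>y. (x, y))) \<in> piM phi \<rightarrow>\<^sub>M prob_algebra (borel \<Otimes>\<^sub>M borel)"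
  by (rule measurable_distr_prob_space2[where M = borel])
     (auto intro: measurable_compose[OF _ Qk_measurable] simp: measurable_cong_sets[OF piM_sets refl])

lemma sets_J [simp, measurable_cong]: "sets (J s) = sets (borel \<Otimes>\<^sub>M borel)"
  unfolding Jm_def by (rule sets_bind) auto

lemma space_J [simp]: "space (J s) = UNIV"
  using sets_eq_imp_space_eq[OF sets_J[of s]] by (simp add: space_pair_measure)

lemma J_prob: "prob_space (J s)"
  unfolding Jm_def
  by (rule prob_space_bind'[OF _ Jm_kernel_measurable]) (simp add: space_prob_algebra piM_prob)

sublocale J: prob_space "J s" for s by (rule J_prob)

lemma nn_integral_J:
  assumes [measurable]: "f \<in> borel_measurable (borel \<Otimes>\<^sub>M borel)"
  shows "(\<integral>\<^sup>+p. f p \<partial>J s) = (\<integral>\<^sup>+x. (\<integral>\<^sup>+w. ennreal (wt s x w) * f (x, x + s * w) \<partial>mu) \<partial>piM phi)"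
  unfolding Jm_def
  by (subst nn_integral_bind[where B = "borel \<Otimes>\<^sub>M borel", OF assms measurable_prob_algebraD[OF Jm_kernel_measurable]])
     (simp add: nn_integral_distr nn_integral_Qk)

text \<open>The x-integral is placed inside, against Lebesgue measure, so that it can be translated
  for each fixed w.\<close>

lemma nn_integral_J_lborel:
  assumes [measurable]: "f \<in> borel_measurable (borel \<Otimes>\<^sub>M borel)"
  shows "(\<integral>\<^sup>+p. f p \<partial>J s)
    = (\<integral>\<^sup>+w. (\<integral>\<^sup>+x. ennreal (exp (phi x) * wt s x w) * f (x, x + s * w) \<partial>lborel) \<partial>mu)"
proof -
  interpret pair_sigma_finite lborel mu
    by (intro pair_sigma_finite.intro sigma_finite_lborel mu.sigma_finite_measure_axioms)
  have "(\<integral>\<^sup>+p. f p \<partial>J s) = (\<integral>\<^sup>+x. ennreal (exp (phi x)) * (\<integral>\<^sup>+w. ennreal (wt s x w) * f (x, x + s * w) \<partial>mu) \<partial>lborel)"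
    unfolding nn_integral_J[OF assms] piM_def by (subst nn_integral_density) auto
  also have "\<dots> = (\<integral>\<^sup>+x. (\<integral>\<^sup>+w. ennreal (exp (phi x) * wt s x w) * f (x, x + s * w) \<partial>mu) \<partial>lborel)"
    by (subst nn_integral_cmult[symmetric]) (auto simp: ennreal_mult' wt_pos less_imp_le mult.assoc)
  also have "\<dots> = (\<integral>\<^sup>+w. (\<integral>\<^sup>+x. ennreal (exp (phi x) * wt s x w) * f (x, x + s * w) \<partial>lborel) \<partial>mu)"
    by (rule Fubini'[symmetric]) measurable
  finally show ?thesis .
qed

definition lr :: "real \<Rightarrow> real \<times> real \<Rightarrow> real" where
  "lr s p = log_ratio s (fst p) (snd p)"

lemma lr_measurable [measurable]: "lr s \<in> borel_measurable (borel \<Otimes>\<^sub>M borel)"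
  unfolding lr_def[abs_def] log_ratio_def by measurable

lemma lr_swap: "lr s (prod.swap p) = - lr s p"
  by (simp add: lr_def log_ratio_def)

lemma nn_integral_mu_uminus:
  assumes [measurable]: "f \<in> borel_measurable borel"
  shows "(\<integral>\<^sup>+w. f (- w) \<partial>mu) = (\<integral>\<^sup>+w. f w \<partial>mu)"
proof -
  have "(\<integral>\<^sup>+w. f w \<partial>mu) = (\<integral>\<^sup>+w. f w \<partial>distr mu borel uminus)" by (simp add: mu_symm)
  also have "\<dots> = (\<integral>\<^sup>+w. f (- w) \<partial>mu)" by (subst nn_integral_distr) auto
  finally show ?thesis by simp
qed

text \<open>The involution \<open>(x, w) \<mapsto> (x + s w, -w)\<close> preserves Lebesgue measure times \<open>mu\<close>
  and swaps the two coordinates of \<open>(x, x + s w)\<close>.\<close>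
lemma nn_integral_J_swap:
  assumes [measurable]: "f \<in> borel_measurable (borel \<Otimes>\<^sub>M borel)"
  shows "(\<integral>\<^sup>+p. f (prod.swap p) \<partial>J s) = (\<integral>\<^sup>+p. ennreal (exp (lr s p)) * f p \<partial>J s)"
proof -
  have sw: "(\<lambda>p. f (prod.swap p)) \<in> borel_measurable (borel \<Otimes>\<^sub>M borel)" unfolding prod.swap_def by measurable
  have "(\<integral>\<^sup>+p. f (prod.swap p) \<partial>J s)
    = (\<integral>\<^sup>+w. (\<integral>\<^sup>+x. ennreal (exp (phi x) * wt s x w) * f (x + s * w, x) \<partial>lborel) \<partial>mu)"
    by (subst nn_integral_J_lborel[OF sw]) simp
  also have "\<dots> = (\<integral>\<^sup>+w. (\<integral>\<^sup>+x. ennreal (exp (phi (x - s * w)) * wt s (x - s * w) w) * f (x, x - s * w) \<partial>lborel) \<partial>mu)"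
  proof (rule nn_integral_cong)
    fix w
    \<comment> \<open>Translation of x by s w, the first half of the involution.\<close>
    have "lborel = distr lborel borel (\<lambda>x. - (s * w) + x)" by (rule lborel_distr_plus[symmetric])
    then have "(\<integral>\<^sup>+x. ennreal (exp (phi x) * wt s x w) * f (x + s * w, x) \<partial>lborel)
      = (\<integral>\<^sup>+x. ennreal (exp (phi x) * wt s x w) * f (x + s * w, x) \<partial>distr lborel borel (\<lambda>x. - (s * w) + x))"
      by simp
    also have "\<dots> = (\<integral>\<^sup>+x. ennreal (exp (phi (x - s * w)) * wt s (x - s * w) w) * f (x, x - s * w) \<partial>lborel)"
      by (subst nn_integral_distr) auto
    finally show "(\<integral>\<^sup>+x. ennreal (exp (phi x) * wt s x w) * f (x + s * w, x) \<partial>lborel)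
      = (\<integral>\<^sup>+x. ennreal (exp (phi (x - s * w)) * wt s (x - s * w) w) * f (x, x - s * w) \<partial>lborel)" .
  qed
  \<comment> \<open>Symmetry of \<open>mu\<close>, the second half of the involution.\<close>
  also have "\<dots> = (\<integral>\<^sup>+w. (\<integral>\<^sup>+x. ennreal (exp (phi (x + s * w)) * wt s (x + s * w) (- w)) * f (x, x + s * w) \<partial>lborel) \<partial>mu)"
    by (subst nn_integral_mu_uminus[symmetric]) auto
  also have "\<dots> = (\<integral>\<^sup>+w. (\<integral>\<^sup>+x. ennreal (exp (phi x) * wt s x w) * (ennreal (exp (lr s (x, x + s * w))) * f (x, x + s * w)) \<partial>lborel) \<partial>mu)"
  proof (intro nn_integral_cong)
    fix w x
    \<comment> \<open>Here b((x - y) phi'(y)) - b((y - x) phi'(x)) and the two normalisers in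
      \<open>log_ratio\<close> are exactly the logarithm of the ratio of the weights.\<close>
    have "wt s x w * exp (lr s (x, x + s * w)) = wt s (x + s * w) (- w) * exp (phi (x + s * w) - phi x)"
      using Zt_pos[of "s * d1 x"] Zt_pos[of "s * d1 (x + s * w)"]
      by (simp add: wt_def lr_def log_ratio_def exp_add exp_diff field_simps)
    then have "exp (phi (x + s * w)) * wt s (x + s * w) (- w) = exp (phi x) * wt s x w * exp (lr s (x, x + s * w))"
      by (simp add: exp_diff field_simps)
    then show "ennreal (exp (phi (x + s * w)) * wt s (x + s * w) (- w)) * f (x, x + s * w)
      = ennreal (exp (phi x) * wt s x w) * (ennreal (exp (lr s (x, x + s * w))) * f (x, x + s * w))"
      by (simp add: ennreal_mult' wt_pos less_imp_le mult.assoc)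
  qed
  also have "\<dots> = (\<integral>\<^sup>+p. ennreal (exp (lr s p)) * f p \<partial>J s)"
    by (subst nn_integral_J_lborel) auto
  finally show ?thesis .
qed

lemma Jrev_eq_density: "Jrev g mu phi s = density (J s) (\<lambda>p. ennreal (exp (lr s p)))"
proof (rule measure_eqI)
  fix A assume "A \<in> sets (Jrev g mu phi s)"
  then have [measurable]: "A \<in> sets (borel \<Otimes>\<^sub>M borel)" by (simp add: Jrev_def)
  have "emeasure (Jrev g mu phi s) A = (\<integral>\<^sup>+p. indicator A p \<partial>Jrev g mu phi s)"
    by (subst nn_integral_indicator) (auto simp: Jrev_def)
  also have "\<dots> = (\<integral>\<^sup>+p. indicator A (prod.swap p) \<partial>J s)"
    unfolding Jrev_def by (subst nn_integral_distr) (auto simp: prod.swap_def case_prod_beta)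
  also have "\<dots> = (\<integral>\<^sup>+p. ennreal (exp (lr s p)) * indicator A p \<partial>J s)"
    by (rule nn_integral_J_swap) auto
  also have "\<dots> = emeasure (density (J s) (\<lambda>p. ennreal (exp (lr s p)))) A"
    by (subst emeasure_density) auto
  finally show "emeasure (Jrev g mu phi s) A = emeasure (density (J s) (\<lambda>p. ennreal (exp (lr s p)))) A" .
qed (simp add: Jrev_def)

text \<open>The density e^lr is positive and finite everywhere, so the default branch of
  \<open>rho\<close> is taken only on a null set.\<close>

lemma rho_AE: "AE p in J s. rho g mu phi s p = lr s p"
proof -
  have "AE p in J s. ennreal (exp (lr s p)) = RN_deriv (J s) (Jrev g mu phi s) p"
    by (rule J.RN_deriv_unique) (auto simp: Jrev_eq_density)
  then show ?thesis
  proof eventually_elim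
    case (elim p)
    show ?case by (simp add: rho_def elim[symmetric] Let_def)
  qed
qed

lemma rho_measurable [measurable]: "rho g mu phi s \<in> borel_measurable (borel \<Otimes>\<^sub>M borel)"
proof -
  have [measurable]: "RN_deriv (J s) (Jrev g mu phi s) \<in> borel_measurable (borel \<Otimes>\<^sub>M borel)"
    using borel_measurable_RN_deriv[of "J s" "Jrev g mu phi s"] by (simp add: measurable_cong_sets[OF sets_J refl])
  show ?thesis unfolding rho_def[abs_def] Let_def by measurable
qed

lemma swap_measurable [measurable]: "prod.swap \<in> (borel \<Otimes>\<^sub>M borel) \<rightarrow>\<^sub>M (borel \<Otimes>\<^sub>M borel)"
  unfolding prod.swap_def[abs_def] by measurable

lemma integral_J_swap:
  fixes f :: "real \<times> real \<Rightarrow> real"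
  assumes [measurable]: "f \<in> borel_measurable (borel \<Otimes>\<^sub>M borel)"
  shows "(\<integral>p. f (prod.swap p) \<partial>J s) = (\<integral>p. exp (lr s p) * f p \<partial>J s)"
    "integrable (J s) (\<lambda>p. f (prod.swap p)) \<longleftrightarrow> integrable (J s) (\<lambda>p. exp (lr s p) * f p)"
proof -
  have sw: "(\<lambda>(x, y). (y, x)) = (prod.swap :: real \<times> real \<Rightarrow> _)" by (auto simp: prod.swap_def)
  have "(\<integral>p. f (prod.swap p) \<partial>J s) = (\<integral>p. f p \<partial>Jrev g mu phi s)"
    unfolding Jrev_def sw by (subst integral_distr) auto
  then show "(\<integral>p. f (prod.swap p) \<partial>J s) = (\<integral>p. exp (lr s p) * f p \<partial>J s)"
    unfolding Jrev_eq_density by (simp add: integral_density)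
  have "integrable (J s) (\<lambda>p. f (prod.swap p)) \<longleftrightarrow> integrable (Jrev g mu phi s) f"
    unfolding Jrev_def sw by (subst integrable_distr_eq) auto
  then show "integrable (J s) (\<lambda>p. f (prod.swap p)) \<longleftrightarrow> integrable (J s) (\<lambda>p. exp (lr s p) * f p)"
    unfolding Jrev_eq_density by (simp add: integrable_density)
qed

text \<open>Displays the half tilt as (1 + e^r)/2, the average of a law and its reversal, divided by
  cosh(r/2).\<close>

lemma exp_half_eq: "exp (r / 2) = (1 + exp r) * (1 / (2 * cosh (r / 2)))" for r :: real
  unfolding cosh_field_def
  by (simp add: field_simps add_pos_pos less_imp_neq[THEN not_sym] flip: exp_add)

text \<open>Because e^(r/2) cosh(r/2) = (1 + e^r)/2, the weight averages J with its reversal: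
  functions even under the swap keep their integral and odd ones lose it.\<close>

lemma integral_J_tilt:
  fixes V :: "real \<times> real \<Rightarrow> real" and \<epsilon> :: real
  assumes [measurable]: "V \<in> borel_measurable (borel \<Otimes>\<^sub>M borel)" and V: "integrable (J s) V"
    and sym: "\<And>p. V (prod.swap p) = \<epsilon> * V p"
  shows "integrable (J s) (\<lambda>p. exp (lr s p / 2) * (cosh (lr s p / 2) * V p))" (is ?int)
    and "(\<integral>p. exp (lr s p / 2) * (cosh (lr s p / 2) * V p) \<partial>J s) = (1 + \<epsilon>) / 2 * (\<integral>p. V p \<partial>J s)" (is ?eq)
proof -
  have eq: "exp (lr s p / 2) * (cosh (lr s p / 2) * V p) = V p / 2 + exp (lr s p) * V p / 2" for p
    unfolding exp_half_eq[of "lr s p"] using cosh_real_pos[of "lr s p / 2"] by (simp add: field_simps)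
  have sw: "integrable (J s) (\<lambda>p. exp (lr s p) * V p)" "(\<integral>p. exp (lr s p) * V p \<partial>J s) = \<epsilon> * (\<integral>p. V p \<partial>J s)"
    using integral_J_swap[of V s] V unfolding sym by simp_all
  show ?int ?eq unfolding eq using V sw by (simp_all add: field_simps)
qed

end

section \<open>Small-step asymptotics in one coordinate\<close>

lemma cosh_minus_one_le: "cosh u - 1 \<le> u\<^sup>2 * cosh u" for u :: real
proof -
  have dc: "(cosh has_real_derivative sinh x) (at x)" and ds: "(sinh has_real_derivative cosh x) (at x)" for x :: real
    by (auto intro!: derivative_eq_intros)
  obtain v where v: "\<bar>v - 0\<bar> \<le> \<bar>u\<bar>" "cosh (0 + u) - cosh 0 = u * sinh v"
    using mvt_between[OF dc, of 0 u] by blast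
  obtain v' where v': "\<bar>v' - 0\<bar> \<le> \<bar>v\<bar>" "sinh (0 + v) - sinh 0 = v * cosh v'"
    using mvt_between[OF ds, of 0 v] by blast
  have "cosh v' \<le> cosh u"
    using v(1) v'(1) cosh_real_nonneg_le_iff[of "\<bar>v'\<bar>" "\<bar>u\<bar>"] by simp
  have "cosh u - 1 = u * v * cosh v'" using v(2) v'(2) by simp
  also have "\<dots> \<le> \<bar>u\<bar> * \<bar>v\<bar> * cosh v'"
    by (intro mult_right_mono) (auto simp: abs_mult[symmetric] cosh_real_nonneg)
  also have "\<dots> \<le> \<bar>u\<bar> * \<bar>u\<bar> * cosh u"
    using v(1) \<open>cosh v' \<le> cosh u\<close> by (intro mult_mono) (auto simp: cosh_real_nonneg)
  finally show ?thesis by (simp add: power2_eq_square)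
qed

lemma cos_ge_one_minus_square: "1 - cos x \<le> x\<^sup>2" for x :: real
proof -
  have *: "1 - cos x = 2 * (sin (x / 2))\<^sup>2" using cos_double_sin[of "x / 2"] by simp
  have "\<bar>sin (x / 2)\<bar>\<^sup>2 \<le> \<bar>x / 2\<bar>\<^sup>2" by (intro power_mono abs_sin_x_le_abs_x) auto
  then have "2 * (sin (x / 2))\<^sup>2 \<le> 2 * (x / 2)\<^sup>2" unfolding power2_abs by linarith
  also have "\<dots> \<le> x\<^sup>2" by (simp add: power_divide)
  finally show ?thesis using * by simp
qed

text \<open>The pointwise deficit from 1 of the symmetrised characteristic function, whose mean is
  raised to a power of order n.\<close>

definition kap :: "real \<Rightarrow> real \<Rightarrow> real" where "kap t r = 1 - cos (t * r) / cosh (r / 2)"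

definition kap_quot :: "real \<Rightarrow> real \<Rightarrow> real" where
  "kap_quot t r = (if r = 0 then 1/8 + t\<^sup>2/2 else kap t r / r\<^sup>2)"

lemma kap_eq: "kap t r = r\<^sup>2 * kap_quot t r"
  by (simp add: kap_quot_def kap_def)

lemma kap_split: "kap t r = ((cosh (r / 2) - 1) + (1 - cos (t * r))) / cosh (r / 2)"
  using cosh_real_pos[of "r / 2"] by (simp add: kap_def field_simps)

lemma kap_nonneg: "kap t r \<ge> 0"
  unfolding kap_split using cosh_real_ge_1[of "r / 2"] by (intro divide_nonneg_nonneg add_nonneg_nonneg) auto

lemma kap_le_2: "kap t r \<le> 2"
proof -
  have "\<bar>cos (t * r) / cosh (r / 2)\<bar> \<le> 1"
    using cosh_real_ge_1[of "r / 2"] order_trans[OF abs_cos_le_one[of "t * r"] cosh_real_ge_1[of "r / 2"]]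
    by (simp add: abs_divide divide_le_eq_1)
  then show ?thesis unfolding kap_def by linarith
qed

lemma kap_le: "kap t r \<le> (1 + t\<^sup>2) * r\<^sup>2"
proof -
  note c = cosh_real_ge_1[of "r / 2"]
  have "kap t r \<le> ((r / 2)\<^sup>2 * cosh (r / 2) + (t * r)\<^sup>2 * cosh (r / 2)) / cosh (r / 2)"
    unfolding kap_split
  proof (intro divide_right_mono add_mono cosh_minus_one_le order_trans[OF cos_ge_one_minus_square])
    show "(t * r)\<^sup>2 \<le> (t * r)\<^sup>2 * cosh (r / 2)" using mult_left_mono[OF c, of "(t * r)\<^sup>2"] by simp
  qed (use c in auto)
  also have "\<dots> = (r / 2)\<^sup>2 + (t * r)\<^sup>2" using c by (simp add: add_divide_distrib)
  also have "\<dots> \<le> r\<^sup>2 + t\<^sup>2 * r\<^sup>2" by (simp add: power_divide power_mult_distrib)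
  finally show ?thesis by (simp add: distrib_right)
qed

text \<open>The hyperbolic part contributes (r/2)^2/2 = r^2/8 and the cosine t^2 r^2/2, hence the
  value 1/8 + t^2/2 at 0.\<close>

lemma kap_quot_isCont: "isCont (kap_quot t) 0"
proof -
  have 1: "(\<lambda>u::real. (cosh u - 1) / u\<^sup>2) \<midarrow>0\<rightarrow> 1/2" by real_asymp
  have 2: "(\<lambda>u::real. (1 - cos u) / u\<^sup>2) \<midarrow>0\<rightarrow> 1/2" by real_asymp
  have 3: "(\<lambda>r::real. (cosh (r / 2) - 1) / (r / 2)\<^sup>2) \<midarrow>0\<rightarrow> 1/2"
    by (rule LIM_compose_eventually[OF _ 1]) (auto intro!: tendsto_eq_intros simp: eventually_at_filter)
  have 4: "(\<lambda>r::real. (1 - cos (t * r)) / r\<^sup>2) \<midarrow>0\<rightarrow> t\<^sup>2 / 2"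
  proof (cases "t = 0")
    case False
    have "(\<lambda>r::real. (1 - cos (t * r)) / (t * r)\<^sup>2) \<midarrow>0\<rightarrow> 1/2"
      by (rule LIM_compose_eventually[OF _ 2]) (use False in \<open>auto intro!: tendsto_eq_intros simp: eventually_at_filter\<close>)
    from tendsto_mult[OF tendsto_const[of "t\<^sup>2"] this] show ?thesis
      using False by (simp add: power_mult_distrib)
  qed simp
  have "(\<lambda>r. (1/4 * ((cosh (r / 2) - 1) / (r / 2)\<^sup>2) + (1 - cos (t * r)) / r\<^sup>2) / cosh (r / 2))
      \<midarrow>0\<rightarrow> (1/4 * (1/2) + t\<^sup>2 / 2) / cosh (0 / 2)"
    by (intro tendsto_intros 3 4) auto
  then have "(\<lambda>r. (1/4 * ((cosh (r / 2) - 1) / (r / 2)\<^sup>2) + (1 - cos (t * r)) / r\<^sup>2) / cosh (r / 2)) \<midarrow>0\<rightarrow> kap_quot t 0"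
    by (simp add: kap_quot_def)
  moreover have eq: "(1/4 * ((cosh (r / 2) - 1) / (r / 2)\<^sup>2) + (1 - cos (t * r)) / r\<^sup>2) / cosh (r / 2) = kap_quot t r" if "r \<noteq> 0" for r
    using that cosh_real_pos[of "r / 2"] by (simp add: kap_quot_def kap_split field_simps)
  moreover have "\<forall>\<^sub>F r in at 0. (1/4 * ((cosh (r / 2) - 1) / (r / 2)\<^sup>2) + (1 - cos (t * r)) / r\<^sup>2) / cosh (r / 2) = kap_quot t r"
    unfolding eventually_at_filter by (intro always_eventually allI impI eq)
  ultimately show ?thesis unfolding isCont_def by (blast intro: Lim_transform_eventually)
qed

section \<open>Domination and limits of one-coordinate expectations\<close>

context mh_chain
begin

lemma wt_moment:
  assumes "0 \<le> s" "s \<le> 1"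
  shows "integrable mu (\<lambda>w. wt s x w * (1 + \<bar>w\<bar> ^ 6))"
    and "(\<integral>w. wt s x w * (1 + \<bar>w\<bar> ^ 6) \<partial>mu) \<le> 2 * (1 + C) * (1 + npow \<bar>d1 x\<bar> \<beta>)"
proof -
  define a where "a = s * d1 x"
  have eq: "wt s x w * (1 + \<bar>w\<bar> ^ 6) = (exp (b (a * w)) * \<bar>w\<bar> ^ 0 + exp (b (a * w)) * \<bar>w\<bar> ^ 6) / Zt a" for w
    by (simp add: wt_def a_def algebra_simps)
  show int: "integrable mu (\<lambda>w. wt s x w * (1 + \<bar>w\<bar> ^ 6))"
    unfolding eq by (intro integrable_divide_zero impI Bochner_Integration.integrable_add int_exp_abs_power) auto
  have "(\<integral>w. wt s x w * (1 + \<bar>w\<bar> ^ 6) \<partial>mu)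
     = ((\<integral>w. exp (b (a * w)) * \<bar>w\<bar> ^ 0 \<partial>mu) + (\<integral>w. exp (b (a * w)) * \<bar>w\<bar> ^ 6 \<partial>mu)) / Zt a"
    unfolding eq
    by (simp only: Bochner_Integration.integral_divide_zero
        Bochner_Integration.integral_add[OF int_exp_abs_power[of 0 a, simplified] int_exp_abs_power[of 6 a, OF order_refl]] power_0 mult_1_right)
  also have "\<dots> \<le> ((1 + C) * (1 + npow \<bar>a\<bar> \<beta>) * Zt a + (1 + C) * (1 + npow \<bar>a\<bar> \<beta>) * Zt a) / Zt a"
    using Zt_pos[of a] by (intro divide_right_mono add_mono exp_abs_power_le) auto
  also have "\<dots> = 2 * (1 + C) * (1 + npow \<bar>a\<bar> \<beta>)" using Zt_pos[of a] by simp
  also have "\<dots> \<le> 2 * (1 + C) * (1 + npow \<bar>d1 x\<bar> \<beta>)"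
    unfolding a_def using C_pos assms beta by (intro mult_left_mono add_left_mono npow_mult_le) auto
  finally show "(\<integral>w. wt s x w * (1 + \<bar>w\<bar> ^ 6) \<partial>mu) \<le> 2 * (1 + C) * (1 + npow \<bar>d1 x\<bar> \<beta>)" .
qed

text \<open>Sixth moments of the proposal absorb the growth in w and leave dom(x) (1 +
  |phi'(x)|^beta), an integrable majorant in x that does not depend on s.\<close>

lemma integral_J:
  fixes f :: "real \<times> real \<Rightarrow> real"
  assumes [measurable]: "f \<in> borel_measurable (borel \<Otimes>\<^sub>M borel)"
    and s: "0 \<le> s" "s \<le> 1"
    and bd: "\<And>x w. \<bar>f (x, x + s * w)\<bar> \<le> K * (1 + \<bar>w\<bar> ^ 6) * dom x" and K: "K \<ge> 0"
  shows "integrable (J s) f" and "(\<integral>p. f p \<partial>J s) = (\<integral>x. (\<integral>w. wt s x w * f (x, x + s * w) \<partial>mu) \<partial>piM phi)"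
    and "(\<lambda>x. \<integral>w. wt s x w * f (x, x + s * w) \<partial>mu) \<in> borel_measurable (piM phi)"
    and "\<bar>\<integral>w. wt s x w * f (x, x + s * w) \<partial>mu\<bar> \<le> K * (2 * (1 + C)) * (dom x * (1 + npow \<bar>d1 x\<bar> \<beta>))"
proof -
  interpret P: pair_prob_space "piM phi" mu
    by (intro pair_prob_space.intro pair_sigma_finite.intro pi.sigma_finite_measure_axioms
        mu.sigma_finite_measure_axioms piM_prob mu_prob)
  have [measurable_cong]: "sets (piM phi \<Otimes>\<^sub>M mu) = sets (borel \<Otimes>\<^sub>M borel)"
    by (rule sets_pair_measure_cong) (auto simp: mu_sets)
  have pt: "\<bar>wt s x w * f (x, x + s * w)\<bar> \<le> K * dom x * (wt s x w * (1 + \<bar>w\<bar> ^ 6))" for x w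
    using mult_left_mono[OF bd[of x w] less_imp_le[OF wt_pos[of s x w]]] wt_pos[of s x w]
    by (simp add: abs_mult ac_simps)
  have [measurable]: "(\<lambda>w. wt s x w * f (x, x + s * w)) \<in> borel_measurable mu" for x
    by measurable
  have inner_int: "integrable mu (\<lambda>w. wt s x w * f (x, x + s * w))" for x
    by (rule Bochner_Integration.integrable_bound[OF integrable_mult_right[OF wt_moment(1)[OF s, of x], of "K * dom x"]])
       (simp, intro AE_I2, simp only: real_norm_def, rule order_trans[OF pt abs_ge_self])
  have abs_le: "(\<integral>w. \<bar>wt s x w * f (x, x + s * w)\<bar> \<partial>mu) \<le> K * (2 * (1 + C)) * (dom x * (1 + npow \<bar>d1 x\<bar> \<beta>))" for x
  proof -
    have "(\<integral>w. \<bar>wt s x w * f (x, x + s * w)\<bar> \<partial>mu) \<le> (\<integral>w. K * dom x * (wt s x w * (1 + \<bar>w\<bar> ^ 6)) \<partial>mu)"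
      by (intro integral_mono pt integrable_abs inner_int integrable_mult_right wt_moment(1) s)
    also have "\<dots> = K * dom x * (\<integral>w. wt s x w * (1 + \<bar>w\<bar> ^ 6) \<partial>mu)" by (rule integral_mult_right_zero)
    also have "\<dots> \<le> K * dom x * (2 * (1 + C) * (1 + npow \<bar>d1 x\<bar> \<beta>))"
      using K dom_ge_1[of x] by (intro mult_left_mono wt_moment(2) s) auto
    finally show ?thesis by (simp only: ac_simps)
  qed
  show "\<bar>\<integral>w. wt s x w * f (x, x + s * w) \<partial>mu\<bar> \<le> K * (2 * (1 + C)) * (dom x * (1 + npow \<bar>d1 x\<bar> \<beta>))"
    by (rule order_trans[OF integral_abs_bound abs_le])
  let ?h = "\<lambda>p. wt s (fst p) (snd p) * f (fst p, fst p + s * snd p)"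
  have hm [measurable]: "?h \<in> borel_measurable (piM phi \<Otimes>\<^sub>M mu)" by measurable
  have h_int: "integrable (piM phi \<Otimes>\<^sub>M mu) ?h"
  proof (rule integrableI_bounded[OF hm])
    have "(\<integral>\<^sup>+p. ennreal (norm (?h p)) \<partial>(piM phi \<Otimes>\<^sub>M mu))
        = (\<integral>\<^sup>+x. (\<integral>\<^sup>+w. ennreal \<bar>wt s x w * f (x, x + s * w)\<bar> \<partial>mu) \<partial>piM phi)"
      by (subst mu.nn_integral_fst[symmetric]) auto
    also have "\<dots> = (\<integral>\<^sup>+x. ennreal (\<integral>w. \<bar>wt s x w * f (x, x + s * w)\<bar> \<partial>mu) \<partial>piM phi)"
      by (intro nn_integral_cong nn_integral_eq_integral integrable_abs inner_int) auto
    also have "\<dots> \<le> (\<integral>\<^sup>+x. ennreal (K * (2 * (1 + C)) * (dom x * (1 + npow \<bar>d1 x\<bar> \<beta>))) \<partial>piM phi)"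
      by (intro nn_integral_mono ennreal_leI abs_le)
    also have "\<dots> < \<infinity>"
    proof (subst nn_integral_eq_integral)
      show "integrable (piM phi) (\<lambda>x. K * (2 * (1 + C)) * (dom x * (1 + npow \<bar>d1 x\<bar> \<beta>)))"
        by (intro integrable_mult_right dom_int)
      have "0 \<le> K * (2 * (1 + C)) * (dom x * (1 + npow \<bar>d1 x\<bar> \<beta>))" for x
        using K C_pos dom_ge_1[of x] npow_nonneg[of "d1 x" \<beta>] by (intro mult_nonneg_nonneg) auto
      then show "AE x in piM phi. 0 \<le> K * (2 * (1 + C)) * (dom x * (1 + npow \<bar>d1 x\<bar> \<beta>))" by simp
    qed simp
    finally show "(\<integral>\<^sup>+p. ennreal (norm (?h p)) \<partial>(piM phi \<Otimes>\<^sub>M mu)) < \<infinity>" .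
  qed
  \<comment> \<open>Realises J as the image of a weighted product measure under (x, w) -> (x, x + s
    w), which reduces Bochner integrals to Fubini.\<close>
  have J_eq: "J s = distr (density (piM phi \<Otimes>\<^sub>M mu) (\<lambda>p. ennreal (wt s (fst p) (snd p)))) (borel \<Otimes>\<^sub>M borel)
      (\<lambda>p. (fst p, fst p + s * snd p))" (is "_ = ?R")
  proof (rule measure_eqI)
    fix A assume "A \<in> sets (J s)"
    then have [measurable]: "A \<in> sets (borel \<Otimes>\<^sub>M borel)" by simp
    have "emeasure (J s) A = (\<integral>\<^sup>+p. indicator A p \<partial>J s)" by simp
    also have "\<dots> = (\<integral>\<^sup>+x. (\<integral>\<^sup>+w. ennreal (wt s x w) * indicator A (x, x + s * w) \<partial>mu) \<partial>piM phi)"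
      by (rule nn_integral_J) auto
    also have "\<dots> = (\<integral>\<^sup>+p. ennreal (wt s (fst p) (snd p)) * indicator A (fst p, fst p + s * snd p) \<partial>(piM phi \<Otimes>\<^sub>M mu))"
      by (subst mu.nn_integral_fst[symmetric]) auto
    also have "\<dots> = (\<integral>\<^sup>+p. indicator A p \<partial>?R)"
      by (subst nn_integral_distr, measurable, subst nn_integral_density, auto)
    finally show "emeasure (J s) A = emeasure ?R A" by simp
  qed simp
  show "integrable (J s) f"
    unfolding J_eq
    by (subst integrable_distr_eq, measurable, subst integrable_density)
       (use h_int wt_pos in \<open>auto simp: less_imp_le\<close>)
  have "(\<integral>p. f p \<partial>J s) = (\<integral>p. ?h p \<partial>(piM phi \<Otimes>\<^sub>M mu))"
    unfolding J_eq by (subst integral_distr, measurable, subst integral_density) (auto simp: wt_pos less_imp_le)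
  also have "\<dots> = (\<integral>x. (\<integral>w. ?h (x, w) \<partial>mu) \<partial>piM phi)"
    by (rule P.integral_fst'[symmetric, OF h_int])
  finally show "(\<integral>p. f p \<partial>J s) = (\<integral>x. (\<integral>w. wt s x w * f (x, x + s * w) \<partial>mu) \<partial>piM phi)" by simp
  show "(\<lambda>x. \<integral>w. wt s x w * f (x, x + s * w) \<partial>mu) \<in> borel_measurable (piM phi)"
    using borel_measurable_integrable[OF P.integrable_fst'[OF h_int]] by simp
qed

text \<open>For fixed x the weight parameter s phi'(x) tends to 0, so the inner limit is
  \<open>weighted_limit\<close> and the tilt disappears since b(0) = 0 and Zt(0) = 1. The outer
  limit is dominated convergence with the majorant of \<open>integral_J\<close>.\<close>

lemma J_limit:
  fixes F :: "nat \<Rightarrow> real \<times> real \<Rightarrow> real"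
  assumes s: "\<And>n. 0 < s n" "\<And>n. s n \<le> 1" "s \<longlonglongrightarrow> 0"
    and [measurable]: "\<And>n. F n \<in> borel_measurable (borel \<Otimes>\<^sub>M borel)"
    and F0 [measurable]: "(\<lambda>p. F0 (fst p) (snd p)) \<in> borel_measurable (borel \<Otimes>\<^sub>M borel)"
    and bd: "\<And>n x w. \<bar>F n (x, x + s n * w)\<bar> \<le> K * (1 + \<bar>w\<bar> ^ 6) * dom x" and K: "K \<ge> 0"
    and lim: "\<And>x w. (\<lambda>n. F n (x, x + s n * w)) \<longlonglongrightarrow> F0 x w"
  shows "(\<lambda>n. \<integral>p. F n p \<partial>J (s n)) \<longlonglongrightarrow> (\<integral>x. (\<integral>w. F0 x w \<partial>mu) \<partial>piM phi)"
proof -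
  note iJ = integral_J[OF _ less_imp_le[OF s(1)] s(2) bd K]
  have F0m [measurable]: "(\<lambda>w. F0 x w) \<in> borel_measurable borel" for x
    using measurable_compose[OF measurable_Pair1' F0, of x] by simp
  have inner: "(\<lambda>n. \<integral>w. wt (s n) x w * F n (x, x + s n * w) \<partial>mu) \<longlonglongrightarrow> (\<integral>w. F0 x w \<partial>mu)" for x
  proof -
    have "(\<lambda>n. s n * d1 x) \<longlonglongrightarrow> 0 * d1 x" by (intro tendsto_intros s)
    then have a0: "(\<lambda>n. s n * d1 x) \<longlonglongrightarrow> 0" by simp
    have a_le: "\<bar>s n * d1 x\<bar> \<le> \<bar>d1 x\<bar>" for n
      using s(1)[of n] s(2)[of n] by (simp add: abs_mult mult_left_le_one_le)
    have 1: "(\<lambda>n. \<integral>w. exp (b (s n * d1 x * w)) * F n (x, x + s n * w) \<partial>mu) \<longlonglongrightarrow> (\<integral>w. F0 x w \<partial>mu)"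
    proof (rule weighted_limit[where a = "\<lambda>n. s n * d1 x" and c = "\<lambda>n. s n * d1 x" and A = "\<bar>d1 x\<bar>" and K = "K * dom x"])
      show "(\<lambda>n. exp (b (s n * d1 x * w)) * F n (x, x + s n * w)) \<longlonglongrightarrow> F0 x w" for w
      proof -
        have "(\<lambda>n. exp (b (s n * d1 x * w))) \<longlonglongrightarrow> exp (b (0 * w))"
          using b_cont[of UNIV] a0
          by (intro tendsto_intros isCont_tendsto_compose[of _ b]) (auto simp: continuous_on_eq_continuous_at)
        from tendsto_mult[OF this lim[of x w]] show ?thesis by (simp add: b_0)
      qed
      show "\<bar>exp (b (s n * d1 x * w)) * F n (x, x + s n * w)\<bar>
        \<le> K * dom x * (1 + \<bar>w\<bar> ^ 6) * (exp (b (s n * d1 x * w)) + exp (b (s n * d1 x * w)))" for n w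
      proof -
        have "\<bar>exp (b (s n * d1 x * w)) * F n (x, x + s n * w)\<bar> \<le> exp (b (s n * d1 x * w)) * (K * (1 + \<bar>w\<bar> ^ 6) * dom x)"
          unfolding abs_mult abs_exp_cancel by (intro mult_left_mono bd) auto
        also have "\<dots> \<le> (exp (b (s n * d1 x * w)) + exp (b (s n * d1 x * w))) * (K * (1 + \<bar>w\<bar> ^ 6) * dom x)"
          using K dom_ge_1[of x] by (intro mult_right_mono mult_nonneg_nonneg) auto
        finally show ?thesis by (simp only: ac_simps)
      qed
      show "integrable mu (F0 x)"
      proof (rule Bochner_Integration.integrable_bound)
        show "integrable mu (\<lambda>w. K * dom x * (1 + \<bar>w\<bar> ^ 6))"
          by (intro integrable_mult_right Bochner_Integration.integrable_add int_mu_power) auto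
        \<comment> \<open>The limit function inherits the bound assumed along the sequence.\<close>
        have "\<bar>F0 x w\<bar> \<le> K * (1 + \<bar>w\<bar> ^ 6) * dom x" for w
          by (rule tendsto_upperbound[OF tendsto_rabs[OF lim]]) (intro always_eventually allI bd, simp)
        then have "\<bar>F0 x w\<bar> \<le> \<bar>K * dom x * (1 + \<bar>w\<bar> ^ 6)\<bar>" for w
          by (rule order_trans) (simp add: ac_simps)
        then show "AE w in mu. norm (F0 x w) \<le> norm (K * dom x * (1 + \<bar>w\<bar> ^ 6))" by simp
      qed auto
    qed (use a_le in auto)
    have "(\<lambda>n. Zt (s n * d1 x)) \<longlonglongrightarrow> Zt 0" by (rule isCont_tendsto_compose[OF Zt_isCont a0])
    then have "(\<lambda>n. (\<integral>w. exp (b (s n * d1 x * w)) * F n (x, x + s n * w) \<partial>mu) / Zt (s n * d1 x)) \<longlonglongrightarrow> (\<integral>w. F0 x w \<partial>mu) / 1"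
      by (intro tendsto_divide 1) (auto simp: Zt_0)
    moreover have "(\<integral>w. exp (b (s n * d1 x * w)) * F n (x, x + s n * w) \<partial>mu) / Zt (s n * d1 x)
      = (\<integral>w. wt (s n) x w * F n (x, x + s n * w) \<partial>mu)" for n
      by (subst Bochner_Integration.integral_divide_zero[symmetric]) (simp add: wt_def ac_simps)
    ultimately show ?thesis by simp
  qed
  have "(\<lambda>n. \<integral>x. (\<integral>w. wt (s n) x w * F n (x, x + s n * w) \<partial>mu) \<partial>piM phi) \<longlonglongrightarrow> (\<integral>x. (\<integral>w. F0 x w \<partial>mu) \<partial>piM phi)"
  proof (rule integral_dominated_convergence)
    show "integrable (piM phi) (\<lambda>x. K * (2 * (1 + C)) * (dom x * (1 + npow \<bar>d1 x\<bar> \<beta>)))"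
      by (intro integrable_mult_right dom_int)
    show "AE x in piM phi. (\<lambda>n. \<integral>w. wt (s n) x w * F n (x, x + s n * w) \<partial>mu) \<longlonglongrightarrow> (\<integral>w. F0 x w \<partial>mu)"
      using inner by simp
    show "AE x in piM phi. norm (\<integral>w. wt (s n) x w * F n (x, x + s n * w) \<partial>mu)
        \<le> K * (2 * (1 + C)) * (dom x * (1 + npow \<bar>d1 x\<bar> \<beta>))" for n
      using iJ(4) by simp
    show "(\<lambda>x. \<integral>w. F0 x w \<partial>mu) \<in> borel_measurable (piM phi)"
    proof -
      have "case_prod F0 \<in> borel_measurable (borel \<Otimes>\<^sub>M mu)"
        using F0 by (simp add: case_prod_beta' measurable_cong_sets[OF sets_pair_measure_cong[OF refl mu_sets] refl])
      from mu.borel_measurable_lebesgue_integral[OF this] show ?thesis by simp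
    qed
  qed (use iJ(3) in auto)
  then show ?thesis by (subst iJ(2)) auto
qed


text \<open>Differentiating g(t) = exp(b(log t)) twice at 1 gives b''(0) + b'(0)^2 - b'(0) with
  b'(0) = 1/2. The identity holds only for t > 0, so derivatives are transferred on that open
  half-line.\<close>

lemma gfrak_eq: "gfrak g = curv - 1/4"
proof -
  have eq: "exp (b (ln t)) = g t" if "t > 0" for t
    using that g_exp[of "ln t"] by simp
  have i: "((\<lambda>t. b (ln t)) has_real_derivative deriv b (ln t) * inverse t) (at t)" if "t > 0" for t
    by (rule DERIV_chain2[OF b_deriv DERIV_ln[OF that]])
  have "(g has_real_derivative exp (b (ln t)) * (deriv b (ln t) * inverse t)) (at t)" if "t > 0" for t
    by (rule has_field_derivative_transform_within_open[OF DERIV_chain2[OF DERIV_exp i[OF that]], of "{0<..}"])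
       (use that eq in auto)
  then have d: "deriv g t = exp (b (ln t)) * (deriv b (ln t) * inverse t)" if "t > 0" for t
    using that DERIV_imp_deriv by blast
  have "((\<lambda>t. exp (b (ln t)) * (deriv b (ln t) * inverse t)) has_real_derivative
      exp (b (ln 1)) * (deriv b (ln 1) * inverse 1) * (deriv b (ln 1) * inverse 1)
       + (deriv (deriv b) (ln 1) * inverse 1 * inverse 1 + - (inverse 1 ^ Suc (Suc 0)) * deriv b (ln 1)) * exp (b (ln 1))) (at 1)"
    by (intro DERIV_mult DERIV_chain2[OF DERIV_exp] i DERIV_chain2[OF b_deriv2] DERIV_ln DERIV_inverse) auto
  then have "((\<lambda>t. exp (b (ln t)) * (deriv b (ln t) * inverse t)) has_real_derivative curv - 1/4) (at 1)"
    by (rule DERIV_cong) (simp add: b_0 b'_0)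
  then have "(deriv g has_real_derivative curv - 1/4) (at 1)"
    by (rule has_field_derivative_transform_within_open[of _ _ _ "{0<..}"]) (auto simp: d)
  then show ?thesis unfolding gfrak_def by (rule DERIV_imp_deriv)
qed

lemma lead_measurable [measurable]: "(\<lambda>p. lead (fst p) (snd p)) \<in> borel_measurable (borel \<Otimes>\<^sub>M borel)"
  unfolding lead_def by measurable

lemma dom_integrable_bound:
  assumes [measurable]: "f \<in> borel_measurable borel" and "\<And>x. \<bar>f x\<bar> \<le> dom x"
  shows "integrable (piM phi) f"
proof (rule Bochner_Integration.integrable_bound[OF dom_int])
  show "AE x in piM phi. norm (f x) \<le> norm (dom x * (1 + npow \<bar>d1 x\<bar> \<beta>))"
  proof (rule AE_I2)
    fix x
    have "\<bar>f x\<bar> \<le> dom x * 1" using assms(2) by simp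
    also have "\<dots> \<le> dom x * (1 + npow \<bar>d1 x\<bar> \<beta>)"
      using dom_ge_1[of x] npow_nonneg[of "d1 x" \<beta>] by (intro mult_left_mono) auto
    also have "\<dots> \<le> norm \<dots>" unfolding real_norm_def by (rule abs_ge_self)
    finally show "norm (f x) \<le> norm (dom x * (1 + npow \<bar>d1 x\<bar> \<beta>))" by simp
  qed
qed simp

text \<open>\<open>lead x w\<close> has the form p w^3 - q w, so its square involves the moments of
  order 6, 4 and 2; the last is 1.\<close>

lemma lead_square_integral:
  "(\<integral>x. (\<integral>w. (lead x w)\<^sup>2 \<partial>mu) \<partial>piM phi) =
    mom mu 6 * ((\<integral>x. (d3 x)\<^sup>2 \<partial>piM phi) / 144 + (1/4 + gfrak g)\<^sup>2 * (\<integral>x. (d1 x * d2 x)\<^sup>2 \<partial>piM phi)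
        - (1/6) * (1/4 + gfrak g) * (\<integral>x. d1 x * d2 x * d3 x \<partial>piM phi))
    + mom mu 4 * ((1/6) * (1/2 + gfrak g) * (\<integral>x. d1 x * d2 x * d3 x \<partial>piM phi)
        - 2 * (1/4 + gfrak g) * (1/2 + gfrak g) * (\<integral>x. (d1 x * d2 x)\<^sup>2 \<partial>piM phi))
    + (1/2 + gfrak g)\<^sup>2 * (\<integral>x. (d1 x * d2 x)\<^sup>2 \<partial>piM phi)" (is "_ = ?R")
proof -
  have g: "1/4 + gfrak g = curv" "1/2 + gfrak g = curv + 1/4" by (simp_all add: gfrak_eq)
  have iA: "integrable (piM phi) (\<lambda>x. (d3 x)\<^sup>2)"
    by (rule dom_integrable_bound) (use dom_d3 in auto)
  have iB: "integrable (piM phi) (\<lambda>x. (d1 x * d2 x)\<^sup>2)"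
    by (rule dom_integrable_bound, measurable) (use dom_d12 in auto)
  have iC: "integrable (piM phi) (\<lambda>x. d1 x * d2 x * d3 x)"
  proof (rule dom_integrable_bound)
    fix x
    \<comment> \<open>The mixed term is bounded by the two squares, each below the envelope.\<close>
    have "2 * (\<bar>d1 x * d2 x\<bar> * \<bar>d3 x\<bar>) \<le> (d1 x * d2 x)\<^sup>2 + (d3 x)\<^sup>2"
      using sum_squares_bound[of "\<bar>d1 x * d2 x\<bar>" "\<bar>d3 x\<bar>"] by simp
    also have "\<dots> \<le> dom x + dom x" by (intro add_mono dom_d12 dom_d3) auto
    finally show "\<bar>d1 x * d2 x * d3 x\<bar> \<le> dom x" by (simp add: abs_mult)
  qed measurable
  have inner: "(\<integral>w. (lead x w)\<^sup>2 \<partial>mu) =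
     (mom mu 6 / 144) * (d3 x)\<^sup>2 + (mom mu 6 * curv\<^sup>2 - 2 * mom mu 4 * curv * (curv + 1/4) + (curv + 1/4)\<^sup>2) * (d1 x * d2 x)\<^sup>2
     + (mom mu 4 * (curv + 1/4) / 6 - mom mu 6 * curv / 6) * (d1 x * d2 x * d3 x)" for x
  proof -
    define p q where "p = - d3 x / 12 + curv * (d1 x * d2 x)" and "q = (curv + 1/4) * (d1 x * d2 x)"
    have sq: "(lead x w)\<^sup>2 = p\<^sup>2 * w ^ 6 - 2 * p * q * w ^ 4 + q\<^sup>2 * w ^ 2" for w
      unfolding lead_def p_def[symmetric] q_def[symmetric] by (simp add: eval_nat_numeral algebra_simps)
    have "(\<integral>w. (lead x w)\<^sup>2 \<partial>mu) = (\<integral>w. p\<^sup>2 * w ^ 6 - 2 * p * q * w ^ 4 + q\<^sup>2 * w ^ 2 \<partial>mu)"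
      unfolding sq ..
    also have "\<dots> = p\<^sup>2 * mom mu 6 - 2 * p * q * mom mu 4 + q\<^sup>2 * 1"
      using int_mu_power(2)[of 6] int_mu_power(2)[of 4] int_mu_power(2)[of 2]
      by (simp add: mom_def mu_var)
    finally show ?thesis unfolding p_def q_def by (simp add: power2_eq_square algebra_simps)
  qed
  have lin: "(\<integral>x. c1 * f1 x + c2 * f2 x + c3 * f3 x \<partial>piM phi)
      = c1 * (\<integral>x. f1 x \<partial>piM phi) + c2 * (\<integral>x. f2 x \<partial>piM phi) + c3 * (\<integral>x. f3 x \<partial>piM phi)"
    if "integrable (piM phi) f1" "integrable (piM phi) f2" "integrable (piM phi) f3"
    for f1 f2 f3 :: "real \<Rightarrow> real" and c1 c2 c3
    using that by simp
  show ?thesis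
    unfolding inner g lin[OF iA iB iC] by (simp add: field_simps)
qed

text \<open>The radicand in theta is an integral of a square, so the square root can be
  undone.\<close>

lemma theta_square:
  assumes "theta phi g mu > 0"
  shows "(\<integral>x. (\<integral>w. (lead x w)\<^sup>2 \<partial>mu) \<partial>piM phi) = (theta phi g mu)\<^sup>2"
proof -
  have "theta phi g mu = sqrt (\<integral>x. (\<integral>w. (lead x w)\<^sup>2 \<partial>mu) \<partial>piM phi)"
    unfolding lead_square_integral theta_def Let_def ..
  moreover have "(\<integral>x. (\<integral>w. (lead x w)\<^sup>2 \<partial>mu) \<partial>piM phi) \<ge> 0" by (intro integral_nonneg_AE) auto
  ultimately show ?thesis by simp
qed

section \<open>The sixth-order deficit and the tilted jump moments\<close>

lemma lr_coord: "lr s (x, x + s * w) = log_ratio s x (x + s * w)"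
  by (simp add: lr_def)

lemma log_ratio_tendsto_0:
  assumes s: "\<And>n. 0 < s n" "s \<longlonglongrightarrow> 0"
  shows "(\<lambda>n. log_ratio (s n) x (x + s n * w)) \<longlonglongrightarrow> 0"
proof -
  have "(\<lambda>n. s n ^ 3 * (log_ratio (s n) x (x + s n * w) / s n ^ 3)) \<longlonglongrightarrow> 0 ^ 3 * lead x w"
    by (intro tendsto_intros s log_ratio_limit)
  moreover have "s n ^ 3 * (log_ratio (s n) x (x + s n * w) / s n ^ 3) = log_ratio (s n) x (x + s n * w)" for n
    using s(1)[of n] by simp
  ultimately show ?thesis by simp
qed

text \<open>Short jumps use the quadratic bound on \<open>kap\<close> with
  \<open>log_ratio_bound\<close>. For |s w| > 1 no bound on the ratio is available, but then kap <=
  2 <= 2 |s w|^6.\<close>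

lemma kap_log_ratio_bound:
  assumes s: "0 < s" "s \<le> 1"
  shows "kap t (log_ratio s x (x + s * w)) / s ^ 6 \<le> (2 + 2 * (1 + t\<^sup>2) * bd_const) * (1 + \<bar>w\<bar> ^ 6) * dom x"
proof (cases "\<bar>s * w\<bar> \<le> 1")
  case True
  let ?r = "log_ratio s x (x + s * w)"
  have bd0: "bd_const \<ge> 0" by (simp add: bd_const_def)
  have "kap t ?r / s ^ 6 \<le> ((1 + t\<^sup>2) * ?r\<^sup>2) / s ^ 6"
    by (intro divide_right_mono kap_le) simp
  also have "\<dots> = (1 + t\<^sup>2) * (?r / s ^ 3)\<^sup>2"
    by (simp add: power_divide flip: power_mult)
  also have "\<dots> \<le> (1 + t\<^sup>2) * (bd_const * (w ^ 6 + w\<^sup>2) * dom x)"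
    by (intro mult_left_mono log_ratio_bound s True) auto
  also have "\<dots> \<le> (1 + t\<^sup>2) * (bd_const * (2 * (1 + \<bar>w\<bar> ^ 6)) * dom x)"
  proof -
    have "\<bar>w\<bar> ^ 2 \<le> 1 + \<bar>w\<bar> ^ 6" by (rule abs_power_le_power_6) simp
    then have "w ^ 6 + w\<^sup>2 \<le> 2 * (1 + \<bar>w\<bar> ^ 6)" by simp
    then show ?thesis using bd0 dom_ge_1[of x] by (intro mult_left_mono mult_right_mono) auto
  qed
  also have "\<dots> = (2 * (1 + t\<^sup>2) * bd_const) * ((1 + \<bar>w\<bar> ^ 6) * dom x)" by (simp only: ac_simps)
  also have "\<dots> \<le> (2 + 2 * (1 + t\<^sup>2) * bd_const) * ((1 + \<bar>w\<bar> ^ 6) * dom x)"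
    using dom_ge_1[of x] by (intro mult_right_mono) auto
  finally show ?thesis by (simp only: mult.assoc)
next
  case False
  have "1 \<le> \<bar>s * w\<bar> ^ 6" using False by (intro one_le_power) auto
  then have sw: "1 / s ^ 6 \<le> \<bar>w\<bar> ^ 6" using s by (simp add: abs_mult power_mult_distrib divide_le_eq mult.commute)
  have bd0: "0 \<le> 2 * (1 + t\<^sup>2) * bd_const" by (simp add: bd_const_def)
  have "kap t (log_ratio s x (x + s * w)) / s ^ 6 \<le> 2 / s ^ 6"
    using s by (intro divide_right_mono kap_le_2) auto
  also have "\<dots> = 2 * (1 / s ^ 6) * 1" by simp
  also have "\<dots> \<le> 2 * (1 + \<bar>w\<bar> ^ 6) * dom x"
    using sw dom_ge_1[of x] s by (intro mult_mono mult_left_mono) auto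
  also have "\<dots> \<le> (2 + 2 * (1 + t\<^sup>2) * bd_const) * (1 + \<bar>w\<bar> ^ 6) * dom x"
    using bd0 dom_ge_1[of x] by (intro mult_right_mono) auto
  finally show ?thesis .
qed

text \<open>Writes kap/s^6 as kap_quot times (log-ratio/s^3)^2; the first factor tends to kap_quot
  at 0 and the second to lead^2.\<close>

lemma kap_expectation_limit:
  assumes s: "\<And>n. 0 < s n" "\<And>n. s n \<le> 1" "s \<longlonglongrightarrow> 0" and th: "theta phi g mu > 0"
  shows "(\<lambda>n. (\<integral>p. kap t (lr (s n) p) \<partial>J (s n)) / s n ^ 6) \<longlonglongrightarrow> (1/8 + t\<^sup>2/2) * (theta phi g mu)\<^sup>2"
proof -
  have [measurable]: "kap t \<in> borel_measurable borel"
    unfolding kap_def[abs_def] by (intro borel_measurable_continuous_onI continuous_intros) auto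
  have "(\<lambda>n. \<integral>p. kap t (lr (s n) p) / s n ^ 6 \<partial>J (s n)) \<longlonglongrightarrow> (\<integral>x. (\<integral>w. (1/8 + t\<^sup>2/2) * (lead x w)\<^sup>2 \<partial>mu) \<partial>piM phi)"
  proof (rule J_limit[OF s])
    show "\<bar>kap t (lr (s n) (x, x + s n * w)) / s n ^ 6\<bar> \<le> (2 + 2 * (1 + t\<^sup>2) * bd_const) * (1 + \<bar>w\<bar> ^ 6) * dom x" for n x w
      using kap_log_ratio_bound[OF s(1)[of n] s(2)] s(1)[of n] kap_nonneg
      by (simp add: lr_coord)
    show "(\<lambda>n. kap t (lr (s n) (x, x + s n * w)) / s n ^ 6) \<longlonglongrightarrow> (1/8 + t\<^sup>2/2) * (lead x w)\<^sup>2" for x w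
    proof -
      have "(\<lambda>n. kap_quot t (log_ratio (s n) x (x + s n * w)) * (log_ratio (s n) x (x + s n * w) / s n ^ 3)\<^sup>2)
        \<longlonglongrightarrow> kap_quot t 0 * (lead x w)\<^sup>2"
        by (intro tendsto_intros isCont_tendsto_compose[OF kap_quot_isCont] log_ratio_tendsto_0 log_ratio_limit s)
      moreover have "kap_quot t (log_ratio (s n) x (x + s n * w)) * (log_ratio (s n) x (x + s n * w) / s n ^ 3)\<^sup>2
        = kap t (lr (s n) (x, x + s n * w)) / s n ^ 6" for n
        unfolding lr_coord kap_eq by (simp add: power_divide flip: power_mult)
      ultimately show ?thesis by (simp add: kap_quot_def[of t 0])
    qed
    show "0 \<le> 2 + 2 * (1 + t\<^sup>2) * bd_const" by (simp add: bd_const_def)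
  qed measurable
  then show ?thesis by (simp add: theta_square[OF th])
qed

text \<open>Recovers w^k from the pair (x, x + s w). The exponent k = 2 serves the efficiency and k
  = 0 the acceptance rate.\<close>

definition jump_pow :: "real \<Rightarrow> nat \<Rightarrow> real \<times> real \<Rightarrow> real" where
  "jump_pow s k p = ((snd p - fst p) / s) ^ k"

lemma jump_pow_measurable [measurable]: "jump_pow s k \<in> borel_measurable (borel \<Otimes>\<^sub>M borel)"
  unfolding jump_pow_def[abs_def] by measurable

lemma jump_pow_coord: "s \<noteq> 0 \<Longrightarrow> jump_pow s k (x, x + s * w) = w ^ k"
  by (simp add: jump_pow_def)

lemma jump_pow_bound:
  assumes "k \<le> 6" "s \<noteq> 0" "\<bar>c\<bar> \<le> 1"
  shows "\<bar>jump_pow s k (x, x + s * w) * c\<bar> \<le> 2 * (1 + \<bar>w\<bar> ^ 6) * dom x"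
proof -
  have "\<bar>w\<bar> ^ k \<le> 1 + \<bar>w\<bar> ^ 6" using assms(1) by (rule abs_power_le_power_6)
  then have "\<bar>w\<bar> ^ k * \<bar>c\<bar> \<le> (1 + \<bar>w\<bar> ^ 6) * 1" using assms by (intro mult_mono) auto
  also have "\<dots> \<le> 2 * (1 + \<bar>w\<bar> ^ 6) * dom x"
    using dom_ge_1[of x] by (intro mult_mono) auto
  finally show ?thesis using assms by (simp add: jump_pow_coord abs_mult power_abs)
qed

text \<open>The integrand, against J, of the characteristic function of the log-ratio under the
  symmetrised law; it equals 1 - kap.\<close>

definition tilted :: "real \<Rightarrow> real \<Rightarrow> real" where "tilted t r = cos (t * r) / cosh (r / 2)"

lemma tilted_measurable [measurable]: "tilted t \<in> borel_measurable borel"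
  unfolding tilted_def[abs_def] by (intro borel_measurable_continuous_onI continuous_intros) auto

lemma tilted_le_1: "\<bar>tilted t r\<bar> \<le> 1"
  using cosh_real_ge_1[of "r / 2"] order_trans[OF abs_cos_le_one[of "t * r"] cosh_real_ge_1[of "r / 2"]]
  by (simp add: tilted_def abs_divide)

text \<open>Both exponents give 1: total mass for k = 0 and unit variance for k = 2.\<close>

lemma jump_tilted_limit:
  assumes s: "\<And>n. 0 < s n" "\<And>n. s n \<le> 1" "s \<longlonglongrightarrow> 0" and k: "k = 0 \<or> k = 2"
  shows "(\<lambda>n. \<integral>p. jump_pow (s n) k p * tilted t (lr (s n) p) \<partial>J (s n)) \<longlonglongrightarrow> 1"
proof -
  have "(\<lambda>n. \<integral>p. jump_pow (s n) k p * tilted t (lr (s n) p) \<partial>J (s n)) \<longlonglongrightarrow> (\<integral>x. (\<integral>w. w ^ k \<partial>mu) \<partial>piM phi)"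
  proof (rule J_limit[OF s])
    show "\<bar>jump_pow (s n) k (x, x + s n * w) * tilted t (lr (s n) (x, x + s n * w))\<bar> \<le> 2 * (1 + \<bar>w\<bar> ^ 6) * dom x" for n x w
      using k s(1)[of n] by (intro jump_pow_bound tilted_le_1) auto
    show "(\<lambda>n. jump_pow (s n) k (x, x + s n * w) * tilted t (lr (s n) (x, x + s n * w))) \<longlonglongrightarrow> w ^ k" for x w
    proof -
      have "isCont (tilted t) 0" unfolding tilted_def[abs_def] by (intro continuous_intros) auto
      then have "(\<lambda>n. w ^ k * tilted t (log_ratio (s n) x (x + s n * w))) \<longlonglongrightarrow> w ^ k * tilted t 0"
        by (intro tendsto_intros isCont_tendsto_compose[of 0 "tilted t"] log_ratio_tendsto_0 s)
      then show ?thesis using s(1) by (simp add: lr_coord jump_pow_coord tilted_def[of t 0] less_imp_neq[THEN not_sym])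
    qed
  qed auto
  moreover have "(\<integral>x. (\<integral>w. w ^ k \<partial>mu) \<partial>piM phi) = 1"
    using k mu_var pi.prob_space by (auto simp: mu.prob_space)
  ultimately show ?thesis by simp
qed

lemma jump_pow_integrable:
  assumes "0 < s" "s \<le> 1" "k \<le> 6" "\<And>p. \<bar>h p\<bar> \<le> 1" and [measurable]: "h \<in> borel_measurable (borel \<Otimes>\<^sub>M borel)"
  shows "integrable (J s) (\<lambda>p. jump_pow s k p * h p)"
proof (rule integral_J(1)[where K = 2])
  show "\<bar>jump_pow s k (x, x + s * w) * h (x, x + s * w)\<bar> \<le> 2 * (1 + \<bar>w\<bar> ^ 6) * dom x" for x w
    using assms by (intro jump_pow_bound) auto
qed (use assms in auto)

lemma jump_pow_swap: "even k \<Longrightarrow> jump_pow s k (prod.swap p) = jump_pow s k p"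
  by (simp add: jump_pow_def power_divide power_even_abs_numeral) (metis minus_diff_eq power_minus_even)

text \<open>Half of the likelihood ratio symmetrises the law, so the tilted characteristic function is real.\<close>
lemma tilted_char:
  assumes s: "0 < s" "s \<le> 1" and k: "even k" "k \<le> 6"
  shows "integrable (J s) (\<lambda>p. complex_of_real (jump_pow s k p * exp (lr s p / 2)) * iexp (t * lr s p))"
    and "(CLINT p|J s. complex_of_real (jump_pow s k p * exp (lr s p / 2)) * iexp (t * lr s p))
      = complex_of_real (\<integral>p. jump_pow s k p * tilted t (lr s p) \<partial>J s)"
proof -
  \<comment> \<open>V collects the cosine part, even under the swap, and V' the sine part, which is
    odd and integrates to zero.\<close>
  define V where "V = (\<lambda>p. jump_pow s k p * (cos (t * lr s p) / cosh (lr s p / 2)))"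
  define V' where "V' = (\<lambda>p. jump_pow s k p * (sin (t * lr s p) / cosh (lr s p / 2)))"
  have le: "\<bar>sin (t * r) / cosh (r / 2)\<bar> \<le> 1" for r
    using cosh_real_ge_1[of "r / 2"] order_trans[OF abs_sin_le_one[of "t * r"] cosh_real_ge_1[of "r / 2"]]
    by (simp add: abs_divide)
  have [measurable]: "(cosh :: real \<Rightarrow> real) \<in> borel_measurable borel"
    by (intro borel_measurable_continuous_onI continuous_intros)
  have Vm [measurable]: "V \<in> borel_measurable (borel \<Otimes>\<^sub>M borel)" "V' \<in> borel_measurable (borel \<Otimes>\<^sub>M borel)"
    unfolding V_def V'_def by measurable
  have iV: "integrable (J s) V" unfolding V_def
    by (rule jump_pow_integrable[OF s k(2)]) (use tilted_le_1 in \<open>auto simp: tilted_def\<close>)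
  have iV': "integrable (J s) V'" unfolding V'_def
    by (rule jump_pow_integrable[OF s k(2)]) (use le in auto)
  have sym: "V (prod.swap p) = 1 * V p" "V' (prod.swap p) = (- 1) * V' p" for p
    by (simp_all add: V_def V'_def jump_pow_swap k lr_swap)
  note t1 = integral_J_tilt[OF Vm(1) iV sym(1)] and t2 = integral_J_tilt[OF Vm(2) iV' sym(2)]
  have ch: "cosh (r / 2) \<noteq> 0" for r :: real using cosh_real_pos[of "r / 2"] by simp
  define A where "A = (\<lambda>p. exp (lr s p / 2) * (cosh (lr s p / 2) * V p))"
  define B where "B = (\<lambda>p. exp (lr s p / 2) * (cosh (lr s p / 2) * V' p))"
  have eq: "complex_of_real (jump_pow s k p * exp (lr s p / 2)) * iexp (t * lr s p)
    = complex_of_real (A p) + \<i> * complex_of_real (B p)" for p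
    using ch[of "lr s p"] by (simp add: A_def B_def V_def V'_def exp_Euler algebra_simps cos_of_real sin_of_real
      flip: of_real_mult)
  have int: "integrable (J s) (\<lambda>p. complex_of_real (A p))" "integrable (J s) (\<lambda>p. complex_of_real (B p))"
    unfolding A_def B_def using t1(1) t2(1) by (auto simp only: complex_of_real_integrable_eq)
  show "integrable (J s) (\<lambda>p. complex_of_real (jump_pow s k p * exp (lr s p / 2)) * iexp (t * lr s p))"
    unfolding eq by (intro Bochner_Integration.integrable_add integrable_mult_right int)
  have "(CLINT p|J s. complex_of_real (jump_pow s k p * exp (lr s p / 2)) * iexp (t * lr s p))
    = complex_of_real (\<integral>p. A p \<partial>J s) + \<i> * complex_of_real (\<integral>p. B p \<partial>J s)"
    unfolding eq
    by (subst Bochner_Integration.integral_add)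
       (auto intro!: integrable_mult_right int simp: integral_complex_of_real)
  then show "(CLINT p|J s. complex_of_real (jump_pow s k p * exp (lr s p / 2)) * iexp (t * lr s p))
      = complex_of_real (\<integral>p. jump_pow s k p * tilted t (lr s p) \<partial>J s)"
    unfolding A_def B_def t1(2) t2(2) by (simp add: V_def tilted_def)
qed

end

section \<open>The product chain\<close>

context mh_chain
begin

text \<open>Measurability of the kernel is tested on boxes, where the product measure is a finite
  product of one-dimensional kernels.\<close>

lemma PiM_Qk_measurable:
  assumes "finite (I :: nat set)"
  shows "(\<lambda>x. PiM I (\<lambda>i. Q s (x i))) \<in> PiM I (\<lambda>_. borel) \<rightarrow>\<^sub>M prob_algebra (PiM I (\<lambda>_. borel))"
proof (rule measurable_prob_algebra_generated[OF sets_PiM Int_stable_prod_algebra prod_algebra_sets_into_space])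
  fix x
  show "prob_space (PiM I (\<lambda>i. Q s (x i)))" by (intro prob_space_PiM Qk_prob)
  show "sets (PiM I (\<lambda>i. Q s (x i))) = sets (PiM I (\<lambda>_. borel))" by (rule sets_PiM_cong) auto
next
  fix A :: "(nat \<Rightarrow> real) set" assume "A \<in> prod_algebra I (\<lambda>_. borel)"
  then obtain X where X: "\<And>i. i \<in> I \<Longrightarrow> X i \<in> sets borel" "A = Pi\<^sub>E I X"
    unfolding prod_algebra_eq_finite[OF assms] by auto
  have [measurable]: "(\<lambda>y. emeasure (Q s y) (X i)) \<in> borel_measurable borel" if "i \<in> I" for i
    by (rule measurable_compose[OF measurable_prob_algebraD[OF Qk_measurable] measurable_emeasure_subprob_algebra[OF X(1)[OF that]]])
  have "emeasure (PiM I (\<lambda>i. Q s (x i))) A = (\<Prod>i\<in>I. emeasure (Q s (x i)) (X i))" for x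
  proof -
    interpret product_sigma_finite "\<lambda>i. Q s (x i)"
      by (intro product_sigma_finite.intro prob_space_imp_sigma_finite Qk_prob)
    show ?thesis unfolding X(2) by (rule emeasure_PiM[OF assms]) (use X(1) in auto)
  qed
  then show "(\<lambda>x. emeasure (PiM I (\<lambda>i. Q s (x i))) A) \<in> borel_measurable (PiM I (\<lambda>_. borel))"
    by simp
qed

lemma joint_kernel_measurable:
  assumes "finite (I :: nat set)"
  shows "(\<lambda>x. distr (PiM I (\<lambda>i. Q s (x i))) (PiM I (\<lambda>_. borel) \<Otimes>\<^sub>M PiM I (\<lambda>_. borel)) (\<lambda>y. (x, y)))
     \<in> PiM I (\<lambda>_. piM phi) \<rightarrow>\<^sub>M prob_algebra (PiM I (\<lambda>_. borel) \<Otimes>\<^sub>M PiM I (\<lambda>_. borel))"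
proof -
  have c: "sets (PiM I (\<lambda>_. piM phi)) = sets (PiM I (\<lambda>_. borel))" by (rule sets_PiM_cong) auto
  have "(\<lambda>x. distr (PiM I (\<lambda>i. Q s (x i))) (PiM I (\<lambda>_. borel) \<Otimes>\<^sub>M PiM I (\<lambda>_. borel)) (\<lambda>y. (x, y)))
     \<in> PiM I (\<lambda>_. borel) \<rightarrow>\<^sub>M prob_algebra (PiM I (\<lambda>_. borel) \<Otimes>\<^sub>M PiM I (\<lambda>_. borel))"
    by (rule measurable_distr_prob_space2[where M = "PiM I (\<lambda>_. borel)"]) (auto intro: PiM_Qk_measurable[OF assms])
  then show ?thesis by (simp add: measurable_cong_sets[OF c refl])
qed

lemma emeasure_J_Times:
  assumes [measurable]: "X \<in> sets borel" "Y \<in> sets borel"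
  shows "emeasure (J s) (X \<times> Y) = (\<integral>\<^sup>+x. indicator X x * emeasure (Q s x) Y \<partial>piM phi)"
proof -
  have "emeasure (J s) (X \<times> Y) = (\<integral>\<^sup>+p. indicator (X \<times> Y) p \<partial>J s)" by simp
  also have "\<dots> = (\<integral>\<^sup>+x. (\<integral>\<^sup>+w. ennreal (wt s x w) * indicator (X \<times> Y) (x, x + s * w) \<partial>mu) \<partial>piM phi)"
    by (rule nn_integral_J) auto
  also have "\<dots> = (\<integral>\<^sup>+x. indicator X x * emeasure (Q s x) Y \<partial>piM phi)"
  proof (rule nn_integral_cong)
    fix x
    have "emeasure (Q s x) Y = (\<integral>\<^sup>+w. ennreal (wt s x w) * indicator Y (x + s * w) \<partial>mu)"
      by (subst nn_integral_Qk[symmetric]) auto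
    then show "(\<integral>\<^sup>+w. ennreal (wt s x w) * indicator (X \<times> Y) (x, x + s * w) \<partial>mu) = indicator X x * emeasure (Q s x) Y"
      by (simp add: indicator_times nn_integral_cmult[symmetric] ac_simps)
  qed
  finally show ?thesis .
qed

sublocale JJ: product_prob_space "\<lambda>_. J s" I for s and I :: "nat set"
  by (intro product_prob_space.intro product_sigma_finite.intro product_prob_space_axioms.intro
      J.sigma_finite_measure_axioms J_prob)

text \<open>Passes from a pair of vectors to a vector of independent pairs. Both laws are compared
  on products of boxes, an intersection-stable generator on which each factorises over
  coordinates.\<close>

lemma jointn_eq:
  "jointn g mu phi s n = distr (JN s n) (PiM {1..n} (\<lambda>_. borel) \<Otimes>\<^sub>M PiM {1..n} (\<lambda>_. borel))
     (\<lambda>\<omega>. (\<lambda>i\<in>{1..n}. fst (\<omega> i), \<lambda>i\<in>{1..n}. snd (\<omega> i)))" (is "_ = distr ?P ?N ?T")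
proof -
  let ?I = "{1..n}" and ?B = "PiM {1..n} (\<lambda>_. borel :: real measure)"
  let ?E = "{a \<times> b | a b. a \<in> prod_algebra ?I (\<lambda>_. borel :: real measure) \<and> b \<in> prod_algebra ?I (\<lambda>_. borel :: real measure)}"
  have T [measurable]: "?T \<in> ?P \<rightarrow>\<^sub>M ?N"
    by (intro measurable_Pair measurable_restrict) measurable
  have pi_sets: "sets (PiM ?I (\<lambda>_. piM phi)) = sets ?B" by (rule sets_PiM_cong) auto
  have pi_space: "space (PiM ?I (\<lambda>_. piM phi)) = space ?B" by (rule sets_eq_imp_space_eq[OF pi_sets])
  have pi_prob: "prob_space (PiM ?I (\<lambda>_. piM phi))" by (intro prob_space_PiM piM_prob)
  have kern: "(\<lambda>x. distr (PiM ?I (\<lambda>i. Q s (x i))) ?N (\<lambda>y. (x, y))) \<in> PiM ?I (\<lambda>_. piM phi) \<rightarrow>\<^sub>M prob_algebra ?N"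
    by (rule joint_kernel_measurable) simp
  have sets_joint: "sets (jointn g mu phi s n) = sets ?N"
    unfolding jointn_def using prob_space.not_empty[OF pi_prob] by (intro sets_bind) auto
  have Om: "space ?B \<in> prod_algebra ?I (\<lambda>_. borel)" unfolding space_PiM by (rule space_in_prod_algebra)
  have sets_N: "sets ?N = sigma_sets (space ?B \<times> space ?B) ?E"
  proof -
    have "sets ?N = sets (sigma (space ?B \<times> space ?B) ?E)"
      by (rule sets_pair_eq[where Ca = "{space ?B}" and Cb = "{space ?B}"])
         (use Om in \<open>auto simp: sets_PiM space_PiM dest: prod_algebra_sets_into_space[THEN subsetD]\<close>)
    also have "\<dots> = sigma_sets (space ?B \<times> space ?B) ?E"
      by (rule sets_measure_of) (auto dest!: prod_algebra_sets_into_space[THEN subsetD] simp: space_PiM)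
    finally show ?thesis .
  qed
  show ?thesis
  proof (rule measure_eqI_generator_eq[where E = ?E and \<Omega> = "space ?B \<times> space ?B" and A = "\<lambda>_. space ?B \<times> space ?B"])
    show "Int_stable ?E"
    proof (rule Int_stableI)
      fix u v assume "u \<in> ?E" "v \<in> ?E"
      then obtain a b a' b' where uv: "u = a \<times> b" "v = a' \<times> b'" "a \<in> prod_algebra ?I (\<lambda>_. borel)" "b \<in> prod_algebra ?I (\<lambda>_. borel)"
        "a' \<in> prod_algebra ?I (\<lambda>_. borel)" "b' \<in> prod_algebra ?I (\<lambda>_. borel)" by auto
      moreover from this have "a \<inter> a' \<in> prod_algebra ?I (\<lambda>_. borel)" "b \<inter> b' \<in> prod_algebra ?I (\<lambda>_. borel)"
        by (auto intro: Int_stableD[OF Int_stable_prod_algebra] simp del: One_nat_def)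
      moreover have "u \<inter> v = (a \<inter> a') \<times> (b \<inter> b')" unfolding uv by (rule Times_Int_Times)
      ultimately show "u \<inter> v \<in> ?E"
        by (intro CollectI exI[of _ "a \<inter> a'"] exI[of _ "b \<inter> b'"] conjI)
    qed
    show "?E \<subseteq> Pow (space ?B \<times> space ?B)"
      by (auto dest!: prod_algebra_sets_into_space[THEN subsetD] simp: space_PiM)
    show "sets (jointn g mu phi s n) = sigma_sets (space ?B \<times> space ?B) ?E" using sets_joint sets_N by simp
    show "sets (distr ?P ?N ?T) = sigma_sets (space ?B \<times> space ?B) ?E" using sets_N by simp
    show "range (\<lambda>_. space ?B \<times> space ?B) \<subseteq> ?E" using Om by auto
    have "prob_space (jointn g mu phi s n)"
      unfolding jointn_def by (rule prob_space_bind'[OF _ kern]) (simp add: space_prob_algebra pi_prob del: One_nat_def)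
    then interpret joint: prob_space "jointn g mu phi s n" .
    show "emeasure (jointn g mu phi s n) (space ?B \<times> space ?B) \<noteq> \<infinity>"
      using joint.emeasure_finite by simp
    fix u assume "u \<in> ?E"
    then obtain a b where ab: "u = a \<times> b" "a \<in> prod_algebra ?I (\<lambda>_. borel)" "b \<in> prod_algebra ?I (\<lambda>_. borel)"
      by blast
    obtain X where a: "a = Pi\<^sub>E ?I X" "X \<in> ?I \<rightarrow> sets borel"
      using ab(2) unfolding prod_algebra_eq_finite[OF finite_atLeastAtMost] by blast
    obtain Y where b: "b = Pi\<^sub>E ?I Y" "Y \<in> ?I \<rightarrow> sets borel"
      using ab(3) unfolding prod_algebra_eq_finite[OF finite_atLeastAtMost] by blast
    have XY: "u = Pi\<^sub>E ?I X \<times> Pi\<^sub>E ?I Y" by (simp only: ab a b)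
    have X: "\<And>i. i \<in> ?I \<Longrightarrow> X i \<in> sets borel" and Y: "\<And>i. i \<in> ?I \<Longrightarrow> Y i \<in> sets borel"
      using a(2) b(2) by (auto simp only: Pi_iff)
    have sX: "Pi\<^sub>E ?I X \<in> sets ?B" and sY: "Pi\<^sub>E ?I Y \<in> sets ?B"
      by (intro sets_PiM_I_finite X Y finite_atLeastAtMost; assumption)+
    have uN: "u \<in> sets ?N" unfolding XY by (intro pair_measureI sX sY)
    have [measurable]: "(\<lambda>y. emeasure (Q s y) (Y i)) \<in> borel_measurable borel" if "i \<in> ?I" for i
      by (rule measurable_compose[OF measurable_prob_algebraD[OF Qk_measurable] measurable_emeasure_subprob_algebra[OF Y[OF that]]])
    have "emeasure (jointn g mu phi s n) u =
      (\<integral>\<^sup>+x. emeasure (distr (PiM ?I (\<lambda>i. Q s (x i))) ?N (\<lambda>y. (x, y))) u \<partial>PiM ?I (\<lambda>_. piM phi))"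
      unfolding jointn_def
      by (rule emeasure_bind_prob_algebra[OF _ kern]) (use sX sY pi_prob in \<open>auto simp: XY space_prob_algebra\<close>)
    \<comment> \<open>For fixed x the section of u is the Y-box if x lies in the X-box and empty
      otherwise; a box indicator is the product of its coordinate indicators.\<close>
    also have "\<dots> = (\<integral>\<^sup>+x. (\<Prod>i\<in>?I. indicator (X i) (x i) * emeasure (Q s (x i)) (Y i)) \<partial>PiM ?I (\<lambda>_. piM phi))"
    proof (rule nn_integral_cong)
      fix x assume x: "x \<in> space (PiM ?I (\<lambda>_. piM phi))"
      interpret Q: product_sigma_finite "\<lambda>i. Q s (x i)"
        by (intro product_sigma_finite.intro prob_space_imp_sigma_finite Qk_prob)
      have sQ: "sets (PiM ?I (\<lambda>i. Q s (x i))) = sets ?B" by (rule sets_PiM_cong) auto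
      have xB: "x \<in> space ?B" using x pi_space by simp
      have mP: "(\<lambda>y. (x, y)) \<in> PiM ?I (\<lambda>i. Q s (x i)) \<rightarrow>\<^sub>M ?N"
        by (subst measurable_cong_sets[OF sQ refl]) (rule measurable_Pair1'[OF xB])
      have "emeasure (distr (PiM ?I (\<lambda>i. Q s (x i))) ?N (\<lambda>y. (x, y))) u
        = emeasure (PiM ?I (\<lambda>i. Q s (x i))) ((\<lambda>y. (x, y)) -` u \<inter> space (PiM ?I (\<lambda>i. Q s (x i))))"
        by (rule emeasure_distr[OF mP uN])
      also have "(\<lambda>y. (x, y)) -` u \<inter> space (PiM ?I (\<lambda>i. Q s (x i))) = (if x \<in> Pi\<^sub>E ?I X then Pi\<^sub>E ?I Y else {})"
        by (auto simp: XY space_PiM PiE_iff)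
      also have "emeasure (PiM ?I (\<lambda>i. Q s (x i))) (if x \<in> Pi\<^sub>E ?I X then Pi\<^sub>E ?I Y else {})
        = (\<Prod>i\<in>?I. indicator (X i) (x i)) * (\<Prod>i\<in>?I. emeasure (Q s (x i)) (Y i))"
      proof (cases "x \<in> Pi\<^sub>E ?I X")
        case True
        then have "(\<Prod>i\<in>?I. indicator (X i) (x i)) = (1 :: ennreal)" by (intro prod.neutral) (auto simp: PiE_iff)
        then show ?thesis using True Q.emeasure_PiM[of ?I Y] Y by simp
      next
        case False
        then obtain i where "i \<in> ?I" "x i \<notin> X i" using xB by (auto simp: PiE_iff space_PiM)
        then have "(\<Prod>i\<in>?I. indicator (X i) (x i)) = (0 :: ennreal)" by (intro prod_zero bexI[of _ i]) auto
        then show ?thesis using False by simp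
      qed
      finally show "emeasure (distr (PiM ?I (\<lambda>i. Q s (x i))) ?N (\<lambda>y. (x, y))) u
        = (\<Prod>i\<in>?I. indicator (X i) (x i) * emeasure (Q s (x i)) (Y i))" unfolding prod.distrib .
    qed
    also have "\<dots> = (\<Prod>i\<in>?I. \<integral>\<^sup>+x. indicator (X i) x * emeasure (Q s x) (Y i) \<partial>piM phi)"
    proof -
      interpret pp: product_sigma_finite "\<lambda>_. piM phi" by (intro product_sigma_finite.intro pi.sigma_finite_measure_axioms)
      show ?thesis by (rule pp.product_nn_integral_prod) (use X in auto)
    qed
    also have "\<dots> = (\<Prod>i\<in>?I. emeasure (J s) (X i \<times> Y i))"
      by (intro prod.cong refl emeasure_J_Times[symmetric] X Y)
    also have "\<dots> = emeasure ?P (Pi\<^sub>E ?I (\<lambda>i. X i \<times> Y i))"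
      by (rule JJ.emeasure_PiM[symmetric]) (use X Y in auto)
    also have "Pi\<^sub>E ?I (\<lambda>i. X i \<times> Y i) = ?T -` u \<inter> space ?P"
      unfolding XY space_PiM space_J by (auto simp: PiE_iff mem_Times_iff)
    also have "emeasure ?P \<dots> = emeasure (distr ?P ?N ?T) u"
      by (rule emeasure_distr[symmetric, OF T uN])
    finally show "emeasure (jointn g mu phi s n) u = emeasure (distr ?P ?N ?T) u" .
  qed auto
qed

definition Slr :: "real \<Rightarrow> nat \<Rightarrow> (nat \<Rightarrow> real \<times> real) \<Rightarrow> real" where
  "Slr s n \<omega> = (\<Sum>i\<in>{1..n}. lr s (\<omega> i))"

lemma lr_coordinate_measurable:
  "i \<in> I \<Longrightarrow> (\<lambda>\<omega>. lr s (\<omega> i)) \<in> borel_measurable (PiM I (\<lambda>_. J s))"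
  by (rule measurable_compose[OF measurable_component_singleton])
     (auto simp: measurable_cong_sets[OF sets_J refl])

lemma Slr_measurable [measurable]: "Slr s n \<in> borel_measurable (JN s n)"
  unfolding Slr_def[abs_def] by (intro borel_measurable_sum lr_coordinate_measurable)

text \<open>A common form for the efficiency (k = 2, up to the factor s^2) and the acceptance rate
  (k = 0), so that one limit theorem serves both.\<close>

definition acc_moment :: "real \<Rightarrow> nat \<Rightarrow> nat \<Rightarrow> real" where
  "acc_moment s n k = (\<integral>\<omega>. jump_pow s k (\<omega> 1) * min 1 (exp (Slr s n \<omega>)) \<partial>JN s n)"

lemma alphan_measurable [measurable]:
  "alphan g mu phi s n \<in> borel_measurable (PiM {1..n} (\<lambda>_. borel) \<Otimes>\<^sub>M PiM {1..n} (\<lambda>_. borel))"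
  unfolding alphan_def[abs_def] by measurable

lemma rho_sum_AE:
  "AE \<omega> in JN s n. (\<Sum>i\<in>{1..n}. rho g mu phi s (fst (\<omega> i), snd (\<omega> i))) = Slr s n \<omega>"
proof -
  have "AE \<omega> in JN s n. \<forall>i\<in>{1..n}. rho g mu phi s (\<omega> i) = lr s (\<omega> i)"
    by (intro eventually_ball_finite ballI AE_PiM_component[where P = "\<lambda>p. rho g mu phi s p = lr s p"] J_prob rho_AE) auto
  then show ?thesis by eventually_elim (simp add: Slr_def)
qed

text \<open>Moves to independent pairs and replaces \<open>rho\<close> by its explicit version
  almost everywhere; n >= 1 ensures that coordinate 1 is present.\<close>

lemma integral_jointn:
  assumes n: "n \<ge> 1" and s: "s > 0"
  shows "En g mu phi s n = s\<^sup>2 * acc_moment s n 2" and "Accn g mu phi s n = acc_moment s n 0"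
proof -
  let ?N = "PiM {1..n} (\<lambda>_. borel :: real measure) \<Otimes>\<^sub>M PiM {1..n} (\<lambda>_. borel :: real measure)"
  let ?T = "\<lambda>\<omega>. (\<lambda>i\<in>{1..n}. fst (\<omega> i), \<lambda>i\<in>{1..n}. snd (\<omega> i :: real \<times> real))"
  have T [measurable]: "?T \<in> JN s n \<rightarrow>\<^sub>M ?N"
    by (intro measurable_Pair measurable_restrict) measurable
  have one: "1 \<in> {1..n}" using n by simp
  have [measurable]: "(\<lambda>xy. fst xy (1::nat)) \<in> borel_measurable ?N" "(\<lambda>xy. snd xy (1::nat)) \<in> borel_measurable ?N"
    using one by measurable
  have al: "AE \<omega> in JN s n. alphan g mu phi s n (?T \<omega>) = min 1 (exp (Slr s n \<omega>))"
    using rho_sum_AE[of s n] by eventually_elim (simp add: alphan_def)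
  have [measurable]: "(\<lambda>\<omega>. alphan g mu phi s n (?T \<omega>)) \<in> borel_measurable (JN s n)"
    by (rule measurable_compose[OF T alphan_measurable])
  have [measurable]: "(\<lambda>\<omega>. \<omega> 1) \<in> JN s n \<rightarrow>\<^sub>M borel \<Otimes>\<^sub>M borel"
    using measurable_component_singleton[OF one, of "\<lambda>_. J s"] by (simp add: measurable_cong_sets[OF refl sets_J])
  have "En g mu phi s n = (\<integral>\<omega>. (snd (\<omega> 1) - fst (\<omega> 1))\<^sup>2 * alphan g mu phi s n (?T \<omega>) \<partial>JN s n)"
  proof -
    have "(\<lambda>xy. (snd xy 1 - fst xy 1)\<^sup>2 * alphan g mu phi s n xy) \<in> borel_measurable ?N" by measurable
    then show ?thesis
      unfolding En_def jointn_eq using one by (subst integral_distr[OF T]) (simp_all del: One_nat_def)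
  qed
  also have "\<dots> = (\<integral>\<omega>. s\<^sup>2 * (jump_pow s 2 (\<omega> 1) * min 1 (exp (Slr s n \<omega>))) \<partial>JN s n)"
  proof (rule integral_cong_AE)
    show "AE \<omega> in JN s n. (snd (\<omega> 1) - fst (\<omega> 1))\<^sup>2 * alphan g mu phi s n (?T \<omega>)
      = s\<^sup>2 * (jump_pow s 2 (\<omega> 1) * min 1 (exp (Slr s n \<omega>)))"
      using al by eventually_elim (use s in \<open>simp add: jump_pow_def power_divide\<close>)
  qed measurable
  also have "\<dots> = s\<^sup>2 * acc_moment s n 2" unfolding acc_moment_def by (rule integral_mult_right_zero)
  finally show "En g mu phi s n = s\<^sup>2 * acc_moment s n 2" .
  have "Accn g mu phi s n = (\<integral>\<omega>. alphan g mu phi s n (?T \<omega>) \<partial>JN s n)"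
    unfolding Accn_def jointn_eq by (subst integral_distr[OF T alphan_measurable]) (rule refl)
  also have "\<dots> = acc_moment s n 0"
    unfolding acc_moment_def
  proof (rule integral_cong_AE)
    show "AE \<omega> in JN s n. alphan g mu phi s n (?T \<omega>) = jump_pow s 0 (\<omega> 1) * min 1 (exp (Slr s n \<omega>))"
      using al by eventually_elim (simp add: jump_pow_def)
  qed measurable
  finally show "Accn g mu phi s n = acc_moment s n 0" .
qed

end

section \<open>Passage to the limit\<close>

text \<open>Completing the square turns the exponential weight into a shift by c/2 and a factor
  exp(c^2/8).\<close>

lemma normal_left_tail:
  "(\<integral>x. indicator {..0} x * (exp (c * x / 2) * std_normal_density x) \<partial>lborel) = exp (c\<^sup>2 / 8) * Phi (- c / 2)"
  and normal_left_tail_integrable: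
  "integrable lborel (\<lambda>x. indicator {..0} x * (exp (c * x / 2) * std_normal_density x))"
proof -
  interpret N: real_distribution std_normal_distribution by (rule real_dist_normal_dist)
  have sq: "exp (c * x / 2) * std_normal_density x = exp (c\<^sup>2 / 8) * std_normal_density (x - c / 2)" for x
  proof -
    have "c * x / 2 + - x\<^sup>2 / 2 = c\<^sup>2 / 8 + - (x - c / 2)\<^sup>2 / 2"
      by (simp add: power2_eq_square field_simps)
    then have "exp (c * x / 2) * exp (- x\<^sup>2 / 2) = exp (c\<^sup>2 / 8) * exp (- (x - c / 2)\<^sup>2 / 2)"
      by (simp flip: exp_add)
    then show ?thesis by (simp add: normal_density_def)
  qed
  have ind: "indicator {..0} (c / 2 + 1 * x) = (indicator {..- c / 2} x :: real)" for x :: real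
    by (auto simp: indicator_def)
  have int: "integrable lborel (\<lambda>y. indicator {..- c / 2} y * std_normal_density y)"
    using integrable_real_mult_indicator[of "{..- c / 2}" lborel std_normal_density] by (simp add: mult.commute)
  have eq: "indicator {..0} x * (exp (c * x / 2) * std_normal_density x)
      = exp (c\<^sup>2 / 8) * (indicator {..0} x * std_normal_density (x - c / 2))" for x
    unfolding sq by simp
  have sh: "(\<lambda>y. indicator {..0} (c / 2 + 1 * y) * std_normal_density (c / 2 + 1 * y - c / 2)) = (\<lambda>y. indicator {..- c / 2} y * std_normal_density y)"
    unfolding ind by simp
  have "integrable lborel (\<lambda>x. indicator {..0} x * std_normal_density (x - c / 2))"
    using lborel_integrable_real_affine_iff[of 1 "\<lambda>x. indicator {..0} x * std_normal_density (x - c / 2)" "c / 2"] int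
    unfolding sh by simp
  then show "integrable lborel (\<lambda>x. indicator {..0} x * (exp (c * x / 2) * std_normal_density x))"
    unfolding eq by (rule integrable_mult_right)
  have "(\<integral>x. indicator {..0} x * std_normal_density (x - c / 2) \<partial>lborel) = (\<integral>y. indicator {..- c / 2} y * std_normal_density y \<partial>lborel)"
    using lborel_integral_real_affine[of 1 "\<lambda>x. indicator {..0} x * std_normal_density (x - c / 2)" "c / 2"]
    unfolding sh by simp
  also have "\<dots> = integral\<^sup>L std_normal_distribution (indicator {..- c / 2})"
    by (subst integral_density) (auto simp: mult.commute)
  also have "\<dots> = Phi (- c / 2)" by (simp add: Phi_def)
  finally show "(\<integral>x. indicator {..0} x * (exp (c * x / 2) * std_normal_density x) \<partial>lborel) = exp (c\<^sup>2 / 8) * Phi (- c / 2)"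
    unfolding eq by simp
qed

lemma laplace_normal:
  assumes "c \<ge> 0"
  shows "(\<integral>x. exp (- \<bar>c * x\<bar> / 2) \<partial>std_normal_distribution) = exp (c\<^sup>2 / 8) * (2 * Phi (- c / 2))"
proof -
  let ?f = "\<lambda>x. indicator {..0} x * (exp (c * x / 2) * std_normal_density x)"
  have "(\<integral>x. exp (- \<bar>c * x\<bar> / 2) \<partial>std_normal_distribution) = (\<integral>x. std_normal_density x * exp (- \<bar>c * x\<bar> / 2) \<partial>lborel)"
    by (subst integral_density) auto
  also have "\<dots> = (\<integral>x. ?f x + ?f (- x) \<partial>lborel)"
  proof (rule integral_cong_AE)
    \<comment> \<open>The two half-lines overlap only at 0, where the sum counts the value
      twice.\<close>
    show "AE x in lborel. std_normal_density x * exp (- \<bar>c * x\<bar> / 2) = ?f x + ?f (- x)"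
      using AE_lborel_singleton[of 0]
      by eventually_elim (use assms in \<open>auto simp: indicator_def abs_mult\<close>)
  qed measurable
  also have "\<dots> = (\<integral>x. ?f x \<partial>lborel) + (\<integral>x. ?f (- x) \<partial>lborel)"
    using normal_left_tail_integrable[of c] lborel_integrable_real_affine_iff[of "-1" ?f 0]
    by (intro Bochner_Integration.integral_add) auto
  also have "(\<integral>x. ?f (- x) \<partial>lborel) = (\<integral>x. ?f x \<partial>lborel)"
    using lborel_integral_real_affine[of "-1" ?f 0] by simp
  finally show ?thesis unfolding normal_left_tail by simp
qed

text \<open>The limit law is an image of the standard normal under scaling, so that c = 0 is
  included as the point mass at 0.\<close>

lemma laplace_limit:
  assumes M: "\<And>n. real_distribution (M n)" and c: "c \<ge> 0"
    and ch: "\<And>t. (\<lambda>n. char (M n) t) \<longlonglongrightarrow> complex_of_real (exp (- (c * t)\<^sup>2 / 2))"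
  shows "(\<lambda>n. \<integral>x. exp (- \<bar>x\<bar> / 2) \<partial>M n) \<longlonglongrightarrow> exp (c\<^sup>2 / 8) * (2 * Phi (- c / 2))"
proof -
  interpret N: real_distribution std_normal_distribution by (rule real_dist_normal_dist)
  let ?N = "distr std_normal_distribution borel (\<lambda>x. c * x)"
  have N': "real_distribution ?N" by (rule N.real_distribution_distr) simp
  have "char ?N t = complex_of_real (exp (- (c * t)\<^sup>2 / 2))" for t
  proof -
    have "char ?N t = char std_normal_distribution (c * t)"
      unfolding char_def by (subst integral_distr) (auto simp: ac_simps)
    then show ?thesis by (simp add: char_std_normal_distribution)
  qed
  then have "weak_conv_m M ?N" using levy_continuity[OF M N'] ch by simp
  then have "(\<lambda>n. \<integral>x. exp (- \<bar>x\<bar> / 2) \<partial>M n) \<longlonglongrightarrow> (\<integral>x. exp (- \<bar>x\<bar> / 2) \<partial>?N)"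
    by (intro weak_conv_imp_integral_bdd_continuous_conv[where B = 1, OF M N']) (auto intro!: continuous_intros)
  also have "(\<integral>x. exp (- \<bar>x\<bar> / 2) \<partial>?N) = exp (c\<^sup>2 / 8) * (2 * Phi (- c / 2))"
    by (subst integral_distr) (use laplace_normal[OF c] in auto)
  finally show ?thesis .
qed

text \<open>The exponent is n - 1 because coordinate 1 carries the jump factor and is treated apart.
  The auxiliary q is -ln(1-u)/u extended continuously by 1.\<close>

lemma power_exp_limit:
  fixes x :: "nat \<Rightarrow> real"
  assumes "(\<lambda>n. real n * x n) \<longlonglongrightarrow> a"
  shows "(\<lambda>n. (1 - x n) ^ (n - 1)) \<longlonglongrightarrow> exp (- a)"
proof -
  define q where "q = (\<lambda>u::real. if u = 0 then 1 else - ln (1 - u) / u)"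
  have "(\<lambda>u::real. - ln (1 - u) / u) \<midarrow>0\<rightarrow> 1" by real_asymp
  then have "(q \<longlongrightarrow> 1) (at 0)"
    by (rule Lim_transform_eventually) (auto simp: eventually_at_filter q_def)
  then have q: "isCont q 0" by (simp add: isCont_def q_def)
  have "(\<lambda>n. (real n * x n) * inverse (real n)) \<longlonglongrightarrow> a * 0"
    by (intro tendsto_intros assms lim_inverse_n)
  moreover have "\<forall>\<^sub>F n in sequentially. (real n * x n) * inverse (real n) = x n"
    using eventually_gt_at_top[of 0] by eventually_elim simp
  ultimately have x0: "x \<longlonglongrightarrow> 0" by (simp add: tendsto_cong)
  have "(\<lambda>n. real n * x n - x n) \<longlonglongrightarrow> a - 0" by (rule tendsto_diff[OF assms x0])
  then have "(\<lambda>n. exp (- ((real n * x n - x n) * q (x n)))) \<longlonglongrightarrow> exp (- ((a - 0) * q 0))"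
    by (intro tendsto_exp tendsto_minus tendsto_mult isCont_tendsto_compose[OF q x0])
  then have "(\<lambda>n. exp (- ((real n * x n - x n) * q (x n)))) \<longlonglongrightarrow> exp (- a)" by (simp add: q_def)
  moreover have "\<forall>\<^sub>F n in sequentially. exp (- ((real n * x n - x n) * q (x n))) = (1 - x n) ^ (n - 1)"
    using order_tendstoD(2)[OF x0, of 1, simplified] eventually_ge_at_top[of 1]
  proof eventually_elim
    case (elim n)
    have "- ((real n * x n - x n) * q (x n)) = real (n - 1) * ln (1 - x n)"
      using elim by (auto simp: q_def of_nat_diff field_simps)
    also have "exp \<dots> = (1 - x n) ^ (n - 1)" unfolding exp_of_nat_mult using elim by simp
    finally show ?case .
  qed
  ultimately show ?thesis by (rule Lim_transform_eventually)
qed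

section \<open>The tilted product law and the acceptance moments\<close>

context mh_chain
begin

definition tilt_moment :: "nat \<Rightarrow> real \<Rightarrow> real \<Rightarrow> real" where
  "tilt_moment k s t = (\<integral>p. jump_pow s k p * tilted t (lr s p) \<partial>J s)"

definition tilt :: "real \<Rightarrow> nat \<Rightarrow> nat \<Rightarrow> (nat \<Rightarrow> real \<times> real) \<Rightarrow> real" where
  "tilt s n k \<omega> = jump_pow s k (\<omega> 1) * exp (Slr s n \<omega> / 2)"

lemma coordinate_1_measurable:
  assumes "(n :: nat) \<ge> 1" shows "(\<lambda>\<omega>. \<omega> 1) \<in> JN s n \<rightarrow>\<^sub>M borel \<Otimes>\<^sub>M borel"
proof -
  have "(\<lambda>\<omega>. \<omega> 1) \<in> JN s n \<rightarrow>\<^sub>M J s"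
    by (rule measurable_component_singleton) (use assms in simp)
  then show ?thesis by (rule measurable_cong_sets[OF refl sets_J, THEN equalityD1, THEN subsetD])
qed

lemma tilt_measurable:
  assumes "n \<ge> 1" shows "tilt s n k \<in> borel_measurable (JN s n)"
proof -
  note [measurable] = coordinate_1_measurable[OF assms]
  show ?thesis unfolding tilt_def[abs_def] by measurable
qed

lemma tilt_nonneg: "even k \<Longrightarrow> tilt s n k \<omega> \<ge> 0"
  by (simp add: tilt_def jump_pow_def zero_le_even_power del: One_nat_def)

text \<open>The integrand is a product over coordinates, of which only the first carries the power
  of the jump; independence factorises its integral.\<close>

lemma tilt_char:
  assumes n: "n \<ge> 1" and s: "0 < s" "s \<le> 1" and k: "even k" "k \<le> 6"
  shows "integrable (JN s n) (\<lambda>\<omega>. complex_of_real (tilt s n k \<omega>) * iexp (t * Slr s n \<omega>))"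
    and "(CLINT \<omega>|JN s n. complex_of_real (tilt s n k \<omega>) * iexp (t * Slr s n \<omega>))
      = complex_of_real (tilt_moment k s t * tilt_moment 0 s t ^ (n - 1))"
proof -
  \<comment> \<open>Coordinate-dependent exponent: power 0 gives the factor 1 in all coordinates but
    the first.\<close>
  define kk where "kk = (\<lambda>i::nat. if i = 1 then k else 0)"
  have kk: "even (kk i)" "kk i \<le> 6" for i using k by (auto simp: kk_def)
  define f where "f = (\<lambda>i p. complex_of_real (jump_pow s (kk i) p * exp (lr s p / 2)) * iexp (t * lr s p))"
  have one: "1 \<in> {1..n}" using n by simp
  have eq: "(\<Prod>i\<in>{1..n}. f i (\<omega> i)) = complex_of_real (tilt s n k \<omega>) * iexp (t * Slr s n \<omega>)" for \<omega>
  proof -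
    have "(\<Prod>i\<in>{1..n}. jump_pow s (kk i) (\<omega> i)) = (\<Prod>i\<in>{1..n}. if i = 1 then jump_pow s k (\<omega> i) else 1)"
      by (intro prod.cong) (auto simp: kk_def jump_pow_def)
    also have "\<dots> = jump_pow s k (\<omega> 1)" using one by (subst prod.delta) auto
    finally have p: "(\<Prod>i\<in>{1..n}. jump_pow s (kk i) (\<omega> i)) = jump_pow s k (\<omega> 1)" .
    have e: "(\<Prod>i\<in>{1..n}. exp (lr s (\<omega> i) / 2)) = exp (Slr s n \<omega> / 2)"
      unfolding Slr_def sum_divide_distrib by (rule exp_sum[symmetric]) simp
    have c: "(\<Prod>i\<in>{1..n}. iexp (t * lr s (\<omega> i))) = iexp (t * Slr s n \<omega>)"
      unfolding Slr_def sum_distrib_left of_real_sum by (rule exp_sum[symmetric]) simp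
    show ?thesis unfolding f_def prod.distrib of_real_prod[symmetric] p e c tilt_def ..
  qed
  have int: "integrable (J s) (f i)" for i
    unfolding f_def by (rule tilted_char(1)[OF s kk])
  have val: "(CLINT p|J s. f i p) = complex_of_real (tilt_moment (kk i) s t)" for i
    unfolding f_def tilt_moment_def by (rule tilted_char(2)[OF s kk])
  show "integrable (JN s n) (\<lambda>\<omega>. complex_of_real (tilt s n k \<omega>) * iexp (t * Slr s n \<omega>))"
    unfolding eq[symmetric] by (rule JJ.product_integrable_prod) (auto intro: int)
  have "(CLINT \<omega>|JN s n. (\<Prod>i\<in>{1..n}. f i (\<omega> i))) = (\<Prod>i\<in>{1..n}. CLINT p|J s. f i p)"
    by (rule JJ.product_integral_prod) (auto intro: int)
  also have "\<dots> = (\<Prod>i\<in>{1..n}. complex_of_real (tilt_moment (kk i) s t))" unfolding val ..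
  also have "\<dots> = complex_of_real (tilt_moment (kk 1) s t) * (\<Prod>i\<in>{1..n} - {1}. complex_of_real (tilt_moment (kk i) s t))"
    by (rule prod.remove[OF _ one]) simp
  also have "(\<Prod>i\<in>{1..n} - {1}. complex_of_real (tilt_moment (kk i) s t)) = (\<Prod>i\<in>{1..n} - {1}. complex_of_real (tilt_moment 0 s t))"
    by (intro prod.cong) (auto simp: kk_def)
  also have "\<dots> = complex_of_real (tilt_moment 0 s t) ^ (n - 1)" using one by simp
  finally show "(CLINT \<omega>|JN s n. complex_of_real (tilt s n k \<omega>) * iexp (t * Slr s n \<omega>))
      = complex_of_real (tilt_moment k s t * tilt_moment 0 s t ^ (n - 1))"
    unfolding eq by (simp add: kk_def)
qed

text \<open>The total mass of the tilted measure, that is, its characteristic function at t =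
  0.\<close>

definition tilt_mass :: "real \<Rightarrow> nat \<Rightarrow> nat \<Rightarrow> real" where
  "tilt_mass s n k = tilt_moment k s 0 * tilt_moment 0 s 0 ^ (n - 1)"

lemma tilt_integral:
  assumes n: "n \<ge> 1" and s: "0 < s" "s \<le> 1" and k: "even k" "k \<le> 6"
  shows "integrable (JN s n) (tilt s n k)"
    and "(\<integral>\<omega>. tilt s n k \<omega> \<partial>JN s n) = tilt_mass s n k"
proof -
  show int: "integrable (JN s n) (tilt s n k)"
    using tilt_char(1)[OF assms, of 0] by (simp add: complex_of_real_integrable_eq)
  have "complex_of_real (\<integral>\<omega>. tilt s n k \<omega> \<partial>JN s n) = complex_of_real (tilt_mass s n k)"
    using tilt_char(2)[OF assms, of 0] by (simp add: tilt_mass_def integral_complex_of_real del: One_nat_def)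
  then show "(\<integral>\<omega>. tilt s n k \<omega> \<partial>JN s n) = tilt_mass s n k" by (simp only: of_real_eq_iff)
qed

lemma min_exp_eq: "min 1 (exp r) = exp (r / 2) * exp (- \<bar>r\<bar> / 2)" for r :: real
  by (cases "r \<ge> 0") (auto simp: min_def simp flip: exp_add)

lemma acc_moment_eq:
  "acc_moment s n k = (\<integral>\<omega>. tilt s n k \<omega> * exp (- \<bar>Slr s n \<omega>\<bar> / 2) \<partial>JN s n)"
  unfolding acc_moment_def tilt_def min_exp_eq by (simp only: mult.assoc)

lemma acc_moment_bounds:
  assumes n: "n \<ge> 1" and s: "0 < s" "s \<le> 1" and k: "even k" "k \<le> 6"
  shows "0 \<le> acc_moment s n k" "acc_moment s n k \<le> tilt_mass s n k"
proof -
  note int = tilt_integral(1)[OF assms] and meas = tilt_measurable[OF n]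
  have le: "tilt s n k \<omega> * exp (- \<bar>Slr s n \<omega>\<bar> / 2) \<le> tilt s n k \<omega>" for \<omega>
    using tilt_nonneg[OF k(1)] by (intro mult_left_le) auto
  show "0 \<le> acc_moment s n k" unfolding acc_moment_eq
    using tilt_nonneg[OF k(1)] by (intro integral_nonneg_AE AE_I2 mult_nonneg_nonneg) auto
  have "integrable (JN s n) (\<lambda>\<omega>. tilt s n k \<omega> * exp (- \<bar>Slr s n \<omega>\<bar> / 2))"
  proof (rule Bochner_Integration.integrable_bound[OF int])
    show "(\<lambda>\<omega>. tilt s n k \<omega> * exp (- \<bar>Slr s n \<omega>\<bar> / 2)) \<in> borel_measurable (JN s n)"
      using meas by measurable
    show "AE \<omega> in JN s n. norm (tilt s n k \<omega> * exp (- \<bar>Slr s n \<omega>\<bar> / 2)) \<le> norm (tilt s n k \<omega>)"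
      using le tilt_nonneg[OF k(1)] by (intro AE_I2) (simp add: abs_mult)
  qed
  then show "acc_moment s n k \<le> tilt_mass s n k"
    unfolding acc_moment_eq tilt_integral(2)[OF assms, symmetric] using le int by (intro integral_mono)
qed

definition tilted_law :: "real \<Rightarrow> nat \<Rightarrow> nat \<Rightarrow> real measure" where
  "tilted_law s n k = distr (density (JN s n) (\<lambda>\<omega>. ennreal (tilt s n k \<omega> / tilt_mass s n k))) borel (Slr s n)"

lemma tilted_law:
  assumes n: "n \<ge> 1" and s: "0 < s" "s \<le> 1" and k: "even k" "k \<le> 6" and pos: "tilt_mass s n k > 0"
  shows "real_distribution (tilted_law s n k)"
    and "char (tilted_law s n k) t = complex_of_real (tilt_moment k s t * tilt_moment 0 s t ^ (n - 1) / tilt_mass s n k)"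
    and "acc_moment s n k = tilt_mass s n k * (\<integral>x. exp (- \<bar>x\<bar> / 2) \<partial>tilted_law s n k)"
proof -
  let ?P = "JN s n"
  note [measurable] = tilt_measurable[OF n]
  note as = n s k
  have nn: "AE \<omega> in ?P. 0 \<le> tilt s n k \<omega> / tilt_mass s n k" using tilt_nonneg[OF k(1)] pos by simp
  have int: "integrable ?P (\<lambda>\<omega>. tilt s n k \<omega> / tilt_mass s n k)"
    by (intro integrable_divide_zero impI tilt_integral(1)[OF as])
  have "prob_space (density ?P (\<lambda>\<omega>. ennreal (tilt s n k \<omega> / tilt_mass s n k)))"
  proof (rule prob_spaceI)
    have "(\<integral>\<^sup>+\<omega>. ennreal (tilt s n k \<omega> / tilt_mass s n k) \<partial>?P) = ennreal (\<integral>\<omega>. tilt s n k \<omega> / tilt_mass s n k \<partial>?P)"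
      by (rule nn_integral_eq_integral[OF int nn])
    also have "\<dots> = 1" using pos tilt_integral(2)[OF as] by simp
    finally show "emeasure (density ?P (\<lambda>\<omega>. ennreal (tilt s n k \<omega> / tilt_mass s n k)))
        (space (density ?P (\<lambda>\<omega>. ennreal (tilt s n k \<omega> / tilt_mass s n k)))) = 1"
      by (subst emeasure_density) (simp_all cong: nn_integral_cong del: One_nat_def)
  qed
  then interpret D: prob_space "density ?P (\<lambda>\<omega>. ennreal (tilt s n k \<omega> / tilt_mass s n k))" .
  show "real_distribution (tilted_law s n k)" unfolding tilted_law_def
    by (rule D.real_distribution_distr) (simp del: One_nat_def)
  \<comment> \<open>Stated for Banach-valued h, since it serves both the complex characteristic
    function and a real expectation.\<close>
  have integ: "(\<integral>x. h x \<partial>tilted_law s n k) = (\<integral>\<omega>. (tilt s n k \<omega> / tilt_mass s n k) *\<^sub>R h (Slr s n \<omega>) \<partial>?P)"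
    if [measurable]: "h \<in> borel_measurable borel" for h :: "real \<Rightarrow> 'x :: {banach, second_countable_topology}"
    unfolding tilted_law_def
    by (subst integral_distr, simp del: One_nat_def, simp, subst integral_density) (use nn in \<open>simp_all del: One_nat_def\<close>)
  have "char (tilted_law s n k) t = (CLINT \<omega>|?P. (tilt s n k \<omega> / tilt_mass s n k) *\<^sub>R iexp (t * Slr s n \<omega>))"
    unfolding char_def by (rule integ) simp
  also have "\<dots> = (CLINT \<omega>|?P. (complex_of_real (tilt s n k \<omega>) * iexp (t * Slr s n \<omega>)) / complex_of_real (tilt_mass s n k))"
    by (simp add: scaleR_conv_of_real)
  also have "\<dots> = complex_of_real (tilt_moment k s t * tilt_moment 0 s t ^ (n - 1)) / complex_of_real (tilt_mass s n k)"
    by (subst Bochner_Integration.integral_divide_zero) (simp only: tilt_char(2)[OF as])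
  finally show "char (tilted_law s n k) t = complex_of_real (tilt_moment k s t * tilt_moment 0 s t ^ (n - 1) / tilt_mass s n k)"
    by simp
  have "(\<integral>x. exp (- \<bar>x\<bar> / 2) \<partial>tilted_law s n k) = (\<integral>\<omega>. (tilt s n k \<omega> * exp (- \<bar>Slr s n \<omega>\<bar> / 2)) / tilt_mass s n k \<partial>?P)"
    by (subst integ) (auto simp: ac_simps)
  also have "\<dots> = acc_moment s n k / tilt_mass s n k"
    unfolding acc_moment_eq by (rule Bochner_Integration.integral_divide_zero)
  finally show "acc_moment s n k = tilt_mass s n k * (\<integral>x. exp (- \<bar>x\<bar> / 2) \<partial>tilted_law s n k)"
    using pos by simp
qed

lemma tilt_moment_0: assumes "0 < s" "s \<le> 1" shows "tilt_moment 0 s t = 1 - (\<integral>p. kap t (lr s p) \<partial>J s)"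
proof -
  have int: "integrable (J s) (\<lambda>p. tilted t (lr s p))"
    using jump_pow_integrable[OF assms, of 0 "\<lambda>p. tilted t (lr s p)"] tilted_le_1 by (simp add: jump_pow_def)
  have "(\<integral>p. kap t (lr s p) \<partial>J s) = (\<integral>p. 1 - tilted t (lr s p) \<partial>J s)" by (simp add: kap_def tilted_def)
  also have "\<dots> = 1 - (\<integral>p. tilted t (lr s p) \<partial>J s)" using int J.prob_space[of s] by simp
  finally show ?thesis by (simp add: tilt_moment_def jump_pow_def)
qed

text \<open>The mass tends to exp(-v/8), and dividing by it leaves the normal characteristic
  function of variance v = c^2. The factor exp(c^2/8) of the limiting expectation then cancels the
  mass.\<close>

lemma acc_moment_limit:
  assumes s: "\<And>n. 0 < s n" "\<And>n. s n \<le> 1" "s \<longlonglongrightarrow> 0" and th: "theta phi g mu > 0"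
    and L: "(\<lambda>n. real n * s n ^ 6) \<longlonglongrightarrow> L" "L \<ge> 0" and k: "k = 0 \<or> k = 2"
  shows "(\<lambda>n. acc_moment (s n) n k) \<longlonglongrightarrow> 2 * Phi (- (sqrt L * theta phi g mu) / 2)"
proof -
  define v where "v = L * (theta phi g mu)\<^sup>2"
  define c where "c = sqrt L * theta phi g mu"
  have c: "c \<ge> 0" "c\<^sup>2 = v" using th L by (auto simp: c_def v_def power_mult_distrib)
  have k': "even k" "k \<le> 6" using k by auto
  have lim0: "(\<lambda>n. tilt_moment 0 (s n) t ^ (n - 1)) \<longlonglongrightarrow> exp (- ((1/8 + t\<^sup>2/2) * v))" for t
  proof -
    have "(\<lambda>n. (real n * s n ^ 6) * ((\<integral>p. kap t (lr (s n) p) \<partial>J (s n)) / s n ^ 6)) \<longlonglongrightarrow> L * ((1/8 + t\<^sup>2/2) * (theta phi g mu)\<^sup>2)"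
      by (intro tendsto_mult L kap_expectation_limit s th)
    moreover have "(real n * s n ^ 6) * ((\<integral>p. kap t (lr (s n) p) \<partial>J (s n)) / s n ^ 6) = real n * (\<integral>p. kap t (lr (s n) p) \<partial>J (s n))" for n
      using s(1)[of n] by simp
    ultimately have "(\<lambda>n. real n * (\<integral>p. kap t (lr (s n) p) \<partial>J (s n))) \<longlonglongrightarrow> (1/8 + t\<^sup>2/2) * v"
      by (simp add: v_def ac_simps)
    from power_exp_limit[OF this] show ?thesis by (simp add: tilt_moment_0 s)
  qed
  have limk: "(\<lambda>n. tilt_moment k (s n) t) \<longlonglongrightarrow> 1" for t
    unfolding tilt_moment_def by (rule jump_tilted_limit[OF s k])
  have lim: "(\<lambda>n. tilt_moment k (s n) t * tilt_moment 0 (s n) t ^ (n - 1)) \<longlonglongrightarrow> exp (- ((1/8 + t\<^sup>2/2) * v))" for t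
    using tendsto_mult[OF limk lim0] by simp
  have mass: "(\<lambda>n. tilt_mass (s n) n k) \<longlonglongrightarrow> exp (- (v / 8))"
    using lim[of 0] by (simp add: tilt_mass_def)
  have pos: "\<forall>\<^sub>F n in sequentially. n \<ge> 1 \<and> tilt_mass (s n) n k > 0"
    using eventually_ge_at_top[of 1] order_tendstoD(1)[OF mass, of 0] by (auto intro: eventually_conj)
  \<comment> \<open>Positivity of the mass is known only eventually; the standard normal is a filler
    for the remaining n, so that the continuity theorem gets a probability law for every
    index.\<close>
  define M where "M = (\<lambda>n. if n \<ge> 1 \<and> tilt_mass (s n) n k > 0 then tilted_law (s n) n k else std_normal_distribution)"
  have Mrd: "real_distribution (M n)" for n
    unfolding M_def using tilted_law(1)[OF _ s(1,2) k'] real_dist_normal_dist by auto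
  have ev: "\<forall>\<^sub>F n in sequentially. M n = tilted_law (s n) n k" using pos by eventually_elim (simp add: M_def)
  have ch: "(\<lambda>n. char (M n) t) \<longlonglongrightarrow> complex_of_real (exp (- (c * t)\<^sup>2 / 2))" for t
  proof -
    have "(\<lambda>n. tilt_moment k (s n) t * tilt_moment 0 (s n) t ^ (n - 1) / tilt_mass (s n) n k)
      \<longlonglongrightarrow> exp (- ((1/8 + t\<^sup>2/2) * v)) / exp (- (v / 8))"
      by (intro tendsto_divide lim mass) simp
    also have "exp (- ((1/8 + t\<^sup>2/2) * v)) / exp (- (v / 8)) = exp (- (c * t)\<^sup>2 / 2)"
      by (simp add: power_mult_distrib c field_simps flip: exp_diff)
    finally have "(\<lambda>n. complex_of_real (tilt_moment k (s n) t * tilt_moment 0 (s n) t ^ (n - 1) / tilt_mass (s n) n k))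
      \<longlonglongrightarrow> complex_of_real (exp (- (c * t)\<^sup>2 / 2))" by (rule tendsto_of_real)
    moreover have "\<forall>\<^sub>F n in sequentially. complex_of_real (tilt_moment k (s n) t * tilt_moment 0 (s n) t ^ (n - 1) / tilt_mass (s n) n k) = char (M n) t"
      using pos by eventually_elim (simp only: M_def if_True simp_thms tilted_law(2)[OF _ s(1,2) k'])
    ultimately show ?thesis by (rule Lim_transform_eventually)
  qed
  have "(\<lambda>n. tilt_mass (s n) n k * (\<integral>x. exp (- \<bar>x\<bar> / 2) \<partial>M n)) \<longlonglongrightarrow> exp (- (v / 8)) * (exp (c\<^sup>2 / 8) * (2 * Phi (- c / 2)))"
    by (intro tendsto_mult mass laplace_limit Mrd c(1) ch)
  also have "exp (- (v / 8)) * (exp (c\<^sup>2 / 8) * (2 * Phi (- c / 2))) = 2 * Phi (- c / 2)"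
    by (simp add: c(2) mult.assoc[symmetric] flip: exp_add)
  finally have "(\<lambda>n. tilt_mass (s n) n k * (\<integral>x. exp (- \<bar>x\<bar> / 2) \<partial>M n)) \<longlonglongrightarrow> 2 * Phi (- c / 2)" .
  moreover have "\<forall>\<^sub>F n in sequentially. tilt_mass (s n) n k * (\<integral>x. exp (- \<bar>x\<bar> / 2) \<partial>M n) = acc_moment (s n) n k"
    using pos by eventually_elim (simp add: M_def tilted_law(3)[OF _ s(1,2) k'])
  ultimately show ?thesis unfolding c_def[symmetric] by (rule Lim_transform_eventually)
qed

text \<open>Bounding the acceptance moment by the tilted mass leaves (1 - e)^(n-1) <= exp(-e (n-1)),
  with e the mean deficit at t = 0, of order s^6.\<close>

lemma acc_moment_decay:
  assumes s: "\<And>n. 0 < s n" "\<And>n. s n \<le> 1" "s \<longlonglongrightarrow> 0" and th: "theta phi g mu > 0"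
  obtains K where "K > 0" "\<forall>\<^sub>F n in sequentially. acc_moment (s n) n 2 \<le> 2 * exp (- (K * (real n * s n ^ 6)))"
proof -
  \<comment> \<open>The deficit over s^6 tends to theta^2/8 = 4 K, so it eventually exceeds 2 K; the
    remaining factor 2 pays for n - 1 >= n/2.\<close>
  define K where "K = (theta phi g mu)\<^sup>2 / 32"
  have K: "K > 0" using th by (simp add: K_def)
  have "(\<lambda>n. (\<integral>p. kap 0 (lr (s n) p) \<partial>J (s n)) / s n ^ 6) \<longlonglongrightarrow> (1/8 + 0\<^sup>2/2) * (theta phi g mu)\<^sup>2"
    by (rule kap_expectation_limit[OF s th])
  then have "\<forall>\<^sub>F n in sequentially. 2 * K < (\<integral>p. kap 0 (lr (s n) p) \<partial>J (s n)) / s n ^ 6"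
    by (rule order_tendstoD) (use th in \<open>simp add: K_def\<close>)
  moreover have "\<forall>\<^sub>F n in sequentially. tilt_moment 2 (s n) 0 < 2"
    using jump_tilted_limit[OF s, of 2 0] unfolding tilt_moment_def by (rule order_tendstoD) auto
  moreover have "\<forall>\<^sub>F n in sequentially. n \<ge> 2" by (rule eventually_ge_at_top)
  ultimately have "\<forall>\<^sub>F n in sequentially. acc_moment (s n) n 2 \<le> 2 * exp (- (K * (real n * s n ^ 6)))"
  proof eventually_elim
    case (elim n)
    define e where "e = (\<integral>p. kap 0 (lr (s n) p) \<partial>J (s n))"
    have e: "2 * K * s n ^ 6 \<le> e" using elim(1) s(1)[of n] by (simp add: e_def field_simps)
    have tm: "tilt_moment 0 (s n) 0 = 1 - e" unfolding e_def by (rule tilt_moment_0[OF s(1,2)])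
    have "tilt_moment 0 (s n) 0 \<ge> 0" unfolding tilt_moment_def
      by (intro integral_nonneg_AE) (auto simp: tilted_def jump_pow_def cosh_real_nonneg)
    then have "tilt_moment 0 (s n) 0 ^ (n - 1) \<le> exp (- (2 * K * s n ^ 6)) ^ (n - 1)"
      using exp_ge_add_one_self[of "- e"] e by (intro power_mono) (auto simp: tm intro: order_trans)
    also have "\<dots> = exp (- (real (n - 1) * (2 * K * s n ^ 6)))" by (simp flip: exp_of_nat_mult)
    also have "\<dots> \<le> exp (- (K * (real n * s n ^ 6)))"
    proof -
      have "real n * (K * s n ^ 6) \<le> (2 * real (n - 1)) * (K * s n ^ 6)"
        using elim K s(1)[of n] by (intro mult_right_mono) (auto simp: of_nat_diff)
      then show ?thesis by (simp add: ac_simps)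
    qed
    finally have pw: "tilt_moment 0 (s n) 0 ^ (n - 1) \<le> exp (- (K * (real n * s n ^ 6)))" .
    have "acc_moment (s n) n 2 \<le> tilt_moment 2 (s n) 0 * tilt_moment 0 (s n) 0 ^ (n - 1)"
      using acc_moment_bounds(2)[OF _ s(1,2), of n 2 n] elim by (simp add: tilt_mass_def)
    also have "\<dots> \<le> 2 * exp (- (K * (real n * s n ^ 6)))"
      using elim pw \<open>tilt_moment 0 (s n) 0 \<ge> 0\<close> by (intro mult_mono) auto
    finally show ?case .
  qed
  with K show ?thesis by (rule that)
qed

section \<open>The scaling regimes\<close>

lemma root_scale_square: "(real n powr (1/6) * s)\<^sup>2 = real n powr (1/3) * s\<^sup>2"
  by (simp add: power2_eq_square flip: powr_add)

lemma root_scale_sixth: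
  assumes "n \<ge> 1" shows "(real n powr (1/6) * s) ^ 6 = real n * s ^ 6"
proof -
  have "(real n powr (1/6)) ^ 6 = (real n powr (1/6)) powr 6" using assms by (simp add: powr_numeral)
  also have "\<dots> = real n" using assms by (simp add: powr_powr)
  finally show ?thesis by (simp add: power_mult_distrib)
qed

text \<open>The value l = 0 is included and covers the regime of vanishing scale, since h vanishes
  there.\<close>

lemma En_limit:
  assumes s: "\<And>n. 0 < s n" "\<And>n. s n \<le> 1" "s \<longlonglongrightarrow> 0" and th: "theta phi g mu > 0"
    and l: "(\<lambda>n. real n powr (1/6) * s n) \<longlonglongrightarrow> l" "l \<ge> 0"
  shows "(\<lambda>n. real n powr (1/3) * En g mu phi (s n) n) \<longlonglongrightarrow> hfun (theta phi g mu) l"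
    and "(\<lambda>n. Accn g mu phi (s n) n) \<longlonglongrightarrow> 2 * Phi (- (l ^ 3 * theta phi g mu / 2))"
proof -
  have n1: "\<forall>\<^sub>F n in sequentially. n \<ge> (1 :: nat)" by (rule eventually_ge_at_top)
  have "(\<lambda>n. (real n powr (1/6) * s n) ^ 6) \<longlonglongrightarrow> l ^ 6" by (intro tendsto_power l)
  moreover have "\<forall>\<^sub>F n in sequentially. (real n powr (1/6) * s n) ^ 6 = real n * s n ^ 6"
    using n1 by eventually_elim (rule root_scale_sixth)
  ultimately have L: "(\<lambda>n. real n * s n ^ 6) \<longlonglongrightarrow> l ^ 6" by (rule Lim_transform_eventually)
  have "sqrt (l ^ 6) = l ^ 3" using l(2) by (intro real_sqrt_unique) (auto simp flip: power_mult)
  then have lim: "(\<lambda>n. acc_moment (s n) n k) \<longlonglongrightarrow> 2 * Phi (- (l ^ 3 * theta phi g mu / 2))" if "k = 0 \<or> k = 2" for k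
    using acc_moment_limit[OF s th L _ that] l(2) by simp
  have "(\<lambda>n. (real n powr (1/6) * s n)\<^sup>2 * acc_moment (s n) n 2) \<longlonglongrightarrow> l\<^sup>2 * (2 * Phi (- (l ^ 3 * theta phi g mu / 2)))"
    by (intro tendsto_mult tendsto_power l lim) simp
  moreover have "\<forall>\<^sub>F n in sequentially. (real n powr (1/6) * s n)\<^sup>2 * acc_moment (s n) n 2 = real n powr (1/3) * En g mu phi (s n) n"
    using n1 by eventually_elim (simp add: root_scale_square integral_jointn(1) s)
  ultimately have "(\<lambda>n. real n powr (1/3) * En g mu phi (s n) n) \<longlonglongrightarrow> l\<^sup>2 * (2 * Phi (- (l ^ 3 * theta phi g mu / 2)))"
    by (rule Lim_transform_eventually)
  then show "(\<lambda>n. real n powr (1/3) * En g mu phi (s n) n) \<longlonglongrightarrow> hfun (theta phi g mu) l"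
    by (simp add: hfun_def ac_simps)
  have "\<forall>\<^sub>F n in sequentially. acc_moment (s n) n 0 = Accn g mu phi (s n) n"
    using n1 by eventually_elim (simp add: integral_jointn(2) s)
  with lim[of 0] show "(\<lambda>n. Accn g mu phi (s n) n) \<longlonglongrightarrow> 2 * Phi (- (l ^ 3 * theta phi g mu / 2))"
    by (auto intro: Lim_transform_eventually)
qed

text \<open>With u = n^(1/6) s the efficiency is eventually at most 2 u^2 exp(-K u^6), and the
  exponential wins.\<close>

lemma En_limit_infinity:
  assumes s: "\<And>n. 0 < s n" "\<And>n. s n \<le> 1" "s \<longlonglongrightarrow> 0" and th: "theta phi g mu > 0"
    and top: "filterlim (\<lambda>n. real n powr (1/6) * s n) at_top sequentially"
  shows "(\<lambda>n. real n powr (1/3) * En g mu phi (s n) n) \<longlonglongrightarrow> 0"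
proof -
  obtain K where K: "K > 0" "\<forall>\<^sub>F n in sequentially. acc_moment (s n) n 2 \<le> 2 * exp (- (K * (real n * s n ^ 6)))"
    using acc_moment_decay[OF s th] by blast
  have "((\<lambda>u::real. u\<^sup>2 * (2 * exp (- (K * u ^ 6)))) \<longlongrightarrow> 0) at_top" using K(1) by real_asymp
  from filterlim_compose[OF this top]
  have lim: "(\<lambda>n. (real n powr (1/6) * s n)\<^sup>2 * (2 * exp (- (K * (real n powr (1/6) * s n) ^ 6)))) \<longlonglongrightarrow> 0" .
  have ev: "\<forall>\<^sub>F n in sequentially. norm (real n powr (1/3) * En g mu phi (s n) n)
      \<le> (real n powr (1/6) * s n)\<^sup>2 * (2 * exp (- (K * (real n powr (1/6) * s n) ^ 6)))"
    using K(2) eventually_ge_at_top[of 1]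
  proof eventually_elim
    case (elim n)
    have a0: "acc_moment (s n) n 2 \<ge> 0" using acc_moment_bounds(1)[OF elim(2) s(1,2)] by simp
    have e: "real n powr (1/3) * En g mu phi (s n) n = (real n powr (1/6) * s n)\<^sup>2 * acc_moment (s n) n 2"
      using elim by (simp add: root_scale_square integral_jointn(1) s)
    have "norm (real n powr (1/3) * En g mu phi (s n) n) = (real n powr (1/6) * s n)\<^sup>2 * acc_moment (s n) n 2"
      unfolding e using a0 by simp
    also have "\<dots> \<le> (real n powr (1/6) * s n)\<^sup>2 * (2 * exp (- (K * (real n powr (1/6) * s n) ^ 6)))"
      unfolding root_scale_sixth[OF elim(2)] by (intro mult_left_mono elim(1)) simp
    finally show ?case .
  qed
  show ?thesis by (rule Lim_null_comparison[OF ev lim])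
qed

end

text \<open>Translates Assumption 1 into the locale; the substance is the construction of the
  envelope \<open>dom\<close> from the Hoelder-type increments.\<close>

lemma mh_chain_exists:
  assumes dens: "(\<integral>\<^sup>+x. ennreal (exp (phi x)) \<partial>lborel) = 1"
    and bal: "balancing g"
    and mu_prob: "prob_space mu" and mu_sets: "sets mu = sets borel"
    and mu_symm: "distr mu borel uminus = mu"
    and mu_centred: "(\<integral>z. z \<partial>mu) = 0"
    and A1: "Assumption1 phi g mu"
  shows "\<exists>M C \<beta> \<xi> dom. mh_chain g mu M C \<beta> \<xi> phi dom"
proof -
  let ?d1 = "deriv phi" and ?d2 = "deriv (deriv phi)" and ?d3 = "deriv (deriv (deriv phi))"
  show ?thesis
    using A1 unfolding Assumption1_def Let_def
  proof (elim exE conjE, goal_cases)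
    case A: (1 H \<gamma> \<beta> \<epsilon> C)
    note H = A(1-5) and C3 = A(6) and F = bspec[OF A(7)] and B3 = A(8) and var = A(9)
    define \<xi> where "\<xi> = max (6 + 3 * \<epsilon>) (max (2 + 2 * H) (2 + 2 * \<gamma>))"
    have xi: "\<xi> > 6" using H by (simp add: \<xi>_def less_max_iff_disj)
    have C: "C > 0" "\<And>a. integrable mu (\<lambda>z. exp (bfun g (a * z)))"
        "\<And>a. integrable mu (\<lambda>z. exp (bfun g (a * z)) * \<bar>z\<bar> powr \<xi>)"
        "\<And>a. (\<integral>z. exp (bfun g (a * z)) * \<bar>z\<bar> powr \<xi> \<partial>mu) \<le> C * (1 + npow \<bar>a\<bar> \<beta>) * (\<integral>z. exp (bfun g (a * z)) \<partial>mu)"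
      using A(11,12) unfolding \<xi>_def[symmetric] by blast+
    from B3 obtain M where B: "\<And>x. (bfun g has_real_derivative deriv (bfun g) x) (at x)"
        "\<And>x. (deriv (bfun g) has_real_derivative deriv (deriv (bfun g)) x) (at x)"
        "\<And>x. (deriv (deriv (bfun g)) has_real_derivative deriv (deriv (deriv (bfun g))) x) (at x)"
        "\<And>x. \<bar>deriv (bfun g) x\<bar> \<le> M" "\<And>x. \<bar>deriv (deriv (bfun g)) x\<bar> \<le> M"
      unfolding C3bdd_def by blast
    from C3 have P: "\<And>x. (phi has_real_derivative ?d1 x) (at x)" "\<And>x. (?d1 has_real_derivative ?d2 x) (at x)"
        "\<And>x. (?d2 has_real_derivative ?d3 x) (at x)" "continuous_on UNIV ?d3"
      unfolding C3H_def by auto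
    have g: "g 0 = 0" "\<And>t. t > 0 \<Longrightarrow> g t > 0" "\<And>t. t > 0 \<Longrightarrow> g t = t * g (1 / t)" "g 1 = 1"
      using bal unfolding balancing_def by blast+
    have "phi \<in> borel_measurable borel" "?d1 \<in> borel_measurable borel" "?d2 \<in> borel_measurable borel" "?d3 \<in> borel_measurable borel"
      using P(4) by (auto intro!: borel_measurable_continuous_onI DERIV_continuous_on[OF P(1)[THEN DERIV_subset]]
          DERIV_continuous_on[OF P(2)[THEN DERIV_subset]] DERIV_continuous_on[OF P(3)[THEN DERIV_subset]])
    note [measurable] = this
    have [measurable_cong]: "sets (piM phi) = sets borel" by (simp add: piM_def)
    have [measurable]: "(\<lambda>x. npow \<bar>?d1 x\<bar> \<beta>) \<in> borel_measurable borel" unfolding npow_def by measurable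
    let ?w = "\<lambda>x. 1 + npow \<bar>?d1 x\<bar> \<beta>"
    have w1: "?w x \<ge> 1" for x using npow_nonneg[of "?d1 x" \<beta>] by simp
    have pi_prob: "prob_space (piM phi)"
      unfolding piM_def by (rule prob_spaceI) (subst emeasure_density, auto simp: dens)
    interpret pi: prob_space "piM phi" by (rule pi_prob)
    \<comment> \<open>Where |phi'| <= 1 the weight is at most 2; elsewhere it is dominated through
      the integrability condition on (phi')^3.\<close>
    have w_int: "integrable (piM phi) ?w"
    proof (rule Bochner_Integration.integrable_bound)
      show "integrable (piM phi) (\<lambda>x. 2 + \<bar>(?d1 x)^3\<bar> powr (2 + \<epsilon>) * ?w x)"
        using F[of "\<lambda>x. (?d1 x)^3"] by (intro Bochner_Integration.integrable_add) auto
      show "AE x in piM phi. norm (?w x) \<le> norm (2 + \<bar>(?d1 x)^3\<bar> powr (2 + \<epsilon>) * ?w x)"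
      proof (rule AE_I2)
        fix x
        have "?w x \<le> 2 + \<bar>(?d1 x)^3\<bar> powr (2 + \<epsilon>) * ?w x"
        proof (cases "\<bar>?d1 x\<bar> \<le> 1")
          case True
          then have "npow \<bar>?d1 x\<bar> \<beta> \<le> 1" using H by (simp add: npow_def powr_le1)
          moreover have "0 \<le> \<bar>(?d1 x)^3\<bar> powr (2 + \<epsilon>) * ?w x" using w1[of x] by simp
          ultimately show ?thesis by linarith
        next
          case False
          then have "1 \<le> \<bar>(?d1 x)^3\<bar>" by (simp add: power_abs one_le_power)
          then have "1 \<le> \<bar>(?d1 x)^3\<bar> powr (2 + \<epsilon>)" using H by (intro ge_one_powr_ge_zero) auto
          then have "1 * ?w x \<le> \<bar>(?d1 x)^3\<bar> powr (2 + \<epsilon>) * ?w x" using w1[of x] by (intro mult_right_mono) auto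
          then show ?thesis by simp
        qed
        then show "norm (?w x) \<le> norm (2 + \<bar>(?d1 x)^3\<bar> powr (2 + \<epsilon>) * ?w x)" using w1[of x] by simp
      qed
    qed measurable
    \<comment> \<open>For |v - x| <= 1 the increment of f is at most K(x), so 2 f(x)^2 + 2 K(x)^2
      dominates f^2 on the whole window.\<close>
    have local_bound: "\<exists>D. (\<forall>x v. \<bar>v - x\<bar> \<le> 1 \<longrightarrow> (f v)\<^sup>2 \<le> D x) \<and> (\<forall>x. 0 \<le> D x) \<and> integrable (piM phi) (\<lambda>x. D x * ?w x)"
      if f: "f \<in> {?d3, \<lambda>x. ?d2 x * ?d1 x, \<lambda>x. (?d1 x)^3, \<lambda>x. ?d2 x * \<bar>?d1 x\<bar> powr (1 + \<beta>)}" for f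
    proof -
      from F[OF f] obtain K where f_int: "integrable (piM phi) (\<lambda>x. \<bar>f x\<bar> powr (2 + \<epsilon>) * ?w x)"
        and K: "integrable (piM phi) (\<lambda>x. (K x)^2 * ?w x)"
          "\<And>x \<delta>. \<bar>f (x + \<delta>) - f x\<bar> \<le> K x * max (\<bar>\<delta>\<bar> powr H) (\<bar>\<delta>\<bar> powr \<gamma>)" by blast
      have [measurable]: "f \<in> borel_measurable borel" using f by auto
      \<comment> \<open>Testing the increment condition with \<delta> = 1 shows that K is
        nonnegative.\<close>
      have K0: "K x \<ge> 0" for x using order_trans[OF abs_ge_zero K(2)[of x 1]] by simp
      have sq_int: "integrable (piM phi) (\<lambda>x. (f x)\<^sup>2 * ?w x)"
      proof (rule Bochner_Integration.integrable_bound)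
        show "integrable (piM phi) (\<lambda>x. ?w x + \<bar>f x\<bar> powr (2 + \<epsilon>) * ?w x)"
          by (intro Bochner_Integration.integrable_add[OF w_int f_int])
        show "AE x in piM phi. norm ((f x)\<^sup>2 * ?w x) \<le> norm (?w x + \<bar>f x\<bar> powr (2 + \<epsilon>) * ?w x)"
        proof (rule AE_I2)
          fix x
          have "(f x)\<^sup>2 \<le> 1 + \<bar>f x\<bar> powr (2 + \<epsilon>)"
          proof (cases "\<bar>f x\<bar> \<le> 1")
            case True
            then have "\<bar>f x\<bar>\<^sup>2 \<le> 1" by (intro power_le_one) auto
            then show ?thesis by (simp add: add_increasing2)
          next
            case False
            then have "\<bar>f x\<bar>\<^sup>2 = \<bar>f x\<bar> powr 2" by (simp add: powr_numeral)
            also have "\<dots> \<le> \<bar>f x\<bar> powr (2 + \<epsilon>)" using False H by (intro powr_mono) auto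
            finally show ?thesis by simp
          qed
          then have "(f x)\<^sup>2 * ?w x \<le> (1 + \<bar>f x\<bar> powr (2 + \<epsilon>)) * ?w x" using w1[of x] by (intro mult_right_mono) auto
          then show "norm ((f x)\<^sup>2 * ?w x) \<le> norm (?w x + \<bar>f x\<bar> powr (2 + \<epsilon>) * ?w x)"
            using w1[of x] by (simp add: distrib_right abs_mult)
        qed
      qed measurable
      have "(f v)\<^sup>2 \<le> 2 * (f x)\<^sup>2 + 2 * (K x)\<^sup>2" if "\<bar>v - x\<bar> \<le> 1" for x v
      proof -
        have "\<bar>f v - f x\<bar> \<le> K x * max (\<bar>v - x\<bar> powr H) (\<bar>v - x\<bar> powr \<gamma>)" using K(2)[of x "v - x"] by simp
        also have "\<dots> \<le> K x * 1" using that H K0 by (intro mult_left_mono) (auto simp: powr_le1)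
        finally have "\<bar>f v - f x\<bar>\<^sup>2 \<le> (K x)\<^sup>2" by (intro power_mono) auto
        moreover have "(f v)\<^sup>2 \<le> 2 * (f x)\<^sup>2 + 2 * (f v - f x)\<^sup>2"
          using zero_le_power2[of "f v - 2 * f x"] by (simp add: power2_eq_square algebra_simps)
        ultimately show ?thesis by simp
      qed
      moreover have "integrable (piM phi) (\<lambda>x. (2 * (f x)\<^sup>2 + 2 * (K x)\<^sup>2) * ?w x)"
      proof -
        have "integrable (piM phi) (\<lambda>x. 2 * ((f x)\<^sup>2 * ?w x) + 2 * ((K x)\<^sup>2 * ?w x))"
          by (intro Bochner_Integration.integrable_add integrable_mult_right sq_int K(1))
        moreover have "2 * ((f x)\<^sup>2 * ?w x) + 2 * ((K x)\<^sup>2 * ?w x) = (2 * (f x)\<^sup>2 + 2 * (K x)\<^sup>2) * ?w x" for x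
          by (simp add: distrib_right mult.assoc)
        ultimately show ?thesis by simp
      qed
      ultimately show ?thesis by (intro exI[of _ "\<lambda>x. 2 * (f x)\<^sup>2 + 2 * (K x)\<^sup>2"]) auto
    qed
    obtain D3 where D3: "\<And>x v. \<bar>v - x\<bar> \<le> 1 \<Longrightarrow> (?d3 v)\<^sup>2 \<le> D3 x" "\<And>x. 0 \<le> D3 x" "integrable (piM phi) (\<lambda>x. D3 x * ?w x)"
      using local_bound[of ?d3] by auto
    obtain D2 where D2: "\<And>x v. \<bar>v - x\<bar> \<le> 1 \<Longrightarrow> (?d2 v * ?d1 v)\<^sup>2 \<le> D2 x" "\<And>x. 0 \<le> D2 x" "integrable (piM phi) (\<lambda>x. D2 x * ?w x)"
      using local_bound[of "\<lambda>x. ?d2 x * ?d1 x"] by auto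
    obtain D4 where D4: "\<And>x v. \<bar>v - x\<bar> \<le> 1 \<Longrightarrow> (?d2 v * \<bar>?d1 v\<bar> powr (1 + \<beta>))\<^sup>2 \<le> D4 x" "\<And>x. 0 \<le> D4 x"
        "integrable (piM phi) (\<lambda>x. D4 x * ?w x)"
      using local_bound[of "\<lambda>x. ?d2 x * \<bar>?d1 x\<bar> powr (1 + \<beta>)"] by auto
    \<comment> \<open>The summand 1 makes the envelope at least 1, which lets it multiply bounds
      that do not depend on x.\<close>
    define dom where "dom = (\<lambda>x. 1 + D3 x + D2 x + D4 x)"
    have dom_int: "integrable (piM phi) (\<lambda>x. dom x * ?w x)"
    proof -
      have "integrable (piM phi) (\<lambda>x. ?w x + D3 x * ?w x + D2 x * ?w x + D4 x * ?w x)"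
        by (intro Bochner_Integration.integrable_add[OF Bochner_Integration.integrable_add[OF Bochner_Integration.integrable_add]] w_int D3 D2 D4)
      moreover have "?w x + D3 x * ?w x + D2 x * ?w x + D4 x * ?w x = dom x * ?w x" for x
        unfolding dom_def by (simp only: distrib_right mult_1_left)
      ultimately show ?thesis by simp
    qed
    have refl: "bfun g u = u + bfun g (- u)" for u
    proof -
      have "ln (g (exp u)) = ln (exp u * g (1 / exp u))" using g(3)[of "exp u"] by simp
      also have "\<dots> = u + ln (g (exp (- u)))"
        using g(2)[of "exp (- u)"] by (subst ln_mult_pos) (auto simp: exp_minus divide_inverse)
      finally show ?thesis by (simp add: bfun_def)
    qed
    have "mh_chain g mu M C \<beta> \<xi> phi dom"
    proof (intro mh_chain.intro mh_target.intro balanced_proposal.intro mh_target_axioms.intro mh_chain_axioms.intro)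
      show "continuous_on UNIV (deriv (deriv (bfun g)))"
        by (rule DERIV_continuous_on[OF B(3)[THEN DERIV_subset]]) simp
      show "bfun g 0 = 0" by (simp add: bfun_def g)
      show "bfun g u = u + bfun g (- u)" for u by (rule refl)
      show "1 \<le> dom x" for x using D3(2)[of x] D2(2)[of x] D4(2)[of x] by (simp add: dom_def)
      show "(?d3 v)\<^sup>2 \<le> dom x" if "\<bar>v - x\<bar> \<le> 1" for v x
        using D3(1)[OF that] D3(2)[of x] D2(2)[of x] D4(2)[of x] by (simp add: dom_def)
      show "(?d1 v * ?d2 v)\<^sup>2 \<le> dom x" if "\<bar>v - x\<bar> \<le> 1" for v x
        using D2(1)[OF that] D3(2)[of x] D2(2)[of x] D4(2)[of x] by (simp add: dom_def mult.commute)
      show "(?d2 v * \<bar>?d1 v\<bar> powr (1 + \<beta>))\<^sup>2 \<le> dom x" if "\<bar>v - x\<bar> \<le> 1" for v x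
        using D4(1)[OF that] D3(2)[of x] D2(2)[of x] D4(2)[of x] by (simp add: dom_def)
    qed (rule dens mu_prob mu_sets mu_symm mu_centred var H C B P xi g(2) dom_int | assumption)+
    then show ?case by blast
  qed
qed

theorem theorem3:
  fixes phi g :: "real \<Rightarrow> real" and mu :: "real measure" and \<sigma> :: "nat \<Rightarrow> real"
  assumes dens: "(\<integral>\<^sup>+x. ennreal (exp (phi x)) \<partial>lborel) = 1"
    and bal: "balancing g"
    and mu_prob: "prob_space mu" and mu_sets: "sets mu = sets borel"
    and mu_symm: "distr mu borel uminus = mu"
    and mu_centred: "integrable mu (\<lambda>z. z)" "(\<integral>z. z \<partial>mu) = 0"
    and A1: "Assumption1 phi g mu"
    and theta_pos: "theta phi g mu > 0"
    and sigma_pos: "\<forall>n. \<sigma> n > 0"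
    and sigma_lim: "\<sigma> \<longlonglongrightarrow> 0"
  shows
    "(((\<lambda>n. real n powr (1/6) * \<sigma> n) \<longlonglongrightarrow> 0 \<or>
       filterlim (\<lambda>n. real n powr (1/6) * \<sigma> n) at_top sequentially) \<longrightarrow>
        (\<lambda>n. real n powr (1/3) * En g mu phi (\<sigma> n) n) \<longlonglongrightarrow> 0)
     \<and>
     (\<forall>l. 0 < l \<and> (\<lambda>n. real n powr (1/6) * \<sigma> n) \<longlonglongrightarrow> l \<longrightarrow>
        (\<lambda>n. real n powr (1/3) * En g mu phi (\<sigma> n) n) \<longlonglongrightarrow> hfun (theta phi g mu) l)
     \<and>
     (\<exists>!l. 0 < l \<and> (\<forall>l'>0. hfun (theta phi g mu) l' \<le> hfun (theta phi g mu) l))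
     \<and>
     (\<exists>!s. 0 < s \<and> s * std_normal_density s / Phi (- s) = 2/3)
     \<and>
     (\<forall>l s. 0 < l \<and> (\<forall>l'>0. hfun (theta phi g mu) l' \<le> hfun (theta phi g mu) l) \<and>
            0 < s \<and> s * std_normal_density s / Phi (- s) = 2/3 \<longrightarrow>
        l^3 * theta phi g mu / 2 = s \<and>
        ((\<lambda>n. real n powr (1/6) * \<sigma> n) \<longlonglongrightarrow> l \<longrightarrow>
           (\<lambda>n. Accn g mu phi (\<sigma> n) n) \<longlonglongrightarrow> 2 * Phi (- s)) \<and>
        0.5735 \<le> 2 * Phi (- s) \<and> 2 * Phi (- s) \<le> 0.5745 \<and>
        hfun (theta phi g mu) l
          = 2 powr (5/3) * s powr (2/3) * Phi (- s) * theta phi g mu powr (- 2/3))"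
proof -
  let ?th = "theta phi g mu"
  obtain M C \<beta> \<xi> dom where "mh_chain g mu M C \<beta> \<xi> phi dom"
    using mh_chain_exists[OF dens bal mu_prob mu_sets mu_symm mu_centred(2) A1] by blast
  then interpret mh_chain g mu M C \<beta> \<xi> phi dom .
  \<comment> \<open>The uniform bounds need scales at most 1. Since \<sigma> tends to 0, truncation
    changes only finitely many terms and no limit.\<close>
  define s where "s = (\<lambda>n. min (\<sigma> n) 1)"
  have ev: "\<forall>\<^sub>F n in sequentially. s n = \<sigma> n"
    using order_tendstoD(2)[OF sigma_lim zero_less_one] by eventually_elim (auto simp: s_def)
  have s: "\<And>n. 0 < s n" "\<And>n. s n \<le> 1" using sigma_pos by (auto simp: s_def)
  have s_lim: "s \<longlonglongrightarrow> 0" using sigma_lim tendsto_cong[OF ev] by simp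
  note s = s s_lim
  have scale_cong: "((\<lambda>n. real n powr (1/6) * \<sigma> n) \<longlonglongrightarrow> l) = ((\<lambda>n. real n powr (1/6) * s n) \<longlonglongrightarrow> l)" for l
    by (rule tendsto_cong) (use ev in \<open>eventually_elim, simp\<close>)
  have top_cong: "filterlim (\<lambda>n. real n powr (1/6) * \<sigma> n) at_top sequentially = filterlim (\<lambda>n. real n powr (1/6) * s n) at_top sequentially"
    by (rule filterlim_cong[OF refl refl]) (use ev in \<open>eventually_elim, simp\<close>)
  have En_cong: "((\<lambda>n. real n powr (1/3) * En g mu phi (\<sigma> n) n) \<longlonglongrightarrow> a) = ((\<lambda>n. real n powr (1/3) * En g mu phi (s n) n) \<longlonglongrightarrow> a)" for a
    by (rule tendsto_cong) (use ev in \<open>eventually_elim, simp\<close>)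
  have Acc_cong: "((\<lambda>n. Accn g mu phi (\<sigma> n) n) \<longlonglongrightarrow> a) = ((\<lambda>n. Accn g mu phi (s n) n) \<longlonglongrightarrow> a)" for a
    by (rule tendsto_cong) (use ev in \<open>eventually_elim, simp\<close>)
  have h0: "hfun ?th 0 = 0" by (simp add: hfun_def)
  obtain s0 where s0: "0 < s0" "hazard_ratio s0 = 2/3" "\<And>s'. 0 < s' \<Longrightarrow> hazard_ratio s' = 2/3 \<Longrightarrow> s' = s0"
    "0.5735 \<le> 2 * Phi (- s0)" "2 * Phi (- s0) \<le> 0.5745"
    by (rule hazard_ratio_solution) blast
  define l0 where "l0 = root 3 (2 * s0 / ?th)"
  note max = hfun_maximiser[OF theta_pos s0(1,2), folded l0_def]
  have max_le: "hfun ?th l' \<le> hfun ?th l0" if "l' > 0" for l' using max(3)[OF that] by (cases "l' = l0") auto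
  have l_uniq: "l = l0" if "0 < l" "\<forall>l'>0. hfun ?th l' \<le> hfun ?th l" for l
    using max(3)[OF that(1)] that(2) max(1) by force
  show ?thesis
  proof (intro conjI allI impI)
    assume "(\<lambda>n. real n powr (1/6) * \<sigma> n) \<longlonglongrightarrow> 0 \<or> filterlim (\<lambda>n. real n powr (1/6) * \<sigma> n) at_top sequentially"
    then show "(\<lambda>n. real n powr (1/3) * En g mu phi (\<sigma> n) n) \<longlonglongrightarrow> 0"
      unfolding scale_cong top_cong En_cong
      using En_limit(1)[OF s theta_pos, of 0] En_limit_infinity[OF s theta_pos] h0 by auto
  next
    fix l assume "0 < l \<and> (\<lambda>n. real n powr (1/6) * \<sigma> n) \<longlonglongrightarrow> l"
    then show "(\<lambda>n. real n powr (1/3) * En g mu phi (\<sigma> n) n) \<longlonglongrightarrow> hfun ?th l"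
      unfolding scale_cong En_cong using En_limit(1)[OF s theta_pos] by simp
  next
    show "\<exists>!l. 0 < l \<and> (\<forall>l'>0. hfun ?th l' \<le> hfun ?th l)"
    proof (rule ex1I[of _ l0])
      show "0 < l0 \<and> (\<forall>l'>0. hfun ?th l' \<le> hfun ?th l0)" using max(1) max_le by blast
    qed (use l_uniq in blast)
  next
    show "\<exists>!s. 0 < s \<and> s * std_normal_density s / Phi (- s) = 2/3"
      using s0(1-3) unfolding hazard_ratio_def by (intro ex1I[of _ s0]) blast+
  next
    fix l t
    assume lt: "0 < l \<and> (\<forall>l'>0. hfun ?th l' \<le> hfun ?th l) \<and> 0 < t \<and> t * std_normal_density t / Phi (- t) = 2/3"
    have l: "l = l0" using lt by (intro l_uniq) blast+
    have t: "t = s0" using lt by (intro s0(3)) (simp_all only: hazard_ratio_def)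
    show eq: "l ^ 3 * ?th / 2 = t" unfolding l t by (rule max(2))
    show "(\<lambda>n. Accn g mu phi (\<sigma> n) n) \<longlonglongrightarrow> 2 * Phi (- t)" if "(\<lambda>n. real n powr (1/6) * \<sigma> n) \<longlonglongrightarrow> l"
      using En_limit(2)[OF s theta_pos, of l] that lt unfolding scale_cong Acc_cong eq by simp
    show "0.5735 \<le> 2 * Phi (- t)" "2 * Phi (- t) \<le> 0.5745" unfolding t by (rule s0)+
    show "hfun ?th l = 2 powr (5/3) * t powr (2/3) * Phi (- t) * ?th powr (- 2/3)"
      using lt by (intro hfun_max_value[OF theta_pos _ eq]) simp
  qed
qed

end
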